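(* Let $X\subset\widehat A$ be an $H$-invariant Borel set and $\mathcal H=\mathcal H_X\subset L^2(A)$. Then there exists an admissible vector for $\mathcal H$ if and only if there exists a weakly admissible vector for $\mathcal H$ and, in addition, either (1) $G$ is not unimodular, or (2) $G$ is unimodular and $\overline\lambda(X/H)<\infty$, where $\overline\lambda$ is the $\sigma$-finite measure on $X/H$ such that $\lambda(B)=\int_{X/H}\mu_{\mathcal O}(B)\,d\overline\lambda(\mathcal O)$ for all Borel $B\subset X$ (with $\lambda$ Haar measure on $\widehat A$ restricted to $X$).
   Context: $A$ is a second countable locally compact abelian group with Haar measure $dx$. $H$ is a group of topological automorphisms of $A$, endowed with a second countable locally compact group topology such that $(h,x)\mapsto h(x)$ is continuous; $dh$, $|\cdot|$ denote left Haar measure on $H$. $\delta(h)=|h(B)|/|B|$ for Borel $B\subset A$ of positive finite measure. $G=A\rtimes H$ with product $(a,h)(b,g)=(a+h(b),hg)$, left Haar measure $dx\,dh/\delta(h)$ and modular function $\Delta_G(a,h)=\Delta_H(h)/\delta(h)$. The quasi-regular representation is $\pi(a,h)f(t)=\delta(h)^{-1/2}f(h^{-1}(t-a))$ on $L^2(A)$, and $V_\psi f(a,h)=\langle f,\pi(a,h)\psi\rangle$. For a closed $\pi$-invariant subspace $\mathcal H$, $\psi\in\mathcal H$ is weakly admissible if $f\mapsto V_\psi f$ is a well-defined bounded injective map $\mathcal H\to L^2(G)$, and admissible if it is an isometry. $\widehat A$ is the dual group with Haar measure normalized so that the Fourier transform extends to a unitary $L^2(A)\to L^2(\widehat A)$;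 $H$ acts on it by $(\xi.h)(x)=\xi(h(x))$; $H_\xi$ is the stabilizer. $\mathcal H_X=\{f\in L^2(A):\widehat f\mathbf 1_X=\widehat f\}$. $X/H$ is the orbit space with quotient Borel structure. For an orbit $\mathcal O=\xi.H$ with compact $H_\xi$, $\mu_{\mathcal O}(B)=|\{h\in H:\xi.h\in B\}|$. (When $G$ is unimodular and a weakly admissible vector exists, almost all stabilizers are compact and a $\sigma$-finite $\overline\lambda$ as in (2) exists.) *)

theory Defs
  imports "HOL-Analysis.Analysis"
begin

definition borel_of_top :: "'b topology \<Rightarrow> 'b measure" where
  "borel_of_top T = sigma (topspace T) {U. openin T U}"

text \<open>A is modelled by a type 'a of class topological_ab_group_add (Hausdorff by t2_space),
  second countable and locally compact.  dx is a Haar measure on A.\<close>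

definition is_haar_A :: "'a::{topological_ab_group_add,t2_space} measure \<Rightarrow> bool" where
  "is_haar_A dx \<longleftrightarrow> sets dx = sets borel \<and>
     (\<forall>a. \<forall>B\<in>sets dx. emeasure dx ((\<lambda>x. a + x) ` B) = emeasure dx B) \<and>
     (\<forall>K. compact K \<longrightarrow> emeasure dx K < \<infinity>) \<and>
     (\<forall>U. open U \<and> U \<noteq> {} \<longrightarrow> emeasure dx U > 0)"

definition characters :: "('a::{topological_ab_group_add}) itself \<Rightarrow> ('a \<Rightarrow> complex) set" where
  "characters _ = {c. continuous_on UNIV c \<and> (\<forall>x. cmod (c x) = 1) \<and>
                      (\<forall>x y. c (x + y) = c x * c y)}"

definition dual_topology :: "('a::{topological_ab_group_add}) itself \<Rightarrow> ('a \<Rightarrow> complex) topology" where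
  "dual_topology T = topology_generated_by
     {{c \<in> characters T. c ` K \<subseteq> U} | K U. compact K \<and> open U}"

definition fourier :: "'a measure \<Rightarrow> ('a \<Rightarrow> complex) \<Rightarrow> ('a \<Rightarrow> complex) \<Rightarrow> complex" where
  "fourier dx f \<xi> = (\<integral>x. f x * cnj (\<xi> x) \<partial>dx)"

definition L2 :: "'b measure \<Rightarrow> ('b \<Rightarrow> complex) set" where
  "L2 M = {f. f \<in> borel_measurable M \<and> integrable M (\<lambda>x. (cmod (f x))\<^sup>2)}"

definition L2norm_sq :: "'b measure \<Rightarrow> ('b \<Rightarrow> complex) \<Rightarrow> ennreal" where
  "L2norm_sq M f = (\<integral>\<^sup>+x. ennreal ((cmod (f x))\<^sup>2) \<partial>M)"

text \<open>Haar measure on the dual group, normalised so that the Fourier transform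
  is isometric from L1 \<inter> L2 (hence extends to a unitary L2(A) \<rightarrow> L2(dual)).\<close>
definition is_plancherel_dual_haar ::
  "'a::{topological_ab_group_add,t2_space} measure \<Rightarrow> ('a \<Rightarrow> complex) measure \<Rightarrow> bool" where
  "is_plancherel_dual_haar dx lam \<longleftrightarrow>
     sets lam = sets (borel_of_top (dual_topology TYPE('a))) \<and>
     space lam = characters TYPE('a) \<and>
     (\<forall>c\<in>characters TYPE('a). \<forall>B\<in>sets lam.
         emeasure lam ((\<lambda>\<eta> x. c x * \<eta> x) ` B) = emeasure lam B) \<and>
     (\<forall>K. compactin (dual_topology TYPE('a)) K \<longrightarrow> emeasure lam K < \<infinity>) \<and>
     (\<forall>U. openin (dual_topology TYPE('a)) U \<and> U \<noteq> {} \<longrightarrow> emeasure lam U > 0) \<and>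
     (\<forall>f. f \<in> L2 dx \<and> integrable dx f \<longrightarrow>
         L2norm_sq lam (fourier dx f) = L2norm_sq dx f)"

definition is_L2_fourier ::
  "'a measure \<Rightarrow> ('a \<Rightarrow> complex) measure \<Rightarrow> ('a \<Rightarrow> complex) \<Rightarrow> (('a \<Rightarrow> complex) \<Rightarrow> complex) \<Rightarrow> bool" where
  "is_L2_fourier dx lam f F \<longleftrightarrow> F \<in> L2 lam \<and>
     (\<exists>g::nat \<Rightarrow> 'a \<Rightarrow> complex. (\<forall>n. g n \<in> L2 dx \<and> integrable dx (g n)) \<and>
        ((\<lambda>n. L2norm_sq dx (\<lambda>x. g n x - f x)) \<longlonglongrightarrow> 0) \<and>
        ((\<lambda>n. L2norm_sq lam (\<lambda>\<xi>. fourier dx (g n) \<xi> - F \<xi>)) \<longlonglongrightarrow> 0))"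

definition HX :: "'a measure \<Rightarrow> ('a \<Rightarrow> complex) measure \<Rightarrow> ('a \<Rightarrow> complex) set \<Rightarrow> ('a \<Rightarrow> complex) set" where
  "HX dx lam X = {f \<in> L2 dx. \<exists>F. is_L2_fourier dx lam f F \<and>
                                   (AE \<xi> in lam. \<xi> \<notin> X \<longrightarrow> F \<xi> = 0)}"

definition is_auto_group ::
  "('a::{topological_ab_group_add,t2_space} \<Rightarrow> 'a) set \<Rightarrow> ('a \<Rightarrow> 'a) topology \<Rightarrow> bool" where
  "is_auto_group HH TH \<longleftrightarrow>
     topspace TH = HH \<and>
     (\<forall>h\<in>HH. bij h \<and> homeomorphism UNIV UNIV h (inv h) \<and> (\<forall>x y. h (x + y) = h x + h y)) \<and>
     id \<in> HH \<and> (\<forall>g\<in>HH. \<forall>h\<in>HH. g \<circ> h \<in> HH) \<and> (\<forall>h\<in>HH. inv h \<in> HH) \<and>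
     continuous_map (prod_topology TH TH) TH (\<lambda>(g, h). g \<circ> h) \<and>
     continuous_map TH TH inv \<and>
     Hausdorff_space TH \<and> locally_compact_space TH \<and> second_countable TH \<and>
     continuous_map (prod_topology TH euclidean) euclidean (\<lambda>(h, x). h x)"

definition is_left_haar_H :: "('a \<Rightarrow> 'a) set \<Rightarrow> ('a \<Rightarrow> 'a) topology \<Rightarrow> ('a \<Rightarrow> 'a) measure \<Rightarrow> bool" where
  "is_left_haar_H HH TH dh \<longleftrightarrow>
     sets dh = sets (borel_of_top TH) \<and> space dh = HH \<and>
     (\<forall>h\<in>HH. \<forall>B\<in>sets dh. emeasure dh ((\<lambda>g. h \<circ> g) ` B) = emeasure dh B) \<and>
     (\<forall>K. compactin TH K \<longrightarrow> emeasure dh K < \<infinity>) \<and>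
     (\<forall>U. openin TH U \<and> U \<noteq> {} \<longrightarrow> emeasure dh U > 0)"

definition delta :: "'a measure \<Rightarrow> ('a \<Rightarrow> 'a) \<Rightarrow> real" where
  "delta dx h = (let B = (SOME B. B \<in> sets dx \<and> 0 < emeasure dx B \<and> emeasure dx B < \<infinity>)
                 in measure dx (h ` B) / measure dx B)"

definition modular_H :: "('a \<Rightarrow> 'a) measure \<Rightarrow> ('a \<Rightarrow> 'a) \<Rightarrow> real" where
  "modular_H dh h = (let B = (SOME B. B \<in> sets dh \<and> 0 < emeasure dh B \<and> emeasure dh B < \<infinity>)
                 in measure dh ((\<lambda>g. g \<circ> h) ` B) / measure dh B)"

definition haar_G :: "'a measure \<Rightarrow> ('a \<Rightarrow> 'a) measure \<Rightarrow> ('a \<times> ('a \<Rightarrow> 'a)) measure" where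
  "haar_G dx dh = density (dx \<Otimes>\<^sub>M dh) (\<lambda>(a, h). ennreal (1 / delta dx h))"

definition modular_G :: "'a measure \<Rightarrow> ('a \<Rightarrow> 'a) measure \<Rightarrow> 'a \<times> ('a \<Rightarrow> 'a) \<Rightarrow> real" where
  "modular_G dx dh = (\<lambda>(a, h). modular_H dh h / delta dx h)"

definition unimodular_G :: "('a \<Rightarrow> 'a) set \<Rightarrow> 'a measure \<Rightarrow> ('a \<Rightarrow> 'a) measure \<Rightarrow> bool" where
  "unimodular_G HH dx dh \<longleftrightarrow> (\<forall>a. \<forall>h\<in>HH. modular_G dx dh (a, h) = 1)"

definition quasi_reg :: "'a::ab_group_add measure \<Rightarrow> 'a \<Rightarrow> ('a \<Rightarrow> 'a) \<Rightarrow> ('a \<Rightarrow> complex) \<Rightarrow> 'a \<Rightarrow> complex" where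
  "quasi_reg dx a h f t = complex_of_real (delta dx h powr (-1/2)) * f (inv h (t - a))"

definition coeff_map :: "'a::ab_group_add measure \<Rightarrow> ('a \<Rightarrow> complex) \<Rightarrow> ('a \<Rightarrow> complex) \<Rightarrow> 'a \<times> ('a \<Rightarrow> 'a) \<Rightarrow> complex" where
  "coeff_map dx \<psi> f = (\<lambda>(a, h). \<integral>t. f t * cnj (quasi_reg dx a h \<psi> t) \<partial>dx)"

definition weakly_admissible ::
  "'a::ab_group_add measure \<Rightarrow> ('a \<Rightarrow> 'a) measure \<Rightarrow> ('a \<Rightarrow> complex) set \<Rightarrow> ('a \<Rightarrow> complex) \<Rightarrow> bool" where
  "weakly_admissible dx dh \<H> \<psi> \<longleftrightarrow> \<psi> \<in> \<H> \<and>
     (\<forall>f\<in>\<H>. coeff_map dx \<psi> f \<in> L2 (haar_G dx dh)) \<and>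
     (\<exists>C::real. \<forall>f\<in>\<H>. L2norm_sq (haar_G dx dh) (coeff_map dx \<psi> f) \<le> ennreal C * L2norm_sq dx f) \<and>
     (\<forall>f\<in>\<H>. \<forall>g\<in>\<H>. (AE p in haar_G dx dh. coeff_map dx \<psi> f p = coeff_map dx \<psi> g p)
                     \<longrightarrow> (AE x in dx. f x = g x))"

definition admissible ::
  "'a::ab_group_add measure \<Rightarrow> ('a \<Rightarrow> 'a) measure \<Rightarrow> ('a \<Rightarrow> complex) set \<Rightarrow> ('a \<Rightarrow> complex) \<Rightarrow> bool" where
  "admissible dx dh \<H> \<psi> \<longleftrightarrow> \<psi> \<in> \<H> \<and>
     (\<forall>f\<in>\<H>. coeff_map dx \<psi> f \<in> L2 (haar_G dx dh)) \<and>
     (\<forall>f\<in>\<H>. L2norm_sq (haar_G dx dh) (coeff_map dx \<psi> f) = L2norm_sq dx f)"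

definition orbit :: "('a \<Rightarrow> 'a) set \<Rightarrow> ('a \<Rightarrow> complex) \<Rightarrow> ('a \<Rightarrow> complex) set" where
  "orbit HH \<xi> = {\<xi> \<circ> h | h. h \<in> HH}"

definition orbits :: "('a \<Rightarrow> 'a) set \<Rightarrow> ('a \<Rightarrow> complex) set \<Rightarrow> ('a \<Rightarrow> complex) set set" where
  "orbits HH X = orbit HH ` X"

definition orbit_sets ::
  "('a \<Rightarrow> 'a) set \<Rightarrow> ('a \<Rightarrow> complex) measure \<Rightarrow> ('a \<Rightarrow> complex) set \<Rightarrow> ('a \<Rightarrow> complex) set set set" where
  "orbit_sets HH lam X = {S. S \<subseteq> orbits HH X \<and> \<Union>S \<in> sets lam}"

definition orbit_measure ::
  "('a \<Rightarrow> 'a) set \<Rightarrow> ('a \<Rightarrow> 'a) measure \<Rightarrow> ('a \<Rightarrow> complex) set \<Rightarrow> ('a \<Rightarrow> complex) set \<Rightarrow> ennreal" where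
  "orbit_measure HH dh Orb B = (let \<xi> = (SOME \<xi>. \<xi> \<in> Orb \<and> Orb = orbit HH \<xi>)
                              in emeasure dh {h \<in> HH. \<xi> \<circ> h \<in> B})"

definition is_orbit_disintegration ::
  "('a \<Rightarrow> 'a) set \<Rightarrow> ('a \<Rightarrow> 'a) measure \<Rightarrow> ('a \<Rightarrow> complex) measure \<Rightarrow> ('a \<Rightarrow> complex) set
    \<Rightarrow> ('a \<Rightarrow> complex) set measure \<Rightarrow> bool" where
  "is_orbit_disintegration HH dh lam X lb \<longleftrightarrow>
     space lb = orbits HH X \<and> sets lb = orbit_sets HH lam X \<and> sigma_finite_measure lb \<and>
     (\<forall>B. B \<in> sets lam \<and> B \<subseteq> X \<longrightarrow>
        (\<lambda>Orb. orbit_measure HH dh Orb B) \<in> borel_measurable lb \<and>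
        emeasure lam B = (\<integral>\<^sup>+Orb. orbit_measure HH dh Orb B \<partial>lb))"

end

theory Submission
  imports Defs
begin

text \<open>
  Taking Fourier transforms in the variable of \<open>A\<close> turns the wavelet transform into multiplication:
  if \<open>F\<close> and \<open>P\<close> are the transforms of \<open>f\<close> and \<open>\<psi>\<close>, then \<open>\<parallel>V\<^sub>\<psi> f\<parallel>\<^sup>2 = \<integral> |F|\<^sup>2 W P\<close> with the
  Calderon function \<open>W P (\<xi>) = \<integral> |P (\<xi>.h)|\<^sup>2 dh\<close>. Hence \<open>\<psi>\<close> is admissible iff \<open>W P = 1\<close> almost
  everywhere on \<open>X\<close>, and a weakly admissible \<open>\<psi>\<close> has \<open>0 < W P < \<infinity>\<close>. As \<open>W P\<close> is constant on orbits,
  \<open>P / sqrt (W P)\<close> has Calderon function \<open>1\<close>; the only question is whether it, or a modification of it,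
  is square-integrable. If \<open>G\<close> is not unimodular, translating by suitable elements of \<open>H\<close> makes the norms
  of the pieces on which \<open>W P\<close> is of fixed size summable. If \<open>G\<close> is unimodular, the squared norm of any
  \<open>P\<close> with \<open>W P = 1\<close> is the total mass of the disintegrating measure on \<open>X/H\<close>.

  The Fourier transform is onto because its range is a closed subspace that is stable under multiplication
  by the characters \<open>\<xi> \<mapsto> \<xi> a\<close>, hence under multiplication by all bounded measurable functions.\<close>

subsection \<open>Borel sets of abstract topologies\<close>

text \<open>\<open>delta\<close> and \<open>modular_H\<close> are read off from one arbitrarily
  chosen set, so nothing can be computed with them before Haar measures are known to be unique up to
  a factor. That uniqueness, the scaling of \<open>lam\<close> and the modular function of
  \<open>H\<close> all come from one Tonelli identity for measurable groups. The dual carries the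
  compact-open topology, in which measurability is hard to test; it is reduced to the evaluations
  \<open>\<xi> \<mapsto> \<xi> a\<close>. The dichotomy has a single source. Composing a function
  with the action of \<open>g\<close> multiplies its Calderon function by
  \<open>1 / modular_H dh g\<close> and its squared norm by \<open>1 / delta dx g\<close>. At fixed
  Calderon function the squared norm therefore changes by
  \<open>modular_H dh g / delta dx g\<close>, the modular function of \<open>G\<close>. This is a
  homomorphism into the positive reals: it either takes arbitrarily small values, so that norms can
  be made as small as desired, or it is constantly 1 and the norm is rigid. In the rigid case the
  factors produced by \<open>\<xi> \<mapsto> \<xi> \<circ> h\<close> and by
  \<open>h \<mapsto> inv h\<close> cancel, which turns the squared norm into a mass on the orbit
  space.\<close>

lemma sets_borel_of_top: "sets (borel_of_top T) = sigma_sets (topspace T) {U. openin T U}"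
  unfolding borel_of_top_def by (intro sets_measure_of) (auto dest: openin_subset)

lemma space_borel_of_top [simp]: "space (borel_of_top T) = topspace T"
  unfolding borel_of_top_def by (intro space_measure_of) (auto dest: openin_subset)

lemma openin_imp_sets_borel_of_top: "openin T U \<Longrightarrow> U \<in> sets (borel_of_top T)"
  unfolding sets_borel_of_top by auto

lemma sets_borel_of_top_euclidean: "sets (borel_of_top euclidean) = sets borel"
  unfolding sets_borel_of_top borel_def by (simp add: sets_measure_of)

lemma second_countable_euclidean:
  "second_countable (euclidean :: 'b::second_countable_topology topology)"
proof -
  obtain B :: "'b set set" where B: "countable B" "topological_basis B"
    using ex_countable_basis by blast
  show ?thesis
    unfolding second_countable_def
  proof (intro exI[of _ B] conjI allI impI ballI)
    fix V assume "V \<in> B"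
    then show "openin euclidean V" using B(2) by (simp add: topological_basis_open)
  next
    fix U :: "'b set" and x assume "openin euclidean U \<and> x \<in> U"
    then have U: "open U" "x \<in> U" by simp_all
    show "\<exists>V\<in>B. x \<in> V \<and> V \<subseteq> U" by (rule topological_basisE[OF B(2) U]) (rule bexI, rule conjI)
  qed (rule B(1))
qed

lemma second_countable_base:
  assumes "second_countable X"
  obtains \<B> where "countable \<B>" "\<And>V. V \<in> \<B> \<Longrightarrow> openin X V"
    "\<And>U x. openin X U \<Longrightarrow> x \<in> U \<Longrightarrow> \<exists>V \<in> \<B>. x \<in> V \<and> V \<subseteq> U"
proof -
  obtain \<B> where *: "countable \<B> \<and> (\<forall>V \<in> \<B>. openin X V) \<and>
      (\<forall>U x. openin X U \<and> x \<in> U \<longrightarrow> (\<exists>V \<in> \<B>. x \<in> V \<and> V \<subseteq> U))"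
    using assms unfolding second_countable_def by (rule exE)
  show thesis
    by (rule that[of \<B>]) (use * in simp_all)
qed

text \<open>When both factors are second countable, an open set of the product is a countable union
  of open rectangles. Hence continuous maps are measurable for the product sigma-algebra, which in
  general can be smaller than the Borel sets of the product. This yields the measurable group
  operations of \<open>H\<close> and the measurable action on \<open>A\<close>.\<close>

lemma measurable_borel_of_top_prod:
  assumes S: "second_countable S" and T: "second_countable T"
    and f: "continuous_map (prod_topology S T) U f"
  shows "f \<in> borel_of_top S \<Otimes>\<^sub>M borel_of_top T \<rightarrow>\<^sub>M borel_of_top U"
proof -
  obtain \<A> where A: "countable \<A>" "\<And>V. V \<in> \<A> \<Longrightarrow> openin S V"
    "\<And>U x. openin S U \<Longrightarrow> x \<in> U \<Longrightarrow> \<exists>V \<in> \<A>. x \<in> V \<and> V \<subseteq> U"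
    by (rule second_countable_base[OF S], rule that)
  obtain \<B> where B: "countable \<B>" "\<And>V. V \<in> \<B> \<Longrightarrow> openin T V"
    "\<And>U x. openin T U \<Longrightarrow> x \<in> U \<Longrightarrow> \<exists>V \<in> \<B>. x \<in> V \<and> V \<subseteq> U"
    by (rule second_countable_base[OF T], rule that)
  have op: "W \<in> sets (borel_of_top S \<Otimes>\<^sub>M borel_of_top T)" if W: "openin (prod_topology S T) W" for W
  proof -
    let ?C = "{(P,Q) \<in> \<A> \<times> \<B>. P \<times> Q \<subseteq> W}"
    have "W = (\<Union>(P,Q)\<in>?C. P \<times> Q)"
    proof (rule set_eqI)
      fix z show "z \<in> W \<longleftrightarrow> z \<in> (\<Union>(P,Q)\<in>?C. P \<times> Q)"
      proof
        assume z: "z \<in> W"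
        obtain x y where xy: "z = (x,y)" by (cases z)
        obtain P Q where PQ: "openin S P" "openin T Q" "x \<in> P" "y \<in> Q" "P \<times> Q \<subseteq> W"
          using iffD1[OF openin_prod_topology_alt W, rule_format, of x y] z unfolding xy by meson
        obtain P' Q' where "P' \<in> \<A>" "x \<in> P'" "P' \<subseteq> P" "Q' \<in> \<B>" "y \<in> Q'" "Q' \<subseteq> Q"
          using A(3)[OF PQ(1,3)] B(3)[OF PQ(2,4)] by blast
        then have "P' \<times> Q' \<subseteq> W" using PQ(5) by blast
        then have "(P', Q') \<in> ?C" "z \<in> P' \<times> Q'"
          using \<open>P' \<in> \<A>\<close> \<open>Q' \<in> \<B>\<close> \<open>x \<in> P'\<close> \<open>y \<in> Q'\<close> xy by auto
        then show "z \<in> (\<Union>(P,Q)\<in>?C. P \<times> Q)" by blast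
      qed auto
    qed
    moreover have "(\<Union>(P,Q)\<in>?C. P \<times> Q) \<in> sets (borel_of_top S \<Otimes>\<^sub>M borel_of_top T)"
    proof (rule sets.countable_UN')
      show "countable ?C" using A(1) B(1) by (auto intro: countable_subset[of _ "\<A> \<times> \<B>"])
      show "(\<lambda>(P,Q). P \<times> Q) ` ?C \<subseteq> sets (borel_of_top S \<Otimes>\<^sub>M borel_of_top T)"
        using A(2) B(2) by (auto intro!: pair_measureI openin_imp_sets_borel_of_top)
    qed
    ultimately show ?thesis by simp
  qed
  show ?thesis
  proof (rule measurable_sigma_sets[OF sets_borel_of_top])
    show "{V. openin U V} \<subseteq> Pow (topspace U)" by (auto dest: openin_subset)
    show "f \<in> space (borel_of_top S \<Otimes>\<^sub>M borel_of_top T) \<rightarrow> topspace U"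
      using f by (auto simp: space_pair_measure continuous_map_def)
    fix y assume "y \<in> {V. openin U V}"
    then have "openin (prod_topology S T) {z \<in> topspace (prod_topology S T). f z \<in> y}"
      by (intro openin_continuous_map_preimage[OF f]) simp
    moreover have "{z \<in> topspace (prod_topology S T). f z \<in> y}
        = f -` y \<inter> space (borel_of_top S \<Otimes>\<^sub>M borel_of_top T)"
      by (auto simp: space_pair_measure)
    ultimately show "f -` y \<inter> space (borel_of_top S \<Otimes>\<^sub>M borel_of_top T)
        \<in> sets (borel_of_top S \<Otimes>\<^sub>M borel_of_top T)"
      using op by simp
  qed
qed

lemma measurable_borel_of_top:
  assumes f: "continuous_map S U f"
  shows "f \<in> borel_of_top S \<rightarrow>\<^sub>M borel_of_top U"
proof (rule measurable_sigma_sets[OF sets_borel_of_top])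
  show "{V. openin U V} \<subseteq> Pow (topspace U)" by (auto dest: openin_subset)
  show "f \<in> space (borel_of_top S) \<rightarrow> topspace U"
    using f by (auto simp: continuous_map_def)
  fix y assume "y \<in> {V. openin U V}"
  then have "openin S {z \<in> topspace S. f z \<in> y}"
    by (intro openin_continuous_map_preimage[OF f]) simp
  moreover have "{z \<in> topspace S. f z \<in> y} = f -` y \<inter> space (borel_of_top S)"
    by auto
  ultimately show "f -` y \<inter> space (borel_of_top S) \<in> sets (borel_of_top S)"
    using openin_imp_sets_borel_of_top by metis
qed

text \<open>Every point has a compact neighbourhood; the members of a countable base that lie inside
  such neighbourhoods have finite measure and cover the space.\<close>

lemma sigma_finite_borel_of_top:
  assumes "second_countable T" "locally_compact_space T"
    and s: "sets M = sets (borel_of_top T)"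
    and K: "\<And>K. compactin T K \<Longrightarrow> emeasure M K < \<infinity>"
    and haus: "Hausdorff_space T"
  shows "sigma_finite_measure M"
proof
  have sp: "space M = topspace T" using sets_eq_imp_space_eq[OF s] by simp
  obtain \<B> where B: "countable \<B>" "\<And>V. V \<in> \<B> \<Longrightarrow> openin T V"
    "\<And>U x. openin T U \<Longrightarrow> x \<in> U \<Longrightarrow> \<exists>V \<in> \<B>. x \<in> V \<and> V \<subseteq> U"
    by (rule second_countable_base[OF assms(1)], rule that)
  define \<K> where KK: "\<K> = {V\<in>\<B>. emeasure M V < \<infinity>}"
  have un: "\<Union>\<K> = space M"
  proof
    show "\<Union>\<K> \<subseteq> space M" unfolding sp KK using openin_subset[OF B(2)] by blast
    show "space M \<subseteq> \<Union>\<K>"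
    proof
      fix x assume "x \<in> space M"
      then have "x \<in> topspace T" using sp by simp
      then have "\<exists>U C. openin T U \<and> compactin T C \<and> x \<in> U \<and> U \<subseteq> C"
        using assms(2) unfolding locally_compact_space_def by simp
      then obtain U C where UC: "openin T U" "compactin T C" "x \<in> U" "U \<subseteq> C" by blast
      obtain V where V: "V \<in> \<B>" "x \<in> V" "V \<subseteq> U" using B(3)[OF UC(1,3)] by blast
      have "emeasure M V < \<infinity>"
      proof -
        \<comment> \<open>Monotonicity of the measure asks for \<open>C\<close> to be measurable; a
          compact set is closed because the space is Hausdorff.\<close>
        have "closedin T C" using UC(2) assms(5) by (simp add: compactin_imp_closedin)
        then have "openin T (topspace T - C)" by (intro openin_diff openin_topspace)
        then have "topspace T - C \<in> sets M" using s openin_imp_sets_borel_of_top by auto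
        then have "space M - (topspace T - C) \<in> sets M" by (rule sets.compl_sets)
        moreover have "space M - (topspace T - C) = C"
          unfolding sp using compactin_subset_topspace[OF UC(2)] by blast
        ultimately have "C \<in> sets M" by simp
        then have "emeasure M V \<le> emeasure M C" using V(3) UC(4) by (intro emeasure_mono) auto
        then show ?thesis using K[OF UC(2)] by (rule le_less_trans)
      qed
      then show "x \<in> \<Union>\<K>" using V KK by auto
    qed
  qed
  show "\<exists>A. countable A \<and> A \<subseteq> sets M \<and> \<Union>A = space M \<and> (\<forall>a\<in>A. emeasure M a \<noteq> \<infinity>)"
  proof (intro exI[of _ \<K>] conjI)
    show "countable \<K>" unfolding KK using B(1) by auto
    show "\<K> \<subseteq> sets M" unfolding KK s using B(2) openin_imp_sets_borel_of_top by blast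
    show "\<forall>a\<in>\<K>. emeasure M a \<noteq> \<infinity>" unfolding KK by auto
  qed (rule un)
qed

subsection \<open>Sigma-finite measures\<close>

text \<open>Such a set is the yardstick for every proportionality constant below, and its existence
  makes the choices inside \<open>delta\<close> and \<open>modular_H\<close> meaningful.\<close>

lemma (in sigma_finite_measure) obtain_pos_finite_set:
  assumes "emeasure M (space M) \<noteq> 0"
  obtains B where "B \<in> sets M" "0 < emeasure M B" "emeasure M B < \<infinity>"
proof -
  obtain A :: "nat \<Rightarrow> 'a set" where A: "range A \<subseteq> sets M" "(\<Union>i. A i) = space M"
    "\<And>i. emeasure M (A i) \<noteq> \<infinity>"
    using sigma_finite by blast
  have "\<exists>i. emeasure M (A i) \<noteq> 0"
  proof (rule ccontr)
    assume "\<not> ?thesis"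
    then have "emeasure M (\<Union>i. A i) = 0" using A(1) by (intro emeasure_UN_eq_0) auto
    then show False using A(2) assms by simp
  qed
  then obtain i where "emeasure M (A i) \<noteq> 0" by blast
  then show thesis using A by (intro that[of "A i"]) (auto simp: less_top zero_less_iff_neq_zero)
qed

text \<open>Integrate over the part of the bad set \<open>v x < u x\<close> that lies in a set of
  finite measure. The bound \<open>c\<close> makes the integral of \<open>v\<close> finite there, so
  it can be cancelled, and \<open>u - v\<close> is left with integral zero; \<open>u\<close> itself
  may be infinite.\<close>

lemma (in sigma_finite_measure) AE_le_of_integral_le:
  fixes u v :: "'a \<Rightarrow> ennreal"
  assumes [measurable]: "u \<in> borel_measurable M" "v \<in> borel_measurable M" "Y \<in> sets M"
    and le: "\<And>B. B \<in> sets M \<Longrightarrow> B \<subseteq> Y \<Longrightarrow> emeasure M B < \<infinity> \<Longrightarrow>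
      (\<integral>\<^sup>+x. indicator B x * u x \<partial>M) \<le> (\<integral>\<^sup>+x. indicator B x * v x \<partial>M)"
    and c: "c < \<infinity>" "\<And>x. x \<in> Y \<Longrightarrow> v x < u x \<Longrightarrow> v x \<le> c"
  shows "AE x in M. x \<in> Y \<longrightarrow> u x \<le> v x"
proof -
  obtain A :: "nat \<Rightarrow> _" where A: "range A \<subseteq> sets M" "(\<Union>i. A i) = space M" "\<And>i. emeasure M (A i) \<noteq> \<infinity>"
    using sigma_finite by blast
  have Am [measurable]: "A i \<in> sets M" for i using A(1) by auto
  have YM: "Y \<subseteq> space M" by (rule sets.sets_into_space) measurable
  have "AE x in M. x \<in> A i \<longrightarrow> x \<in> Y \<longrightarrow> u x \<le> v x" for i
  proof -
    define B where "B = {x \<in> space M. x \<in> A i \<and> x \<in> Y \<and> v x < u x}"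
    have B [measurable]: "B \<in> sets M" unfolding B_def by measurable
    have "emeasure M B \<le> emeasure M (A i)" by (intro emeasure_mono) (auto simp: B_def)
    also have "\<dots> < \<infinity>" using A(3)[of i] by (simp add: less_top)
    finally have Bf: "emeasure M B < \<infinity>" .
    have "(\<integral>\<^sup>+x. indicator B x * v x \<partial>M) \<le> (\<integral>\<^sup>+x. c * indicator B x \<partial>M)"
      by (rule nn_integral_mono) (use c(2) in \<open>auto simp: B_def split: split_indicator\<close>)
    also have "\<dots> = c * emeasure M B" by (rule nn_integral_cmult_indicator) measurable
    also have "\<dots> < \<infinity>" using c(1) Bf by (simp add: ennreal_mult_less_top)
    finally have vf: "(\<integral>\<^sup>+x. indicator B x * v x \<partial>M) < \<infinity>" .
    have "(\<integral>\<^sup>+x. indicator B x * v x \<partial>M) + (\<integral>\<^sup>+x. indicator B x * (u x - v x) \<partial>M)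
        = (\<integral>\<^sup>+x. indicator B x * v x + indicator B x * (u x - v x) \<partial>M)"
      by (rule nn_integral_add[symmetric]) measurable
    also have "\<dots> = (\<integral>\<^sup>+x. indicator B x * u x \<partial>M)"
      by (intro nn_integral_cong) (auto simp: B_def less_imp_le add_diff_inverse_ennreal split: split_indicator)
    also have "\<dots> \<le> (\<integral>\<^sup>+x. indicator B x * v x \<partial>M) + 0"
      using le[OF B _ Bf] by (simp add: B_def subset_eq)
    finally have "(\<integral>\<^sup>+x. indicator B x * (u x - v x) \<partial>M) \<le> 0"
      using vf by (subst (asm) ennreal_add_left_cancel_le) (auto simp: less_top)
    then have "AE x in M. indicator B x * (u x - v x) = 0"
      by (subst (asm) le_zero_eq, subst (asm) nn_integral_0_iff_AE) auto
    then show ?thesis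
    proof (rule AE_mp, intro AE_I2 impI)
      fix x assume x: "x \<in> space M" "indicator B x * (u x - v x) = 0" "x \<in> A i" "x \<in> Y"
      show "u x \<le> v x"
      proof (rule ccontr)
        assume "\<not> u x \<le> v x"
        then have "x \<in> B" "v x < u x" using x by (auto simp: B_def)
        then have "u x - v x = 0" using x(2) by simp
        then show False using \<open>v x < u x\<close> c(2)[OF x(4)] c(1) by (simp add: ennreal_minus_eq_0 leD)
      qed
    qed
  qed
  then have "AE x in M. \<forall>i. x \<in> A i \<longrightarrow> x \<in> Y \<longrightarrow> u x \<le> v x" by (subst AE_all_countable) blast
  then show ?thesis
  proof (rule AE_mp, intro AE_I2 impI)
    fix x assume x: "x \<in> space M" "\<forall>i. x \<in> A i \<longrightarrow> x \<in> Y \<longrightarrow> u x \<le> v x" "x \<in> Y"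
    then have "x \<in> (\<Union>i. A i)" using A(2) by simp
    then show "u x \<le> v x" using x by blast
  qed
qed

text \<open>Image measures of sigma-finite measures can fail to be sigma-finite. With a measurable
  left inverse \<open>g\<close>, the preimages under \<open>g\<close> of a cover by sets of finite
  measure form such a cover again, since pulling them back along \<open>f\<close> returns the
  original sets.\<close>

lemma sigma_finite_distr_inverse:
  assumes M: "sigma_finite_measure M" and f [measurable]: "f \<in> M \<rightarrow>\<^sub>M N" and g [measurable]: "g \<in> N \<rightarrow>\<^sub>M M"
    and gf: "\<And>x. x \<in> space M \<Longrightarrow> g (f x) = x"
  shows "sigma_finite_measure (distr M N f)"
proof
  interpret sigma_finite_measure M by (rule M)
  obtain A :: "nat \<Rightarrow> _" where A: "range A \<subseteq> sets M" "(\<Union>i. A i) = space M" "\<And>i. emeasure M (A i) \<noteq> \<infinity>"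
    using sigma_finite by blast
  have Am [measurable]: "A i \<in> sets M" for i using A(1) by auto
  have "emeasure (distr M N f) (g -` A i \<inter> space N) = emeasure M (A i)" for i
  proof -
    have "emeasure (distr M N f) (g -` A i \<inter> space N) = emeasure M (f -` (g -` A i \<inter> space N) \<inter> space M)"
      by (rule emeasure_distr) measurable
    also have "f -` (g -` A i \<inter> space N) \<inter> space M = A i"
      using sets.sets_into_space[OF Am[of i]] gf measurable_space[OF f] by auto
    finally show ?thesis .
  qed
  note e = this
  have "g -` (\<Union>i. A i) \<inter> space N = g -` space M \<inter> space N" by (simp only: A(2))
  also have "\<dots> = space N" using measurable_space[OF g] by auto
  finally have "g -` (\<Union>i. A i) \<inter> space N = space N" .
  moreover have "(\<Union>i. g -` A i \<inter> space N) = g -` (\<Union>i. A i) \<inter> space N" by blast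
  ultimately have un: "(\<Union>i. g -` A i \<inter> space N) = space N" by (rule trans[rotated])
  show "\<exists>B. countable B \<and> B \<subseteq> sets (distr M N f) \<and> \<Union>B = space (distr M N f)
      \<and> (\<forall>b\<in>B. emeasure (distr M N f) b \<noteq> \<infinity>)"
  proof (intro exI[of _ "range (\<lambda>i. g -` A i \<inter> space N)"] conjI)
    show "range (\<lambda>i. g -` A i \<inter> space N) \<subseteq> sets (distr M N f)"
      unfolding sets_distr by (rule image_subsetI) measurable
    show "\<forall>b\<in>range (\<lambda>i. g -` A i \<inter> space N). emeasure (distr M N f) b \<noteq> \<infinity>"
      using e A(3) by simp
    show "\<Union>(range (\<lambda>i. g -` A i \<inter> space N)) = space (distr M N f)" unfolding space_distr by (rule un)
  qed simp
qed

subsection \<open>Invariant measures on measurable groups\<close>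

text \<open>Images instead of preimages, to match the definitions of the three Haar measures.
  \<open>N\<close> enters through its sigma-algebra and its underlying set, so that several
  invariant measures can be compared on one group.\<close>

definition left_inv :: "'g measure \<Rightarrow> ('g \<Rightarrow> 'g \<Rightarrow> 'g) \<Rightarrow> 'g measure \<Rightarrow> bool" where
  "left_inv N mul M \<longleftrightarrow> sets M = sets N \<and>
     (\<forall>g\<in>space N. \<forall>B\<in>sets N. emeasure M (mul g ` B) = emeasure M B)"

lemma left_inv_space: "left_inv N mul M \<Longrightarrow> space M = space N"
  unfolding left_inv_def by (elim conjE) (rule sets_eq_imp_space_eq)

text \<open>The common ground of \<open>A\<close>, its dual and \<open>H\<close>. Measurable
  multiplication and inversion are what Tonelli's theorem asks for, and the comparison of invariant
  measures rests on that theorem alone.\<close>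

locale measurable_group =
  fixes N :: "'g measure" and mul :: "'g \<Rightarrow> 'g \<Rightarrow> 'g" and iv :: "'g \<Rightarrow> 'g" and e :: 'g
  assumes mul_measurable: "(\<lambda>(x,y). mul x y) \<in> N \<Otimes>\<^sub>M N \<rightarrow>\<^sub>M N"
    and iv_measurable [measurable]: "iv \<in> N \<rightarrow>\<^sub>M N"
    and assoc: "x \<in> space N \<Longrightarrow> y \<in> space N \<Longrightarrow> z \<in> space N \<Longrightarrow> mul (mul x y) z = mul x (mul y z)"
    and e_space: "e \<in> space N"
    and mul_e: "x \<in> space N \<Longrightarrow> mul e x = x" "x \<in> space N \<Longrightarrow> mul x e = x"
    and iv_mul: "x \<in> space N \<Longrightarrow> mul (iv x) x = e" "x \<in> space N \<Longrightarrow> mul x (iv x) = e"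
begin

lemma mul_meas [measurable (raw)]:
  assumes "f \<in> M \<rightarrow>\<^sub>M N" "g \<in> M \<rightarrow>\<^sub>M N"
  shows "(\<lambda>x. mul (f x) (g x)) \<in> M \<rightarrow>\<^sub>M N"
  using measurable_compose[OF measurable_Pair[OF assms] mul_measurable] by simp

lemma mul_space: "x \<in> space N \<Longrightarrow> y \<in> space N \<Longrightarrow> mul x y \<in> space N"
  using measurable_space[OF mul_measurable, of "(x,y)"] by (simp add: space_pair_measure)

lemma iv_space: "x \<in> space N \<Longrightarrow> iv x \<in> space N"
  using measurable_space[OF iv_measurable] .

lemma iv_cancel: 
  "x \<in> space N \<Longrightarrow> y \<in> space N \<Longrightarrow> mul (iv x) (mul x y) = y"
  "x \<in> space N \<Longrightarrow> y \<in> space N \<Longrightarrow> mul x (mul (iv x) y) = y"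
  "x \<in> space N \<Longrightarrow> y \<in> space N \<Longrightarrow> mul (mul y (iv x)) x = y"
  "x \<in> space N \<Longrightarrow> y \<in> space N \<Longrightarrow> mul (mul y x) (iv x) = y"
  by (simp_all add: assoc [symmetric] iv_space iv_mul mul_e)
    (simp_all add: assoc iv_space iv_mul mul_e)

lemma iv_iv: "x \<in> space N \<Longrightarrow> iv (iv x) = x"
  using iv_cancel(1)[of "iv x" x] iv_mul[of x] by (simp add: iv_space mul_e)

lemma iv_unique: "x \<in> space N \<Longrightarrow> y \<in> space N \<Longrightarrow> mul y x = e \<Longrightarrow> y = iv x"
  using iv_cancel(4)[of x y] by (simp add: mul_e iv_space)

lemma iv_mult: "x \<in> space N \<Longrightarrow> y \<in> space N \<Longrightarrow> iv (mul x y) = mul (iv y) (iv x)"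
  by (rule iv_unique[symmetric]) (simp_all add: mul_space iv_space assoc iv_cancel iv_mul)

text \<open>Invariance is stated for images, whereas measurability and image measures speak of
  preimages; translation by the inverse converts one into the other.\<close>

lemma left_image:
  assumes g: "g \<in> space N" and B: "B \<in> sets N"
  shows "mul g ` B = mul (iv g) -` B \<inter> space N"
proof (intro set_eqI iffI)
  fix x assume "x \<in> mul g ` B"
  then obtain b where b: "b \<in> B" "x = mul g b" by blast
  moreover have "b \<in> space N" using sets.sets_into_space[OF B] b by blast
  ultimately show "x \<in> mul (iv g) -` B \<inter> space N"
    using g by (simp add: iv_cancel mul_space)
next
  fix x assume x: "x \<in> mul (iv g) -` B \<inter> space N"
  then have "x = mul g (mul (iv g) x)" using g by (simp add: iv_cancel)
  then show "x \<in> mul g ` B" using x by blast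
qed

lemma right_image:
  assumes g: "g \<in> space N" and B: "B \<in> sets N"
  shows "(\<lambda>x. mul x g) ` B = (\<lambda>x. mul x (iv g)) -` B \<inter> space N"
proof (intro set_eqI iffI)
  fix x assume "x \<in> (\<lambda>x. mul x g) ` B"
  then obtain b where b: "b \<in> B" "x = mul b g" by blast
  moreover have "b \<in> space N" using sets.sets_into_space[OF B] b by blast
  ultimately show "x \<in> (\<lambda>x. mul x (iv g)) -` B \<inter> space N"
    using g by (simp add: iv_cancel mul_space)
next
  fix x assume x: "x \<in> (\<lambda>x. mul x (iv g)) -` B \<inter> space N"
  then have "x = mul (mul x (iv g)) g" using g by (simp add: iv_cancel)
  then show "x \<in> (\<lambda>x. mul x g) ` B" using x by blast
qed

lemma nn_integral_left_inv:
  assumes M: "left_inv N mul M" and g: "g \<in> space N" and f [measurable]: "f \<in> borel_measurable N"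
  shows "(\<integral>\<^sup>+x. f (mul g x) \<partial>M) = (\<integral>\<^sup>+x. f x \<partial>M)"
proof -
  have s [measurable_cong]: "sets M = sets N" using M by (simp add: left_inv_def)
  have sp: "space M = space N" using s by (rule sets_eq_imp_space_eq)
  note g[measurable]
  have m [measurable]: "(\<lambda>x. mul g x) \<in> M \<rightarrow>\<^sub>M N" by measurable
  have d: "distr M N (mul g) = M"
  proof (rule measure_eqI)
    fix B assume "B \<in> sets (distr M N (mul g))"
    then have B: "B \<in> sets N" by simp
    have "emeasure (distr M N (mul g)) B = emeasure M (mul g -` B \<inter> space N)"
      using B by (simp add: emeasure_distr[OF m] sp)
    also have "mul g -` B \<inter> space N = mul (iv g) ` B"
      using left_image[OF iv_space[OF g] B] g by (simp add: iv_iv)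
    also have "emeasure M \<dots> = emeasure M B"
      using M B iv_space[OF g] by (simp add: left_inv_def)
    finally show "emeasure (distr M N (mul g)) B = emeasure M B" .
  qed (simp add: s)
  have "f \<in> borel_measurable (distr M N (mul g))" by simp
  from nn_integral_distr[OF m this] show ?thesis unfolding d by (rule sym)
qed

text \<open>Replace \<open>x\<close> by \<open>mul (iv y) x\<close> using invariance of
  \<open>M\<close>, exchange the integrals, then replace \<open>y\<close> by \<open>mul x y\<close>
  using invariance of \<open>K\<close>; the argument \<open>mul (iv y) x\<close> turns into
  \<open>iv y\<close>. Uniqueness, preservation of null sets and the modular function are obtained
  from special choices of \<open>f\<close> and \<open>g\<close>.\<close>

lemma tonelli_identity:
  assumes M: "left_inv N mul M" and K: "left_inv N mul K"
    and sfM: "sigma_finite_measure M" and sfK: "sigma_finite_measure K"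
    and f [measurable]: "f \<in> borel_measurable N" and g [measurable]: "g \<in> borel_measurable N"
  shows "(\<integral>\<^sup>+x. f x * (\<integral>\<^sup>+y. g (mul y x) \<partial>K) \<partial>M) = (\<integral>\<^sup>+x. g x \<partial>M) * (\<integral>\<^sup>+y. f (iv y) \<partial>K)"
proof -
  have s [measurable_cong]: "sets M = sets N" "sets K = sets N"
    using M K by (simp_all add: left_inv_def)
  have sp: "space M = space N" "space K = space N" using s[THEN sets_eq_imp_space_eq] by simp_all
  interpret M: sigma_finite_measure M by (rule sfM)
  interpret K: sigma_finite_measure K by (rule sfK)
  interpret MK: pair_sigma_finite M K ..
  have "(\<integral>\<^sup>+x. f x * (\<integral>\<^sup>+y. g (mul y x) \<partial>K) \<partial>M) = (\<integral>\<^sup>+x. (\<integral>\<^sup>+y. f x * g (mul y x) \<partial>K) \<partial>M)"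
    by (intro nn_integral_cong nn_integral_cmult[symmetric]) (simp add: sp)
  also have "\<dots> = (\<integral>\<^sup>+y. (\<integral>\<^sup>+x. f x * g (mul y x) \<partial>M) \<partial>K)"
    by (rule MK.Fubini'[symmetric]) measurable
  also have "\<dots> = (\<integral>\<^sup>+y. (\<integral>\<^sup>+x. f (mul (iv y) x) * g x \<partial>M) \<partial>K)"
  proof (rule nn_integral_cong)
    fix y assume "y \<in> space K"
    then have y: "y \<in> space N" by (simp add: sp)
    note y[measurable]
    have "(\<integral>\<^sup>+x. f (mul (iv y) x) * g x \<partial>M) = (\<integral>\<^sup>+x. f (mul (iv y) (mul y x)) * g (mul y x) \<partial>M)"
      by (rule nn_integral_left_inv[OF M y, symmetric]) measurable
    also have "\<dots> = (\<integral>\<^sup>+x. f x * g (mul y x) \<partial>M)"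
      by (intro nn_integral_cong) (simp add: sp y iv_cancel)
    finally show "(\<integral>\<^sup>+x. f x * g (mul y x) \<partial>M) = (\<integral>\<^sup>+x. f (mul (iv y) x) * g x \<partial>M)" by simp
  qed
  also have "\<dots> = (\<integral>\<^sup>+x. (\<integral>\<^sup>+y. f (mul (iv y) x) * g x \<partial>K) \<partial>M)"
    by (rule MK.Fubini') measurable
  also have "\<dots> = (\<integral>\<^sup>+x. (\<integral>\<^sup>+y. f (iv y) \<partial>K) * g x \<partial>M)"
  proof (rule nn_integral_cong)
    fix x assume "x \<in> space M"
    then have x: "x \<in> space N" by (simp add: sp)
    note x[measurable]
    have "(\<integral>\<^sup>+y. f (mul (iv y) x) * g x \<partial>K) = (\<integral>\<^sup>+y. f (mul (iv y) x) \<partial>K) * g x"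
      by (intro nn_integral_multc) measurable
    also have "(\<integral>\<^sup>+y. f (mul (iv y) x) \<partial>K) = (\<integral>\<^sup>+y. f (iv (mul (iv x) y)) \<partial>K)"
      by (intro nn_integral_cong) (simp add: sp x iv_mult iv_space iv_iv)
    also have "\<dots> = (\<integral>\<^sup>+y. f (iv y) \<partial>K)"
      by (rule nn_integral_left_inv[OF K iv_space[OF x], of "\<lambda>y. f (iv y)"]) measurable
    finally show "(\<integral>\<^sup>+y. f (mul (iv y) x) * g x \<partial>K) = (\<integral>\<^sup>+y. f (iv y) \<partial>K) * g x" .
  qed
  also have "\<dots> = (\<integral>\<^sup>+x. g x \<partial>M) * (\<integral>\<^sup>+y. f (iv y) \<partial>K)"
    by (subst nn_integral_cmult) (auto simp: mult.commute)
  finally show ?thesis .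
qed

text \<open>In a commutative group the inner integral of \<open>tonelli_identity\<close> does not
  depend on \<open>x\<close>, so the identity becomes a relation between total integrals. The
  conclusion stays multiplied out because the integrals of \<open>f\<close>, and that of
  \<open>g\<close> over \<open>K\<close>, may be zero or infinite.\<close>

lemma left_inv_unique_comm:
  assumes M: "left_inv N mul M" and K: "left_inv N mul K"
    and sfM: "sigma_finite_measure M" and sfK: "sigma_finite_measure K"
    and comm: "\<And>x y. x \<in> space N \<Longrightarrow> y \<in> space N \<Longrightarrow> mul x y = mul y x"
    and f [measurable]: "f \<in> borel_measurable N" and g [measurable]: "g \<in> borel_measurable N"
    and pos: "0 < (\<integral>\<^sup>+x. g x \<partial>M)" "(\<integral>\<^sup>+x. g x \<partial>M) < \<infinity>"
  shows "(\<integral>\<^sup>+x. f x \<partial>M) * (\<integral>\<^sup>+x. g x \<partial>K) = (\<integral>\<^sup>+x. g x \<partial>M) * (\<integral>\<^sup>+x. f x \<partial>K)"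
proof -
  have swap: "(\<integral>\<^sup>+x. f x \<partial>M') * (\<integral>\<^sup>+x. g x \<partial>K') = (\<integral>\<^sup>+x. g x \<partial>M') * (\<integral>\<^sup>+x. f (iv x) \<partial>K')"
    if M': "left_inv N mul M'" "left_inv N mul K'" "sigma_finite_measure M'" "sigma_finite_measure K'"
      and [measurable]: "f \<in> borel_measurable N" "g \<in> borel_measurable N" for M' K' and f g :: "'g \<Rightarrow> ennreal"
  proof -
    have s [measurable_cong]: "sets M' = sets N" "sets K' = sets N"
      using M' by (simp_all add: left_inv_def)
    have sp: "space M' = space N" "space K' = space N" using s[THEN sets_eq_imp_space_eq] by simp_all
    have "(\<integral>\<^sup>+x. f x * (\<integral>\<^sup>+y. g (mul y x) \<partial>K') \<partial>M') = (\<integral>\<^sup>+x. f x * (\<integral>\<^sup>+y. g y \<partial>K') \<partial>M')"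
    proof (rule nn_integral_cong)
      fix x assume "x \<in> space M'"
      then have x: "x \<in> space N" by (simp add: sp)
      have "(\<integral>\<^sup>+y. g (mul y x) \<partial>K') = (\<integral>\<^sup>+y. g (mul x y) \<partial>K')"
        by (intro nn_integral_cong) (simp add: sp x comm)
      also have "\<dots> = (\<integral>\<^sup>+y. g y \<partial>K')"
        by (rule nn_integral_left_inv[OF M'(2) x]) measurable
      finally show "f x * (\<integral>\<^sup>+y. g (mul y x) \<partial>K') = f x * (\<integral>\<^sup>+y. g y \<partial>K')" by simp
    qed
    also have "\<dots> = (\<integral>\<^sup>+x. f x \<partial>M') * (\<integral>\<^sup>+y. g y \<partial>K')"
      by (rule nn_integral_multc) measurable
    finally show ?thesis using tonelli_identity[OF M'(1-4), of f g] by simp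
  qed
  \<comment> \<open>The case \<open>K = M\<close> shows that inversion preserves \<open>M\<close>;
    the integral of \<open>g\<close> can be cancelled since it is positive and finite.\<close>
  have inv: "(\<integral>\<^sup>+x. f (iv x) \<partial>M) = (\<integral>\<^sup>+x. f x \<partial>M)" if [measurable]: "f \<in> borel_measurable N" for f
  proof -
    have "(\<integral>\<^sup>+x. g x \<partial>M) * (\<integral>\<^sup>+x. f (iv x) \<partial>M) = (\<integral>\<^sup>+x. g x \<partial>M) * (\<integral>\<^sup>+x. f x \<partial>M)"
      using swap[OF M M sfM sfM, of f g] by (simp add: mult.commute)
    then show ?thesis using pos by (auto simp: ennreal_mult_cancel_left less_top[symmetric])
  qed
  have "(\<integral>\<^sup>+x. f x \<partial>M) * (\<integral>\<^sup>+x. g x \<partial>K) = (\<integral>\<^sup>+x. f (iv x) \<partial>M) * (\<integral>\<^sup>+x. g x \<partial>K)"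
    by (simp add: inv)
  also have "\<dots> = (\<integral>\<^sup>+x. g x \<partial>M) * (\<integral>\<^sup>+x. f (iv (iv x)) \<partial>K)"
    by (rule swap[OF M K sfM sfK]) measurable
  also have "(\<integral>\<^sup>+x. f (iv (iv x)) \<partial>K) = (\<integral>\<^sup>+x. f x \<partial>K)"
    using left_inv_space[OF K] by (intro nn_integral_cong) (simp add: iv_iv)
  finally show ?thesis .
qed

text \<open>Null sets survive inversion: take the indicator of the exceptional set as
  \<open>f\<close> in \<open>tonelli_identity\<close>. Right translation by \<open>h\<close> is
  inversion, left translation by \<open>iv h\<close> and inversion again, so it preserves null sets
  too, although it may change the measure.\<close>

lemma AE_translate:
  assumes M: "left_inv N mul M" and sfM: "sigma_finite_measure M"
    and nz: "emeasure M (space M) \<noteq> 0"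
    and P [measurable]: "Measurable.pred N P" and AE: "AE x in M. P x"
  shows AE_iv: "AE x in M. P (iv x)"
    and AE_right: "h \<in> space N \<Longrightarrow> AE x in M. P (mul x h)"
proof -
  interpret sigma_finite_measure M by (rule sfM)
  have s [measurable_cong]: "sets M = sets N" using M by (simp add: left_inv_def)
  have sp: "space M = space N" by (rule left_inv_space[OF M])
  obtain B where B: "B \<in> sets M" "0 < emeasure M B" "emeasure M B < \<infinity>"
    using obtain_pos_finite_set[OF nz] .
  note B(1)[measurable]
  have iv: "AE x in M. Q (iv x)" if Q [measurable]: "Measurable.pred N Q" and AE: "AE x in M. Q x" for Q
  proof -
    let ?f = "\<lambda>x. indicator {x\<in>space N. \<not> Q x} x :: ennreal"
    have "(\<integral>\<^sup>+x. ?f x * (\<integral>\<^sup>+y. indicator B (mul y x) \<partial>M) \<partial>M) = 0"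
      using AE by (subst nn_integral_0_iff_AE) (auto split: split_indicator)
    moreover have "(\<integral>\<^sup>+x. ?f x * (\<integral>\<^sup>+y. indicator B (mul y x) \<partial>M) \<partial>M)
        = (\<integral>\<^sup>+x. indicator B x \<partial>M) * (\<integral>\<^sup>+y. ?f (iv y) \<partial>M)"
      using B(1) s by (intro tonelli_identity[OF M M sfM sfM]) auto
    ultimately have "(\<integral>\<^sup>+y. ?f (iv y) \<partial>M) = 0" using B by auto
    then have "AE y in M. ?f (iv y) = 0" by (subst (asm) nn_integral_0_iff_AE) auto
    then show ?thesis by (rule AE_mp) (auto intro!: AE_I2 simp: sp iv_space split: split_indicator_asm)
  qed
  have left: "AE x in M. Q (mul h x)" if Q [measurable]: "Measurable.pred N Q" and AE: "AE x in M. Q x"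
    and h [measurable]: "h \<in> space N" for Q h
  proof -
    let ?f = "\<lambda>x. indicator {x\<in>space N. \<not> Q x} x :: ennreal"
    have "(\<integral>\<^sup>+x. ?f (mul h x) \<partial>M) = (\<integral>\<^sup>+x. ?f x \<partial>M)"
      by (rule nn_integral_left_inv[OF M h]) measurable
    also have "(\<integral>\<^sup>+x. ?f x \<partial>M) = 0"
      using AE by (subst nn_integral_0_iff_AE) (auto split: split_indicator)
    finally have "AE y in M. ?f (mul h y) = 0" by (subst (asm) nn_integral_0_iff_AE) auto
    then show ?thesis by (rule AE_mp) (auto intro!: AE_I2 simp: sp mul_space h split: split_indicator_asm)
  qed
  show "AE x in M. P (iv x)" by (rule iv[OF P AE])
  assume h [measurable]: "h \<in> space N"
  have ih [measurable]: "iv h \<in> space N" using h by (rule iv_space)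
  have "AE x in M. P (iv (mul (iv h) (iv x)))"
    by (rule iv[OF _ left[OF _ iv[OF P AE] ih]]) measurable
  then show "AE x in M. P (mul x h)"
    by (rule AE_mp) (auto intro!: AE_I2 simp: sp iv_mult iv_space iv_iv h)
qed

text \<open>This is the modular function. By \<open>tonelli_identity\<close>,
  \<open>c0 * W g\<close> and the integral of \<open>g\<close> times \<open>W ?g0\<close> are
  densities of the same measure and hence equal almost everywhere. Comparing this relation for
  \<open>g\<close>, for \<open>?g0\<close> and for their translates by \<open>h\<close> at one good
  point determines \<open>W g\<close> at \<open>h\<close> itself.\<close>

lemma right_translate_scaling:
  assumes M: "left_inv N mul M" and sfM: "sigma_finite_measure M"
    and nz: "emeasure M (space M) \<noteq> 0" and h [measurable]: "h \<in> space N"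
  obtains c :: real where "0 < c"
    "\<And>g. g \<in> borel_measurable N \<Longrightarrow> (\<integral>\<^sup>+y. g (mul y h) \<partial>M) = ennreal c * (\<integral>\<^sup>+y. g y \<partial>M)"
proof -
  interpret sigma_finite_measure M by (rule sfM)
  have s [measurable_cong]: "sets M = sets N" using M by (simp add: left_inv_def)
  have sp: "space M = space N" by (rule left_inv_space[OF M])
  obtain B where B: "B \<in> sets M" "0 < emeasure M B" "emeasure M B < \<infinity>"
    using obtain_pos_finite_set[OF nz] .
  define W where "W g x = (\<integral>\<^sup>+y. g (mul y x) \<partial>M)" for g :: "'g \<Rightarrow> ennreal" and x
  have W_meas [measurable]: "W g \<in> borel_measurable N" if [measurable]: "g \<in> borel_measurable N" for g
    unfolding W_def by measurable
  have T: "(\<integral>\<^sup>+x. f x * W g x \<partial>M) = (\<integral>\<^sup>+x. g x \<partial>M) * (\<integral>\<^sup>+y. f (iv y) \<partial>M)"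
    if "f \<in> borel_measurable N" "g \<in> borel_measurable N" for f g
    unfolding W_def by (rule tonelli_identity[OF M M sfM sfM that])
  let ?g0 = "indicator B :: 'g \<Rightarrow> ennreal"
  have g0 [measurable]: "?g0 \<in> borel_measurable N" using B(1) s by simp
  define c0 where "c0 = (\<integral>\<^sup>+x. ?g0 x \<partial>M)"
  have c0: "0 < c0" "c0 < \<infinity>" using B by (simp_all add: c0_def)
  \<comment> \<open>Proportionality is kept multiplied out, as the integral of \<open>g\<close> may
    be infinite.\<close>
  have eq: "AE x in M. c0 * W g x = (\<integral>\<^sup>+x. g x \<partial>M) * W ?g0 x" if g [measurable]: "g \<in> borel_measurable N" for g
  proof (rule density_unique)
    show "density M (\<lambda>x. c0 * W g x) = density M (\<lambda>x. (\<integral>\<^sup>+x. g x \<partial>M) * W ?g0 x)"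
    proof (rule measure_eqI)
      fix A assume "A \<in> sets (density M (\<lambda>x. c0 * W g x))"
      then have A [measurable]: "A \<in> sets M" by simp
      have iA: "indicator A \<in> borel_measurable N" using A s by simp
      note this[measurable]
      have "emeasure (density M (\<lambda>x. c0 * W g x)) A = (\<integral>\<^sup>+x. c0 * (indicator A x * W g x) \<partial>M)"
        by (subst emeasure_density) (auto simp: mult_ac)
      also have "\<dots> = c0 * (\<integral>\<^sup>+x. indicator A x * W g x \<partial>M)" by (rule nn_integral_cmult) measurable
      also have "\<dots> = (\<integral>\<^sup>+x. g x \<partial>M) * (\<integral>\<^sup>+x. indicator A x * W ?g0 x \<partial>M)"
        unfolding T[OF iA g] T[OF iA g0] c0_def[symmetric] by (simp add: mult_ac)
      also have "\<dots> = (\<integral>\<^sup>+x. (\<integral>\<^sup>+x. g x \<partial>M) * (indicator A x * W ?g0 x) \<partial>M)"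
        by (rule nn_integral_cmult[symmetric]) measurable
      also have "\<dots> = emeasure (density M (\<lambda>x. (\<integral>\<^sup>+x. g x \<partial>M) * W ?g0 x)) A"
        by (subst emeasure_density) (auto simp: mult_ac)
      finally show "emeasure (density M (\<lambda>x. c0 * W g x)) A
          = emeasure (density M (\<lambda>x. (\<integral>\<^sup>+x. g x \<partial>M) * W ?g0 x)) A" .
    qed simp
  qed measurable
  \<comment> \<open>Over the points with \<open>iv x \<in> A i\<close> the integral of
    \<open>W ?g0\<close> is \<open>c0 * emeasure M (A i)\<close>, which is finite.\<close>
  have fin: "AE x in M. W ?g0 x < \<infinity>"
  proof -
    obtain A :: "nat \<Rightarrow> 'g set" where A: "range A \<subseteq> sets M" "(\<Union>i. A i) = space M"
      "\<And>i. emeasure M (A i) \<noteq> \<infinity>"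
      using sigma_finite by blast
    have "AE x in M. iv x \<in> A i \<longrightarrow> W ?g0 x < \<infinity>" for i
    proof -
      have Ai [measurable]: "A i \<in> sets M" "A i \<in> sets N" using A(1) s by auto
      have "(\<integral>\<^sup>+x. indicator (A i) (iv x) * W ?g0 x \<partial>M)
          = c0 * (\<integral>\<^sup>+y. indicator (A i) (iv (iv y)) \<partial>M)"
        unfolding c0_def by (rule T) measurable
      also have "(\<integral>\<^sup>+y. indicator (A i) (iv (iv y)) \<partial>M) = (\<integral>\<^sup>+y. indicator (A i) y \<partial>M)"
        by (intro nn_integral_cong) (simp add: sp iv_iv)
      also have "c0 * \<dots> < \<infinity>" using c0 A(3)[of i] by (simp add: ennreal_mult_less_top less_top)
      finally have "AE x in M. indicator (A i) (iv x) * W ?g0 x \<noteq> \<infinity>"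
        by (intro nn_integral_PInf_AE) auto
      then show ?thesis by (rule AE_mp) (auto intro!: AE_I2 simp: less_top)
    qed
    then have "AE x in M. \<forall>i. iv x \<in> A i \<longrightarrow> W ?g0 x < \<infinity>" by (subst AE_all_countable) blast
    then show ?thesis
    proof (rule AE_mp, intro AE_I2 impI)
      fix x assume x: "x \<in> space M" and *: "\<forall>i. iv x \<in> A i \<longrightarrow> W ?g0 x < \<infinity>"
      have "iv x \<in> (\<Union>i. A i)" using A(2) x by (simp add: sp iv_space)
      then show "W ?g0 x < \<infinity>" using * by blast
    qed
  qed
  \<comment> \<open>Over its zero set \<open>W ?g0\<close> has integral 0, so by the Tonelli
    identity the inverse of that set is null, and then so is the set.\<close>
  have pos: "AE x in M. 0 < W ?g0 x"
  proof -
    let ?f = "\<lambda>x. indicator {x\<in>space N. W ?g0 x = 0} x :: ennreal"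
    have "(\<integral>\<^sup>+x. ?f x * W ?g0 x \<partial>M) = c0 * (\<integral>\<^sup>+y. ?f (iv y) \<partial>M)"
      unfolding c0_def by (rule T) measurable
    moreover have "(\<integral>\<^sup>+x. ?f x * W ?g0 x \<partial>M) = (\<integral>\<^sup>+x. 0 \<partial>M)"
      by (intro nn_integral_cong) (auto split: split_indicator)
    ultimately have "(\<integral>\<^sup>+y. ?f (iv y) \<partial>M) = 0" using c0 by auto
    then have "AE y in M. ?f (iv y) = 0" by (subst (asm) nn_integral_0_iff_AE) auto
    then have "AE y in M. ?f (iv (iv y)) = 0" 
      by (intro AE_iv[OF M sfM nz, where P="\<lambda>y. ?f (iv y) = 0"]) auto
    then show ?thesis
      by (rule AE_mp) (auto intro!: AE_I2 simp: sp iv_iv zero_less_iff_neq_zero split: split_indicator_asm)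
  qed
  define b0 where "b0 = W ?g0 h"
  have W_shift: "W (\<lambda>y. g (mul y h)) x = W g (mul x h)" if "x \<in> space N" for g x
    unfolding W_def using that h by (intro nn_integral_cong) (simp add: sp assoc)
  have shift_eq: "AE x in M. c0 * W g (mul x h) = W g h * W ?g0 x" if g [measurable]: "g \<in> borel_measurable N" for g
  proof -
    have "AE x in M. c0 * W (\<lambda>y. g (mul y h)) x = (\<integral>\<^sup>+y. g (mul y h) \<partial>M) * W ?g0 x"
      by (rule eq) measurable
    then show ?thesis
      by (rule AE_mp) (auto intro!: AE_I2 simp: sp W_shift W_def[of _ h])
  qed
  have fin': "AE x in M. W ?g0 (mul x h) < \<infinity>"
    by (rule AE_right[OF M sfM nz _ fin h]) measurable
  have pos': "AE x in M. 0 < W ?g0 (mul x h)"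
    by (rule AE_right[OF M sfM nz _ pos h]) measurable
  have ex: "\<exists>x. P x" if "AE x in M. P x" for P
  proof (rule ccontr)
    assume "\<nexists>x. P x"
    then have "P = (\<lambda>x. False)" by blast
    then show False using that nz by (simp add: eventually_False ae_filter_eq_bot_iff)
  qed
  have b0: "0 < b0" "b0 < \<infinity>"
  proof -
    have "AE x in M. 0 < W ?g0 x \<and> W ?g0 x < \<infinity> \<and> 0 < W ?g0 (mul x h) \<and> W ?g0 (mul x h) < \<infinity>
        \<and> c0 * W ?g0 (mul x h) = b0 * W ?g0 x"
      using fin pos fin' pos' shift_eq[OF g0] unfolding b0_def by eventually_elim auto
    from ex[OF this] obtain x where x: "0 < W ?g0 x" "W ?g0 x < \<infinity>" "0 < W ?g0 (mul x h)"
      "W ?g0 (mul x h) < \<infinity>" "c0 * W ?g0 (mul x h) = b0 * W ?g0 x" by blast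
    show "0 < b0"
    proof (rule ccontr)
      assume "\<not> 0 < b0"
      then have "c0 * W ?g0 (mul x h) = 0" using x(5) by simp
      then show False using c0(1) x(3) by auto
    qed
    show "b0 < \<infinity>"
    proof (rule ccontr)
      assume "\<not> b0 < \<infinity>"
      then have "b0 = top" by (simp add: less_top[symmetric])
      then have "c0 * W ?g0 (mul x h) = top" using x(1,5) by (simp add: ennreal_top_mult)
      then show False using c0(2) x(4) by (auto simp: ennreal_mult_eq_top_iff)
    qed
  qed
  have main: "c0 * W g h = b0 * (\<integral>\<^sup>+y. g y \<partial>M)" if g [measurable]: "g \<in> borel_measurable N" for g
  proof -
    have e: "AE x in M. c0 * W g (mul x h) = (\<integral>\<^sup>+x. g x \<partial>M) * W ?g0 (mul x h)"
      by (rule AE_right[OF M sfM nz _ eq[OF g] h]) measurable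
    have "AE x in M. 0 < W ?g0 x \<and> W ?g0 x < \<infinity> \<and> c0 * W g (mul x h) = W g h * W ?g0 x
        \<and> c0 * W g (mul x h) = (\<integral>\<^sup>+x. g x \<partial>M) * W ?g0 (mul x h)
        \<and> c0 * W ?g0 (mul x h) = b0 * W ?g0 x"
      using fin pos shift_eq[OF g0] shift_eq[OF g] e unfolding b0_def by eventually_elim auto
    from ex[OF this] obtain x where x: "0 < W ?g0 x" "W ?g0 x < \<infinity>"
      "c0 * W g (mul x h) = W g h * W ?g0 x"
      "c0 * W g (mul x h) = (\<integral>\<^sup>+x. g x \<partial>M) * W ?g0 (mul x h)"
      "c0 * W ?g0 (mul x h) = b0 * W ?g0 x" by blast
    have "W ?g0 x * (c0 * W g h) = c0 * (W g h * W ?g0 x)" by (simp add: mult_ac)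
    also have "\<dots> = (\<integral>\<^sup>+x. g x \<partial>M) * (c0 * W ?g0 (mul x h))" using x(3,4) by (simp add: mult_ac)
    also have "\<dots> = W ?g0 x * (b0 * (\<integral>\<^sup>+x. g x \<partial>M))" unfolding x(5) by (simp add: mult_ac)
    finally show ?thesis using x(1,2) by (auto simp: ennreal_mult_cancel_left less_top)
  qed
  obtain cr br where r: "c0 = ennreal cr" "b0 = ennreal br" "0 < cr" "0 < br"
    using c0 b0 by (cases c0; cases b0) auto
  show thesis
  proof (rule that[of "br / cr"])
    fix g :: "'g \<Rightarrow> ennreal" assume g: "g \<in> borel_measurable N"
    have "ennreal cr * W g h = ennreal cr * (ennreal (br / cr) * (\<integral>\<^sup>+y. g y \<partial>M))"
      using main[OF g] r by (simp add: mult.assoc[symmetric] ennreal_mult[symmetric])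
    then have "W g h = ennreal (br / cr) * (\<integral>\<^sup>+y. g y \<partial>M)"
      using r(3) by (auto simp: ennreal_mult_cancel_left)
    then show "(\<integral>\<^sup>+y. g (mul y h) \<partial>M) = ennreal (br / cr) * (\<integral>\<^sup>+y. g y \<partial>M)" by (simp add: W_def)
  qed (use r in simp)
qed

text \<open>The preimage of the translate of \<open>B\<close> by \<open>a\<close> is the translate
  by \<open>g a\<close> of the preimage. Applied to \<open>inv h\<close> on \<open>A\<close> and to
  \<open>\<xi> \<mapsto> \<xi> \<circ> h\<close> on the dual, this makes the image measures
  comparable with Haar measure.\<close>

lemma left_inv_distr_automorphism:
  assumes M: "left_inv N mul M" and f [measurable]: "f \<in> N \<rightarrow>\<^sub>M N" and g [measurable]: "g \<in> N \<rightarrow>\<^sub>M N"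
    and gf: "\<And>x. x \<in> space N \<Longrightarrow> g (f x) = x" and fg: "\<And>x. x \<in> space N \<Longrightarrow> f (g x) = x"
    and hom: "\<And>x y. x \<in> space N \<Longrightarrow> y \<in> space N \<Longrightarrow> f (mul x y) = mul (f x) (f y)"
  shows "left_inv N mul (distr M N f)"
  unfolding left_inv_def
proof (intro conjI ballI)
  have s [measurable_cong]: "sets M = sets N" using M by (simp add: left_inv_def)
  have sp: "space M = space N" by (rule left_inv_space[OF M])
  fix a B assume a: "a \<in> space N" and B [measurable]: "B \<in> sets N"
  have BN: "B \<subseteq> space N" by (rule sets.sets_into_space[OF B])
  have ga: "g a \<in> space N" using measurable_space[OF g a] .
  have "mul a ` B = mul (iv a) -` B \<inter> space N" by (rule left_image[OF a B])
  also have "\<dots> \<in> sets N" using iv_space[OF a] by measurable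
  finally have aB: "mul a ` B \<in> sets N" .
  have pre: "f -` B \<inter> space N \<in> sets N" by measurable
  have "f -` (mul a ` B) \<inter> space N = mul (g a) ` (f -` B \<inter> space N)"
  proof (intro set_eqI iffI)
    fix x assume "x \<in> f -` (mul a ` B) \<inter> space N"
    then have x: "x \<in> space N" and "f x \<in> mul a ` B" by simp_all
    then obtain b where b: "b \<in> B" "f x = mul a b" by blast
    have bN: "b \<in> space N" using b(1) BN by (rule rev_subsetD)
    then have gb: "g b \<in> space N" by (rule measurable_space[OF g])
    have "f (mul (g a) (g b)) = f x" unfolding hom[OF ga gb] fg[OF a] fg[OF bN] b(2) ..
    from arg_cong[OF this, of g] have "mul (g a) (g b) = x"
      unfolding gf[OF mul_space[OF ga gb]] gf[OF x] .
    moreover have "g b \<in> f -` B \<inter> space N" using b(1) gb fg[OF bN] by simp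
    ultimately show "x \<in> mul (g a) ` (f -` B \<inter> space N)" by (intro image_eqI[of _ _ "g b"]) simp_all
  next
    fix x assume "x \<in> mul (g a) ` (f -` B \<inter> space N)"
    then obtain y where y: "x = mul (g a) y" "y \<in> f -` B \<inter> space N" by (rule imageE)
    then have "f y \<in> B" "y \<in> space N" by simp_all
    then have "f x = mul a (f y)" "x \<in> space N" unfolding y(1) using hom[OF ga] fg[OF a] mul_space[OF ga] by simp_all
    then show "x \<in> f -` (mul a ` B) \<inter> space N" using \<open>f y \<in> B\<close> by simp
  qed
  then have "emeasure (distr M N f) (mul a ` B) = emeasure M (mul (g a) ` (f -` B \<inter> space N))"
    using aB by (simp add: emeasure_distr sp)
  also have "\<dots> = emeasure M (f -` B \<inter> space N)"
    using M ga pre by (simp add: left_inv_def)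
  also have "\<dots> = emeasure (distr M N f) B" by (simp add: emeasure_distr sp)
  finally show "emeasure (distr M N f) (mul a ` B) = emeasure (distr M N f) B" .
qed simp

end

subsection \<open>Square-integrable functions\<close>

text \<open>The real-valued norm for epsilon arguments. Its square agrees with
  \<open>L2norm_sq\<close> on \<open>L2\<close>; elsewhere the Bochner integral defaults to 0, so it
  says nothing about size.\<close>

definition n2 :: "'b measure \<Rightarrow> ('b \<Rightarrow> complex) \<Rightarrow> real" where
  "n2 M f = sqrt (\<integral>x. (cmod (f x))\<^sup>2 \<partial>M)"

definition ip :: "'b measure \<Rightarrow> ('b \<Rightarrow> complex) \<Rightarrow> ('b \<Rightarrow> complex) \<Rightarrow> complex" where
  "ip M f g = (\<integral>x. f x * cnj (g x) \<partial>M)"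

lemma borel_measurable_cnj [measurable (raw)]:
  assumes "f \<in> borel_measurable M" shows "(\<lambda>x. cnj (f x)) \<in> borel_measurable M"
proof -
  have "cnj \<in> borel_measurable borel"
    by (intro borel_measurable_continuous_onI continuous_intros)
  from measurable_compose[OF assms this] show ?thesis .
qed

lemma L2_measurable [measurable_dest]: "f \<in> L2 M \<Longrightarrow> f \<in> borel_measurable M"
  by (simp add: L2_def)

lemma L2_integrable: "f \<in> L2 M \<Longrightarrow> integrable M (\<lambda>x. (cmod (f x))\<^sup>2)"
  by (simp add: L2_def)

lemma n2_nonneg [simp]: "0 \<le> n2 M f"
  by (simp add: n2_def)

lemma n2_sq: "(n2 M f)\<^sup>2 = (\<integral>x. (cmod (f x))\<^sup>2 \<partial>M)"
  by (simp add: n2_def)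

lemma L2norm_sq_eq: "f \<in> L2 M \<Longrightarrow> L2norm_sq M f = ennreal ((n2 M f)\<^sup>2)"
  unfolding L2norm_sq_def n2_sq by (intro nn_integral_eq_integral L2_integrable) auto

text \<open>Lets computations with nonnegative integrals, where Tonelli and monotone convergence are
  free, decide square-integrability afterwards.\<close>

lemma L2_iff: "f \<in> borel_measurable M \<Longrightarrow> f \<in> L2 M \<longleftrightarrow> L2norm_sq M f < \<infinity>"
  unfolding L2_def L2norm_sq_def by (auto simp: integrable_iff_bounded)

lemma L2_cmult: assumes f: "f \<in> L2 M" shows "(\<lambda>x. c * f x) \<in> L2 M"
proof -
  have "integrable M (\<lambda>x. (cmod c)\<^sup>2 * (cmod (f x))\<^sup>2)"
    using L2_integrable[OF f] by (rule integrable_mult_right)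
  then show ?thesis using L2_measurable[OF f]
    by (auto simp: L2_def norm_mult power_mult_distrib)
qed

lemma n2_cmult: "n2 M (\<lambda>x. c * f x) = cmod c * n2 M f"
  by (simp add: n2_def norm_mult power_mult_distrib real_sqrt_mult)

lemma L2_add: assumes f: "f \<in> L2 M" and g: "g \<in> L2 M" shows "(\<lambda>x. f x + g x) \<in> L2 M"
proof -
  note [measurable] = L2_measurable[OF f] L2_measurable[OF g]
  have "integrable M (\<lambda>x. 2 * (cmod (f x))\<^sup>2 + 2 * (cmod (g x))\<^sup>2)"
    using L2_integrable[OF f] L2_integrable[OF g] by simp
  then have "integrable M (\<lambda>x. (cmod (f x + g x))\<^sup>2)"
  proof (rule Bochner_Integration.integrable_bound)
    show "AE x in M. norm ((cmod (f x + g x))\<^sup>2) \<le> norm (2 * (cmod (f x))\<^sup>2 + 2 * (cmod (g x))\<^sup>2)"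
    proof (rule AE_I2)
      fix x
      have "(cmod (f x + g x))\<^sup>2 \<le> (cmod (f x) + cmod (g x))\<^sup>2"
        by (intro power_mono norm_triangle_ineq) auto
      also have "\<dots> \<le> 2 * (cmod (f x))\<^sup>2 + 2 * (cmod (g x))\<^sup>2"
        using zero_le_power2[of "cmod (f x) - cmod (g x)"] by (simp add: power2_eq_square algebra_simps)
      finally show "norm ((cmod (f x + g x))\<^sup>2) \<le> norm (2 * (cmod (f x))\<^sup>2 + 2 * (cmod (g x))\<^sup>2)" by simp
    qed
  qed measurable
  then show ?thesis by (simp add: L2_def)
qed

lemma L2_diff: assumes "f \<in> L2 M" "g \<in> L2 M" shows "(\<lambda>x. f x - g x) \<in> L2 M"
  using L2_add[OF assms(1) L2_cmult[OF assms(2), of "-1"]] by simp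

lemma L2_cong_AE:
  assumes "f \<in> L2 M" "g \<in> borel_measurable M" "AE x in M. f x = g x"
  shows "g \<in> L2 M"
proof -
  note [measurable] = L2_measurable[OF assms(1)] assms(2)
  have "integrable M (\<lambda>x. (cmod (f x))\<^sup>2) = integrable M (\<lambda>x. (cmod (g x))\<^sup>2)"
    using assms(3) by (intro integrable_cong_AE) auto
  then show ?thesis using assms by (simp add: L2_def)
qed

lemma L2_mult_bounded:
  assumes f: "f \<in> L2 M" and m [measurable]: "m \<in> borel_measurable M"
    and b: "\<And>x. x \<in> space M \<Longrightarrow> cmod (m x) \<le> C"
  shows "(\<lambda>x. m x * f x) \<in> L2 M"
proof -
  note [measurable] = L2_measurable[OF f]
  have "integrable M (\<lambda>x. C\<^sup>2 * (cmod (f x))\<^sup>2)"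
    using L2_integrable[OF f] by (rule integrable_mult_right)
  then have "integrable M (\<lambda>x. (cmod (m x * f x))\<^sup>2)"
  proof (rule Bochner_Integration.integrable_bound)
    show "AE x in M. norm ((cmod (m x * f x))\<^sup>2) \<le> norm (C\<^sup>2 * (cmod (f x))\<^sup>2)"
      using b by (intro AE_I2) (auto simp: norm_mult power_mult_distrib intro!: mult_right_mono power_mono)
  qed measurable
  then show ?thesis by (simp add: L2_def)
qed

lemma L2_prod_integrable:
  assumes f: "f \<in> L2 M" and g: "g \<in> L2 M"
  shows "integrable M (\<lambda>x. cmod (f x) * cmod (g x))" "integrable M (\<lambda>x. f x * cnj (g x))"
    "integrable M (\<lambda>x. f x * g x)"
proof -
  note [measurable] = L2_measurable[OF f] L2_measurable[OF g]
  have i: "integrable M (\<lambda>x. (cmod (f x))\<^sup>2 + (cmod (g x))\<^sup>2)"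
    using L2_integrable[OF f] L2_integrable[OF g] by simp
  have b: "cmod (f x) * cmod (g x) \<le> (cmod (f x))\<^sup>2 + (cmod (g x))\<^sup>2" for x
    using sum_squares_bound[of "cmod (f x)" "cmod (g x)"] mult_nonneg_nonneg[of "cmod (f x)" "cmod (g x)"]
    unfolding mult.assoc by (smt (verit) norm_ge_zero)
  show "integrable M (\<lambda>x. cmod (f x) * cmod (g x))"
    by (rule Bochner_Integration.integrable_bound[OF i]) (use b in auto)
  show "integrable M (\<lambda>x. f x * cnj (g x))"
    by (rule Bochner_Integration.integrable_bound[OF i]) (use b in \<open>auto simp: norm_mult\<close>)
  show "integrable M (\<lambda>x. f x * g x)"
    by (rule Bochner_Integration.integrable_bound[OF i]) (use b in \<open>auto simp: norm_mult\<close>)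
qed

lemma Cauchy_Schwarz_L2:
  assumes f: "f \<in> L2 M" and g: "g \<in> L2 M"
  shows "(\<integral>x. cmod (f x) * cmod (g x) \<partial>M) \<le> n2 M f * n2 M g"
proof -
  note [measurable] = L2_measurable[OF f] L2_measurable[OF g]
  let ?I = "\<integral>x. cmod (f x) * cmod (g x) \<partial>M"
  have I0: "0 \<le> ?I" by (intro Bochner_Integration.integral_nonneg) auto
  have "ennreal (?I\<^sup>2) = (ennreal ?I)\<^sup>2" using I0 by (simp add: ennreal_power)
  also have "ennreal ?I = (\<integral>\<^sup>+x. ennreal (cmod (f x) * cmod (g x)) \<partial>M)"
    using L2_prod_integrable(1)[OF f g] by (intro nn_integral_eq_integral[symmetric]) auto
  also have "\<dots> = (\<integral>\<^sup>+x. ennreal (cmod (f x)) * ennreal (cmod (g x)) \<partial>M)"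
    by (simp add: ennreal_mult)
  also have "\<dots>\<^sup>2 \<le> (\<integral>\<^sup>+x. (ennreal (cmod (f x)))\<^sup>2 \<partial>M) * (\<integral>\<^sup>+x. (ennreal (cmod (g x)))\<^sup>2 \<partial>M)"
    by (rule Cauchy_Schwarz_nn_integral) measurable
  also have "\<dots> = L2norm_sq M f * L2norm_sq M g"
    by (simp add: L2norm_sq_def ennreal_power)
  also have "\<dots> = ennreal ((n2 M f * n2 M g)\<^sup>2)"
    by (simp add: L2norm_sq_eq f g ennreal_mult power_mult_distrib)
  finally have "?I\<^sup>2 \<le> (n2 M f * n2 M g)\<^sup>2" by (subst (asm) ennreal_le_iff) auto
  then show ?thesis by (rule power2_le_imp_le) simp
qed

lemma n2_add_le:
  assumes f: "f \<in> L2 M" and g: "g \<in> L2 M"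
  shows "n2 M (\<lambda>x. f x + g x) \<le> n2 M f + n2 M g"
proof -
  note i = L2_integrable[OF f] L2_integrable[OF g] L2_prod_integrable(1)[OF f g]
  have "(n2 M (\<lambda>x. f x + g x))\<^sup>2 \<le> (\<integral>x. (cmod (f x))\<^sup>2 + 2 * (cmod (f x) * cmod (g x)) + (cmod (g x))\<^sup>2 \<partial>M)"
    unfolding n2_sq
  proof (rule integral_mono)
    show "integrable M (\<lambda>x. (cmod (f x + g x))\<^sup>2)" by (rule L2_integrable[OF L2_add[OF f g]])
    show "integrable M (\<lambda>x. (cmod (f x))\<^sup>2 + 2 * (cmod (f x) * cmod (g x)) + (cmod (g x))\<^sup>2)"
      using i by simp
    fix x
    have "(cmod (f x + g x))\<^sup>2 \<le> (cmod (f x) + cmod (g x))\<^sup>2"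
      by (intro power_mono norm_triangle_ineq) auto
    then show "(cmod (f x + g x))\<^sup>2 \<le> (cmod (f x))\<^sup>2 + 2 * (cmod (f x) * cmod (g x)) + (cmod (g x))\<^sup>2"
      by (simp add: power2_eq_square algebra_simps)
  qed
  also have "\<dots> = (n2 M f)\<^sup>2 + 2 * (\<integral>x. cmod (f x) * cmod (g x) \<partial>M) + (n2 M g)\<^sup>2"
    unfolding n2_sq using i by simp
  also have "\<dots> \<le> (n2 M f)\<^sup>2 + 2 * (n2 M f * n2 M g) + (n2 M g)\<^sup>2"
    using Cauchy_Schwarz_L2[OF f g] by simp
  also have "\<dots> = (n2 M f + n2 M g)\<^sup>2" by (simp add: power2_eq_square algebra_simps)
  finally show ?thesis by (rule power2_le_imp_le) simp
qed

lemma n2_minus_commute: "n2 M (\<lambda>x. f x - g x) = n2 M (\<lambda>x. g x - f x)"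
  by (simp add: n2_def norm_minus_commute)

lemma n2_diff_triangle:
  assumes "f \<in> L2 M" "g \<in> L2 M" "h \<in> L2 M"
  shows "n2 M (\<lambda>x. f x - h x) \<le> n2 M (\<lambda>x. f x - g x) + n2 M (\<lambda>x. g x - h x)"
  using n2_add_le[OF L2_diff[OF assms(1,2)] L2_diff[OF assms(2,3)]] by simp

lemma n2_triangle_abs:
  assumes f: "f \<in> L2 M" and g: "g \<in> L2 M"
  shows "\<bar>n2 M f - n2 M g\<bar> \<le> n2 M (\<lambda>x. f x - g x)"
  using n2_add_le[OF L2_diff[OF f g] g] n2_add_le[OF L2_diff[OF g f] f] n2_minus_commute[of M f g]
  by simp

lemma n2_cong_AE:
  assumes "f \<in> borel_measurable M" "g \<in> borel_measurable M" "AE x in M. f x = g x"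
  shows "n2 M f = n2 M g"
proof -
  have "(\<integral>x. (cmod (f x))\<^sup>2 \<partial>M) = (\<integral>x. (cmod (g x))\<^sup>2 \<partial>M)"
    using assms by (intro integral_cong_AE) auto
  then show ?thesis by (simp add: n2_def)
qed

lemma ip_self: "ip M f f = complex_of_real ((n2 M f)\<^sup>2)"
proof -
  have "ip M f f = (\<integral>x. complex_of_real ((cmod (f x))\<^sup>2) \<partial>M)"
    unfolding ip_def by (intro Bochner_Integration.integral_cong refl complex_norm_square[symmetric])
  then show ?thesis by (simp only: n2_sq integral_complex_of_real)
qed

lemma ip_add_left:
  assumes "f \<in> L2 M" "g \<in> L2 M" "k \<in> L2 M"
  shows "ip M (\<lambda>x. f x + g x) k = ip M f k + ip M g k"
  unfolding ip_def using L2_prod_integrable(2)[OF assms(1,3)] L2_prod_integrable(2)[OF assms(2,3)]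
  by (simp add: distrib_right)

lemma ip_add_right:
  assumes "f \<in> L2 M" "g \<in> L2 M" "k \<in> L2 M"
  shows "ip M k (\<lambda>x. f x + g x) = ip M k f + ip M k g"
  unfolding ip_def using L2_prod_integrable(2)[OF assms(3,1)] L2_prod_integrable(2)[OF assms(3,2)]
  by (simp add: distrib_left)

lemma ip_diff_left:
  assumes "f \<in> L2 M" "g \<in> L2 M" "k \<in> L2 M"
  shows "ip M (\<lambda>x. f x - g x) k = ip M f k - ip M g k"
  unfolding ip_def using L2_prod_integrable(2)[OF assms(1,3)] L2_prod_integrable(2)[OF assms(2,3)]
  by (simp add: left_diff_distrib)

lemma ip_cmult_left: "ip M (\<lambda>x. c * f x) k = c * ip M f k"
  unfolding ip_def by (simp add: mult.assoc)

lemma ip_cmult_right: "ip M k (\<lambda>x. c * f x) = cnj c * ip M k f"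
  unfolding ip_def by (simp add: mult.left_commute)

text \<open>Norms determine the inner product, so a linear isometry preserves it. Differences are
  written as \<open>f + c * g\<close> so that linearity of the transform, stated for a general
  \<open>c\<close>, matches every term.\<close>

lemma ip_polarization:
  assumes f: "f \<in> L2 M" and g: "g \<in> L2 M"
  shows "4 * ip M f g = complex_of_real ((n2 M (\<lambda>x. f x + g x))\<^sup>2 - (n2 M (\<lambda>x. f x + (-1) * g x))\<^sup>2)
    + \<i> * complex_of_real ((n2 M (\<lambda>x. f x + \<i> * g x))\<^sup>2 - (n2 M (\<lambda>x. f x + (-\<i>) * g x))\<^sup>2)"
proof -
  have e: "complex_of_real ((n2 M (\<lambda>x. f x + c * g x))\<^sup>2)
      = ip M f f + cnj c * ip M f g + c * ip M g f + c * cnj c * ip M g g" for c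
    using f g L2_cmult[OF g, of c] L2_add[OF f L2_cmult[OF g, of c]]
    unfolding ip_self[symmetric]
    by (simp add: ip_add_left ip_add_right ip_cmult_left ip_cmult_right algebra_simps)
  have e1: "complex_of_real ((n2 M (\<lambda>x. f x + g x))\<^sup>2) = ip M f f + ip M f g + ip M g f + ip M g g"
    using e[of 1] by (simp only: mult_1_left complex_cnj_one)
  show ?thesis
    unfolding of_real_diff e e1 by (simp add: algebra_simps)
qed

text \<open>A subsequence converges almost everywhere because its successive differences decay
  geometrically, and Fatou's lemma turns the pointwise limit into a limit in norm.\<close>

lemma riesz_fischer:
  assumes u: "\<And>n. u n \<in> L2 M"
    and cauchy: "\<And>e. 0 < e \<Longrightarrow> \<exists>N::nat. \<forall>m\<ge>N. \<forall>n\<ge>N. n2 M (\<lambda>x. u m x - u n x) < e"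
  obtains f where "f \<in> L2 M" "(\<lambda>n. n2 M (\<lambda>x. u n x - f x)) \<longlonglongrightarrow> 0"
proof -
  note [measurable] = L2_measurable[OF u]
  have "\<exists>N. \<forall>m\<ge>N. \<forall>n\<ge>N. n2 M (\<lambda>x. u m x - u n x) < (1/4)^k" for k
    by (rule cauchy) simp
  then obtain N where N: "\<And>k m n. m \<ge> N k \<Longrightarrow> n \<ge> N k \<Longrightarrow> n2 M (\<lambda>x. u m x - u n x) < (1/4)^k"
    by metis
  \<comment> \<open>The sum makes \<open>r\<close> increasing and at least \<open>N k\<close>; the
    extra summand \<open>k\<close> makes it tend to infinity.\<close>
  define r where "r k = (\<Sum>i\<le>k. N i) + k" for k
  have rN: "N k \<le> r k" for k unfolding r_def by (simp add: member_le_sum trans_le_add1)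
  have rS: "r k \<le> r (Suc k)" for k unfolding r_def by simp
  have rk: "k \<le> r k" for k unfolding r_def by simp
  define d where "d k x = u (r (Suc k)) x - u (r k) x" for k x
  have d_L2: "d k \<in> L2 M" for k unfolding d_def by (intro L2_diff u)
  note [measurable] = L2_measurable[OF d_L2]
  have dn: "n2 M (d k) \<le> (1/4)^k" for k
    unfolding d_def using N[of k "r (Suc k)" "r k"] rN[of k] rS[of k] by simp
  \<comment> \<open>The rate \<open>(1/4)^k\<close> leaves room for the weight \<open>4^k\<close>:
    the weighted squares still have a finite sum of integrals, and a finite value of the series at
    \<open>x\<close> yields \<open>cmod (d k x) \<le> sqrt C * (1/2)^k\<close>.\<close>
  have fin: "(\<integral>\<^sup>+x. (\<Sum>k. ennreal (4^k * (cmod (d k x))\<^sup>2)) \<partial>M) < \<infinity>"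
  proof -
    have "(\<integral>\<^sup>+x. (\<Sum>k. ennreal (4^k * (cmod (d k x))\<^sup>2)) \<partial>M)
        = (\<Sum>k. \<integral>\<^sup>+x. ennreal (4^k * (cmod (d k x))\<^sup>2) \<partial>M)"
      by (rule nn_integral_suminf) measurable
    also have "\<dots> \<le> (\<Sum>k. ennreal ((1/4)^k))"
    proof (rule suminf_le)
      fix k
      have "(\<integral>\<^sup>+x. ennreal (4^k * (cmod (d k x))\<^sup>2) \<partial>M) = (\<integral>\<^sup>+x. ennreal (4^k) * ennreal ((cmod (d k x))\<^sup>2) \<partial>M)"
        by (simp add: ennreal_mult)
      also have "\<dots> = ennreal (4^k) * L2norm_sq M (d k)"
        unfolding L2norm_sq_def by (rule nn_integral_cmult) measurable
      also have "\<dots> = ennreal (4^k * (n2 M (d k))\<^sup>2)" by (simp add: L2norm_sq_eq d_L2 ennreal_mult)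
      also have "\<dots> \<le> ennreal ((1/4)^k)"
      proof (rule ennreal_leI)
        have "4^k * (n2 M (d k))\<^sup>2 \<le> 4^k * ((1/4)^k)\<^sup>2" using dn[of k] by (intro mult_left_mono power_mono) auto
        also have "\<dots> = (1/4)^k" by (simp add: power2_eq_square power_divide)
        finally show "4^k * (n2 M (d k))\<^sup>2 \<le> (1/4)^k" .
      qed
      finally show "(\<integral>\<^sup>+x. ennreal (4^k * (cmod (d k x))\<^sup>2) \<partial>M) \<le> ennreal ((1/4)^k)" .
    qed auto
    also have "\<dots> = ennreal (\<Sum>k. (1/4)^k)" by (intro suminf_ennreal2 summable_geometric) auto
    also have "\<dots> < \<infinity>" by simp
    finally show ?thesis .
  qed
  have "AE x in M. (\<Sum>k. ennreal (4^k * (cmod (d k x))\<^sup>2)) \<noteq> \<infinity>"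
  proof (rule nn_integral_PInf_AE)
    show "(\<lambda>x. \<Sum>k. ennreal (4^k * (cmod (d k x))\<^sup>2)) \<in> borel_measurable M" by measurable
    show "(\<integral>\<^sup>+x. (\<Sum>k. ennreal (4^k * (cmod (d k x))\<^sup>2)) \<partial>M) \<noteq> \<infinity>"
      using fin by (rule less_imp_neq)
  qed
  then have conv: "AE x in M. convergent (\<lambda>k. u (r k) x)"
  proof (rule AE_mp, intro AE_I2 impI)
    fix x assume x: "(\<Sum>k. ennreal (4^k * (cmod (d k x))\<^sup>2)) \<noteq> \<infinity>"
    define C where "C = enn2real (\<Sum>k. ennreal (4^k * (cmod (d k x))\<^sup>2))"
    have C: "(\<Sum>k. ennreal (4^k * (cmod (d k x))\<^sup>2)) = ennreal C" "0 \<le> C"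
      unfolding C_def using x by (simp_all only: ennreal_enn2real less_top infinity_ennreal_def enn2real_nonneg)
    have b: "cmod (d k x) \<le> sqrt C * (1/2)^k" for k
    proof -
      have "ennreal (4^k * (cmod (d k x))\<^sup>2) \<le> ennreal C"
        unfolding C(1)[symmetric]
        by (rule order_trans[OF _ sum_le_suminf[OF summableI, of "{k}"]]) simp_all
      then have "4^k * (cmod (d k x))\<^sup>2 \<le> C" using C(2) by simp
      moreover have "(4::real)^k = (2^k)\<^sup>2" by (simp add: power2_eq_square power_mult_distrib[symmetric])
      ultimately have "(2^k * cmod (d k x))\<^sup>2 \<le> (sqrt C)\<^sup>2"
        using C(2) by (simp add: power_mult_distrib)
      then have "2^k * cmod (d k x) \<le> sqrt C" by (rule power2_le_imp_le) (use C in simp)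
      then show ?thesis by (simp add: power_divide field_simps)
    qed
    have "summable (\<lambda>k. d k x)"
      by (rule summable_comparison_test'[of "\<lambda>k. sqrt C * (1/2)^k" 0])
        (use b in \<open>auto intro!: summable_mult summable_geometric\<close>)
    then have "convergent (\<lambda>n. \<Sum>k<n. d k x)" by (simp add: summable_iff_convergent)
    moreover have "(\<Sum>k<n. d k x) = u (r n) x - u (r 0) x" for n
      unfolding d_def by (rule sum_lessThan_telescope)
    ultimately have "convergent (\<lambda>n. u (r n) x - u (r 0) x)" by simp
    then show "convergent (\<lambda>k. u (r k) x)" by (simp add: convergent_diff_const_right_iff)
  qed
  define f where "f x = lim (\<lambda>k. u (r k) x)" for x
  have f_meas [measurable]: "f \<in> borel_measurable M" unfolding f_def by measurable
  have bound: "L2norm_sq M (\<lambda>x. u n x - f x) \<le> ennreal (e\<^sup>2)"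
    if e: "0 < e" and K: "\<forall>m\<ge>K. \<forall>n\<ge>K. n2 M (\<lambda>x. u m x - u n x) < e" and n: "n \<ge> K" for n e K
  proof -
    have "L2norm_sq M (\<lambda>x. u n x - f x) = (\<integral>\<^sup>+x. liminf (\<lambda>k. ennreal ((cmod (u n x - u (r k) x))\<^sup>2)) \<partial>M)"
      unfolding L2norm_sq_def
    proof (rule nn_integral_cong_AE, rule AE_mp[OF conv], intro AE_I2 impI)
      fix x assume "convergent (\<lambda>k. u (r k) x)"
      then have "(\<lambda>k. u (r k) x) \<longlonglongrightarrow> f x" unfolding f_def by (simp add: convergent_LIMSEQ_iff)
      then have "(\<lambda>k. ennreal ((cmod (u n x - u (r k) x))\<^sup>2)) \<longlonglongrightarrow> ennreal ((cmod (u n x - f x))\<^sup>2)"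
        by (intro tendsto_intros tendsto_ennrealI)
      then show "ennreal ((cmod (u n x - f x))\<^sup>2) = liminf (\<lambda>k. ennreal ((cmod (u n x - u (r k) x))\<^sup>2))"
        by (intro lim_imp_Liminf[symmetric]) auto
    qed
    also have "\<dots> \<le> liminf (\<lambda>k. \<integral>\<^sup>+x. ennreal ((cmod (u n x - u (r k) x))\<^sup>2) \<partial>M)"
      by (rule nn_integral_liminf) measurable
    also have "\<dots> \<le> liminf (\<lambda>k. ennreal (e\<^sup>2))"
    proof (rule Liminf_mono, rule eventually_sequentiallyI[of K])
      fix k assume k: "K \<le> k"
      have "(\<integral>\<^sup>+x. ennreal ((cmod (u n x - u (r k) x))\<^sup>2) \<partial>M) = ennreal ((n2 M (\<lambda>x. u n x - u (r k) x))\<^sup>2)"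
        using L2norm_sq_eq[OF L2_diff[OF u u], of n "r k"] by (simp add: L2norm_sq_def)
      also have "\<dots> \<le> ennreal (e\<^sup>2)"
        using K n k rk[of k] by (intro ennreal_leI power_mono) (auto intro: less_imp_le)
      finally show "(\<integral>\<^sup>+x. ennreal ((cmod (u n x - u (r k) x))\<^sup>2) \<partial>M) \<le> ennreal (e\<^sup>2)" .
    qed
    also have "\<dots> = ennreal (e\<^sup>2)" by (simp add: Liminf_const)
    finally show ?thesis .
  qed
  obtain K1 where K1: "\<forall>m\<ge>K1. \<forall>n\<ge>K1. n2 M (\<lambda>x. u m x - u n x) < 1" using cauchy[of 1] by auto
  have "L2norm_sq M (\<lambda>x. u K1 x - f x) \<le> ennreal (1\<^sup>2)" by (rule bound[OF _ K1]) auto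
  also have "\<dots> < \<infinity>" by simp
  finally have "(\<lambda>x. u K1 x - f x) \<in> L2 M" by (subst L2_iff) auto
  from L2_diff[OF u[of K1] this] have f: "f \<in> L2 M" by simp
  have "(\<lambda>n. n2 M (\<lambda>x. u n x - f x)) \<longlonglongrightarrow> 0"
  proof (rule LIMSEQ_I)
    fix e :: real assume e: "0 < e"
    obtain K where K: "\<forall>m\<ge>K. \<forall>n\<ge>K. n2 M (\<lambda>x. u m x - u n x) < e/2" using cauchy[of "e/2"] e by auto
    show "\<exists>no. \<forall>n\<ge>no. norm (n2 M (\<lambda>x. u n x - f x) - 0) < e"
    proof (intro exI[of _ K] allI impI)
      fix n assume n: "K \<le> n"
      have "ennreal ((n2 M (\<lambda>x. u n x - f x))\<^sup>2) \<le> ennreal ((e/2)\<^sup>2)"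
        using bound[OF _ K n] e L2norm_sq_eq[OF L2_diff[OF u f], of n] by simp
      then have "(n2 M (\<lambda>x. u n x - f x))\<^sup>2 \<le> (e/2)\<^sup>2" by (subst (asm) ennreal_le_iff) auto
      then have "n2 M (\<lambda>x. u n x - f x) \<le> e/2" by (rule power2_le_imp_le) (use e in simp)
      then show "norm (n2 M (\<lambda>x. u n x - f x) - 0) < e" using e by simp
    qed
  qed
  with f show thesis by (rule that)
qed

text \<open>Dominated by \<open>(2 * C)\<^sup>2 * (cmod (F x))\<^sup>2\<close>. It serves both for
  pointwise limits of multipliers and for exhausting the dual by pieces.\<close>

lemma L2_dominated_convergence:
  assumes F: "F \<in> L2 M" and m [measurable]: "\<And>n::nat. m n \<in> borel_measurable M"
    and b: "\<And>n x. x \<in> space M \<Longrightarrow> cmod (m n x) \<le> C"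
    and k [measurable]: "k \<in> borel_measurable M"
    and lim: "\<And>x. x \<in> space M \<Longrightarrow> (\<lambda>n. m n x) \<longlonglongrightarrow> k x"
  shows "(\<lambda>n. n2 M (\<lambda>x. m n x * F x - k x * F x)) \<longlonglongrightarrow> 0"
proof -
  note [measurable] = L2_measurable[OF F]
  have kb: "cmod (k x) \<le> C" if "x \<in> space M" for x
    by (rule LIMSEQ_le_const2[OF tendsto_norm[OF lim[OF that]]]) (use b[OF that] in auto)
  have "(\<lambda>n. \<integral>x. (cmod (m n x * F x - k x * F x))\<^sup>2 \<partial>M) \<longlonglongrightarrow> (\<integral>x. 0 \<partial>M)"
  proof (rule integral_dominated_convergence)
    show "integrable M (\<lambda>x. (2 * C)\<^sup>2 * (cmod (F x))\<^sup>2)"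
      using L2_integrable[OF F] by (rule integrable_mult_right)
    show "AE x in M. (\<lambda>n. (cmod (m n x * F x - k x * F x))\<^sup>2) \<longlonglongrightarrow> 0"
    proof (rule AE_I2)
      fix x assume "x \<in> space M"
      from lim[OF this] have "(\<lambda>n. (cmod (m n x * F x - k x * F x))\<^sup>2) \<longlonglongrightarrow> (cmod (k x * F x - k x * F x))\<^sup>2"
        by (intro tendsto_intros)
      then show "(\<lambda>n. (cmod (m n x * F x - k x * F x))\<^sup>2) \<longlonglongrightarrow> 0" by simp
    qed
    fix n show "AE x in M. norm ((cmod (m n x * F x - k x * F x))\<^sup>2) \<le> (2 * C)\<^sup>2 * (cmod (F x))\<^sup>2"
    proof (rule AE_I2)
      fix x assume x: "x \<in> space M"
      have "cmod (m n x - k x) \<le> 2 * C"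
        using norm_triangle_ineq4[of "m n x" "k x"] b[OF x, of n] kb[OF x] by simp
      then have "(cmod (m n x - k x))\<^sup>2 * (cmod (F x))\<^sup>2 \<le> (2 * C)\<^sup>2 * (cmod (F x))\<^sup>2"
        by (intro mult_right_mono power_mono) auto
      then show "norm ((cmod (m n x * F x - k x * F x))\<^sup>2) \<le> (2 * C)\<^sup>2 * (cmod (F x))\<^sup>2"
        by (simp add: left_diff_distrib[symmetric] norm_mult power_mult_distrib)
    qed
  qed measurable
  then have "(\<lambda>n. sqrt (\<integral>x. (cmod (m n x * F x - k x * F x))\<^sup>2 \<partial>M)) \<longlonglongrightarrow> sqrt 0"
    by (intro tendsto_real_sqrt) simp
  then show ?thesis by (simp add: n2_def)
qed

lemma indicator_L2:
  assumes B: "B \<in> sets M" "emeasure M B < \<infinity>"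
  shows "(indicator B :: _ \<Rightarrow> complex) \<in> L2 M" "L2norm_sq M (indicator B) = emeasure M B"
proof -
  have sq: "ennreal ((cmod (indicator B x))\<^sup>2) = indicator B x" for x by (auto split: split_indicator)
  have "(\<integral>\<^sup>+x. ennreal ((cmod (indicator B x))\<^sup>2) \<partial>M) = emeasure M B"
    unfolding sq using B(1) by simp
  then show n: "L2norm_sq M (indicator B) = emeasure M B" unfolding L2norm_sq_def .
  show "(indicator B :: _ \<Rightarrow> complex) \<in> L2 M" by (subst L2_iff) (use B n in auto)
qed

subsection \<open>The dual group as a measurable space\<close>

locale dual_pair =
  fixes dx :: "'a::{topological_ab_group_add, t2_space, second_countable_topology} measure"
    and lam :: "('a \<Rightarrow> complex) measure"
  assumes A_lc: "locally_compact_space (euclidean :: 'a topology)"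
    and haarA: "is_haar_A dx"
    and haar_dual: "is_plancherel_dual_haar dx lam"
begin

abbreviation Ch :: "('a \<Rightarrow> complex) set" where "Ch \<equiv> characters TYPE('a)"

lemma sets_dx [measurable_cong, simp]: "sets dx = sets borel"
  using haarA by (simp add: is_haar_A_def)

lemma space_dx [simp]: "space dx = UNIV"
  using sets_eq_imp_space_eq[OF sets_dx] by simp

lemma space_lam [simp]: "space lam = Ch"
  using haar_dual by (simp add: is_plancherel_dual_haar_def)

lemma sigma_finite_dx: "sigma_finite_measure dx"
proof (rule sigma_finite_borel_of_top[OF second_countable_euclidean A_lc])
  show "sets dx = sets (borel_of_top (euclidean :: 'a topology))"
    by (simp add: sets_borel_of_top_euclidean)
  show "emeasure dx K < \<infinity>" if "compactin euclidean K" for K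
    using haarA that by (simp add: is_haar_A_def)
  show "Hausdorff_space (euclidean :: 'a topology)"
    unfolding Hausdorff_space_def disjnt_def using separation_t2[where 'a='a] by simp
qed

sublocale dx: sigma_finite_measure dx by (rule sigma_finite_dx)

lemma Ch_I:
  "continuous_on UNIV c \<Longrightarrow> (\<And>x. cmod (c x) = 1) \<Longrightarrow> (\<And>x y. c (x + y) = c x * c y) \<Longrightarrow> c \<in> Ch"
  by (simp add: characters_def)

lemma Ch_continuous: "c \<in> Ch \<Longrightarrow> continuous_on UNIV c"
  and Ch_norm: "c \<in> Ch \<Longrightarrow> cmod (c x) = 1"
  and Ch_add: "c \<in> Ch \<Longrightarrow> c (x + y) = c x * c y"
  by (simp_all add: characters_def)

lemma Ch_nonzero: "c \<in> Ch \<Longrightarrow> c x \<noteq> 0"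
  using Ch_norm[of c x] by auto

lemma Ch_zero: "c \<in> Ch \<Longrightarrow> c 0 = 1"
  using Ch_add[of c 0 0] Ch_nonzero[of c 0] by simp

lemma Ch_cnj_mult: "c \<in> Ch \<Longrightarrow> c x * cnj (c x) = 1" "c \<in> Ch \<Longrightarrow> cnj (c x) * c x = 1"
  using Ch_norm[of c x] by (simp_all add: complex_norm_square[symmetric] mult.commute[of "cnj (c x)"])

lemma Ch_minus: "c \<in> Ch \<Longrightarrow> c (- x) = cnj (c x)"
proof -
  assume c: "c \<in> Ch"
  have "c (- x) * c x = 1" using Ch_add[OF c, of "-x" x] Ch_zero[OF c] by simp
  then have "c (- x) * (c x * cnj (c x)) = cnj (c x)" by (simp add: mult.assoc[symmetric])
  then show ?thesis using Ch_cnj_mult[OF c] by simp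
qed

lemma Ch_measurable [measurable_dest]: "c \<in> Ch \<Longrightarrow> c \<in> borel_measurable borel"
  by (rule borel_measurable_continuous_onI[OF Ch_continuous])

section \<open>Borel sets of the dual group\<close>

abbreviation ev_sets :: "('a \<Rightarrow> complex) set set" where
  "ev_sets \<equiv> {{\<xi> \<in> Ch. \<xi> a \<in> U} | a U. open U}"

abbreviation dual_subbase :: "('a \<Rightarrow> complex) set set" where
  "dual_subbase \<equiv> {{c \<in> Ch. c ` K \<subseteq> U} | K U. compact K \<and> open U}"

lemma sigma_ev_sets: "sets (sigma Ch ev_sets) = sigma_sets Ch ev_sets" "space (sigma Ch ev_sets) = Ch"
proof -
  have "ev_sets \<subseteq> Pow Ch" by auto
  then show "sets (sigma Ch ev_sets) = sigma_sets Ch ev_sets" "space (sigma Ch ev_sets) = Ch"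
    by (rule sets_measure_of, rule space_measure_of)
qed

lemma ev_sigma: "(\<lambda>\<xi>. \<xi> a) \<in> borel_measurable (sigma Ch ev_sets)"
proof (rule borel_measurableI)
  fix U :: "complex set" assume "open U"
  then have "{\<xi> \<in> Ch. \<xi> a \<in> U} \<in> sigma_sets Ch ev_sets" by (intro sigma_sets.Basic) blast
  moreover have "{\<xi> \<in> Ch. \<xi> a \<in> U} = (\<lambda>\<xi>. \<xi> a) -` U \<inter> space (sigma Ch ev_sets)"
    unfolding sigma_ev_sets by auto
  ultimately show "(\<lambda>\<xi>. \<xi> a) -` U \<inter> space (sigma Ch ev_sets) \<in> sets (sigma Ch ev_sets)"
    unfolding sigma_ev_sets(1) by simp
qed

text \<open>Continuity of \<open>c\<close> and closedness of \<open>C\<close> reduce the inclusion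
  to the points of \<open>B\<close> in a countable dense set. Openness of \<open>B\<close> makes
  these points dense in \<open>B\<close>, hence the use of open sources and closed targets in the
  network below.\<close>

lemma closed_image_sigma:
  assumes B: "open B" and C: "closed C"
  shows "{c \<in> Ch. c ` B \<subseteq> C} \<in> sigma_sets Ch ev_sets"
proof -
  obtain D :: "'a set" where D: "countable D" "\<And>X. open X \<Longrightarrow> X \<noteq> {} \<Longrightarrow> \<exists>d\<in>D. d \<in> X"
    by (rule countable_dense_setE, rule that)
  have "c ` B \<subseteq> C" if c: "c \<in> Ch" and d: "\<forall>d\<in>D \<inter> B. c d \<in> C" for c
  proof (rule ccontr)
    assume "\<not> c ` B \<subseteq> C"
    then have ne: "B \<inter> c -` (- C) \<noteq> {}" by blast
    have "open (c -` (- C))" using Ch_continuous[OF c] C by (intro open_vimage) auto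
    then have "open (B \<inter> c -` (- C))" using B by (intro open_Int)
    from D(2)[OF this ne] obtain d where "d \<in> D" "d \<in> B \<inter> c -` (- C)" by blast
    then show False using d by blast
  qed
  then have "{c \<in> Ch. c ` B \<subseteq> C} = {c \<in> space (sigma Ch ev_sets). \<forall>d\<in>D \<inter> B. c d \<in> C}"
    unfolding sigma_ev_sets by blast
  also have "\<dots> \<in> sets (sigma Ch ev_sets)"
  proof -
    have m: "{c \<in> space (sigma Ch ev_sets). c d \<in> C} \<in> sets (sigma Ch ev_sets)" for d
      using measurable_sets[OF ev_sigma[of d] borel_closed[OF C]] by (simp add: vimage_def Int_def conj_commute)
    have "(\<Union>d\<in>D \<inter> B. space (sigma Ch ev_sets) - {c \<in> space (sigma Ch ev_sets). c d \<in> C}) \<in> sets (sigma Ch ev_sets)"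
      using D(1) m by (intro sets.countable_UN') auto
    from sets.compl_sets[OF this]
    show ?thesis by (rule back_subst[where P="\<lambda>S. S \<in> sets (sigma Ch ev_sets)"]) blast
  qed
  finally show ?thesis unfolding sigma_ev_sets .
qed

lemma complex_basis_closure:
  assumes V: "topological_basis \<V>" and U: "open U" "z \<in> (U :: complex set)"
  obtains V where "V \<in> \<V>" "z \<in> V" "closure V \<subseteq> U"
proof -
  obtain e where e: "0 < e" "cball z e \<subseteq> U" using U by (meson open_contains_cball)
  obtain V where V': "V \<in> \<V>" "z \<in> V" "V \<subseteq> ball z e"
    using topological_basisE[OF V, of "ball z e" z] e by auto
  have "closure V \<subseteq> cball z e" by (rule closure_minimal) (use V' ball_subset_cball in auto)
  with V' e that show thesis by blast
qed

text \<open>The countably many sets of characters mapping a basic open set of \<open>A\<close> into the closure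
  of a basic open set of \<open>\<complex>\<close> form a network of the compact-open topology, up to finite
  intersections. This is why the Borel sets are generated by the evaluations.\<close>
lemma dual_network:
  assumes B: "topological_basis \<B>" and V: "topological_basis \<V>"
    and W: "generate_topology_on dual_subbase W" and c: "c \<in> W"
  shows "\<exists>F. finite F \<and> F \<subseteq> \<B> \<times> \<V> \<and> (\<forall>(P,Q)\<in>F. c ` P \<subseteq> closure Q) \<and>
     {c' \<in> Ch. \<forall>(P,Q)\<in>F. c' ` P \<subseteq> closure Q} \<subseteq> W"
  using W c
proof (induction)
  case Empty
  then show ?case by simp
next
  case (Int a b)
  then have "c \<in> a" "c \<in> b" by auto
  from Int.IH(1)[OF this(1)] obtain F where F: "finite F" "F \<subseteq> \<B> \<times> \<V>" "\<forall>(P,Q)\<in>F. c ` P \<subseteq> closure Q"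
      "{c' \<in> Ch. \<forall>(P,Q)\<in>F. c' ` P \<subseteq> closure Q} \<subseteq> a" by (elim exE conjE) (rule that)
  from Int.IH(2)[OF \<open>c \<in> b\<close>] obtain G where G: "finite G" "G \<subseteq> \<B> \<times> \<V>" "\<forall>(P,Q)\<in>G. c ` P \<subseteq> closure Q"
      "{c' \<in> Ch. \<forall>(P,Q)\<in>G. c' ` P \<subseteq> closure Q} \<subseteq> b" by (elim exE conjE) (rule that)
  show ?case
  proof (intro exI[of _ "F \<union> G"] conjI)
    show "\<forall>(P,Q)\<in>F \<union> G. c ` P \<subseteq> closure Q" using F(3) G(3) by (simp add: ball_Un)
    show "{c' \<in> Ch. \<forall>(P,Q)\<in>F \<union> G. c' ` P \<subseteq> closure Q} \<subseteq> a \<inter> b"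
    proof
      fix c' assume "c' \<in> {c' \<in> Ch. \<forall>(P,Q)\<in>F \<union> G. c' ` P \<subseteq> closure Q}"
      then have "c' \<in> {c' \<in> Ch. \<forall>(P,Q)\<in>F. c' ` P \<subseteq> closure Q}" "c' \<in> {c' \<in> Ch. \<forall>(P,Q)\<in>G. c' ` P \<subseteq> closure Q}"
        by (simp_all add: ball_Un)
      then show "c' \<in> a \<inter> b" using subsetD[OF F(4)] subsetD[OF G(4)] by (intro IntI)
    qed
    show "finite (F \<union> G)" "F \<union> G \<subseteq> \<B> \<times> \<V>" using F(1,2) G(1,2) by simp_all
  qed
next
  case (UN K)
  then obtain k where k: "k \<in> K" "c \<in> k" by blast
  from UN.IH[OF k] obtain F where F: "finite F" "F \<subseteq> \<B> \<times> \<V>" "\<forall>(P,Q)\<in>F. c ` P \<subseteq> closure Q"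
      "{c' \<in> Ch. \<forall>(P,Q)\<in>F. c' ` P \<subseteq> closure Q} \<subseteq> k" by (elim exE conjE) (rule that)
  have "{c' \<in> Ch. \<forall>(P,Q)\<in>F. c' ` P \<subseteq> closure Q} \<subseteq> \<Union>K"
    using F(4) Union_upper[OF k(1)] by (rule order_trans)
  with F show ?case by (intro exI[of _ F] conjI)
next
  case (Basis s)
  then obtain K U where s: "s = {c \<in> Ch. c ` K \<subseteq> U}" "compact K" "open U" by blast
  have c: "c \<in> Ch" "c ` K \<subseteq> U" using Basis s by auto
  have "\<exists>P Q. P \<in> \<B> \<and> Q \<in> \<V> \<and> x \<in> P \<and> c ` P \<subseteq> closure Q \<and> closure Q \<subseteq> U" if x: "x \<in> K" for x
  proof -
    obtain Q where Q: "Q \<in> \<V>" "c x \<in> Q" "closure Q \<subseteq> U"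
      by (rule complex_basis_closure[OF V s(3), of "c x"]) (use c x in auto)
    have "open (c -` Q)" using Ch_continuous[OF c(1)] topological_basis_open[OF V Q(1)]
      by (intro open_vimage)
    then obtain P where "P \<in> \<B>" "x \<in> P" "P \<subseteq> c -` Q"
      using topological_basisE[OF B, of "c -` Q" x] Q(2) by blast
    then show ?thesis using Q closure_subset[of Q] by blast
  qed
  then obtain P Q where PQ: "\<And>x. x \<in> K \<Longrightarrow> P x \<in> \<B> \<and> Q x \<in> \<V> \<and> x \<in> P x \<and> c ` P x \<subseteq> closure (Q x) \<and> closure (Q x) \<subseteq> U"
    by metis
  \<comment> \<open>Compactness of \<open>K\<close> keeps the family of conditions finite, so that
    only countably many families can arise.\<close>
  have "\<exists>C\<subseteq>K. finite C \<and> K \<subseteq> (\<Union>x\<in>C. P x)"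
  proof (rule compactE_image[OF s(2), of K P])
    show "open (P x)" if "x \<in> K" for x using PQ[OF that] topological_basis_open[OF B] by blast
    show "K \<subseteq> (\<Union>x\<in>K. P x)" using PQ by blast
  qed blast
  then obtain C where C: "C \<subseteq> K" "finite C" "K \<subseteq> (\<Union>x\<in>C. P x)" by blast
  let ?F = "(\<lambda>x. (P x, Q x)) ` C"
  show ?case
  proof (intro exI[of _ ?F] conjI)
    show "finite ?F" using C by simp
    show "?F \<subseteq> \<B> \<times> \<V>" using PQ C by blast
    show "\<forall>(P,Q)\<in>?F. c ` P \<subseteq> closure Q" using PQ C by auto
    show "{c' \<in> Ch. \<forall>(P,Q)\<in>?F. c' ` P \<subseteq> closure Q} \<subseteq> s"
    proof
      fix c' assume c': "c' \<in> {c' \<in> Ch. \<forall>(P,Q)\<in>?F. c' ` P \<subseteq> closure Q}"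
      have "c' y \<in> U" if y: "y \<in> K" for y
      proof -
        obtain x where x: "x \<in> C" "y \<in> P x" using C y by blast
        then have "c' ` P x \<subseteq> closure (Q x)" using c' by auto
        then show ?thesis using x PQ[of x] C(1) by blast
      qed
      then show "c' \<in> s" using c' s(1) by auto
    qed
  qed
qed

text \<open>Through this identity a map into the dual can be tested for measurability on evaluations
  alone. One inclusion holds because an evaluation condition is a compact-open condition on a
  singleton; for the other, an open set is the union of the countably many finite intersections of
  network sets that it contains.\<close>

lemma sets_lam: "sets lam = sigma_sets Ch ev_sets"
proof
  have dt: "dual_topology TYPE('a) = topology_generated_by dual_subbase"
    by (simp add: dual_topology_def)
  have top: "topspace (dual_topology TYPE('a)) = Ch"
  proof -
    have "Ch \<in> dual_subbase" by (intro CollectI exI[of _ "{}"] exI[of _ UNIV]) auto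
    then show ?thesis unfolding dt topology_generated_by_topspace by auto
  qed
  have sl: "sets lam = sigma_sets Ch {U. openin (dual_topology TYPE('a)) U}"
    using haar_dual sets_borel_of_top[of "dual_topology TYPE('a)"]
    by (simp add: is_plancherel_dual_haar_def top)
  show "sigma_sets Ch ev_sets \<subseteq> sets lam"
    unfolding sl
  proof (rule sigma_sets_mono, rule subsetI)
    fix W assume "W \<in> ev_sets"
    then obtain a U where W: "W = {\<xi> \<in> Ch. \<xi> a \<in> U}" "open U" by blast
    then have "W = {\<xi> \<in> Ch. \<xi> ` {a} \<subseteq> U}" by auto
    then have "W \<in> dual_subbase" using W(2) compact_sing[of a] by blast
    then have "openin (dual_topology TYPE('a)) W" unfolding dt by (rule topology_generated_by_Basis)
    then show "W \<in> sigma_sets Ch {U. openin (dual_topology TYPE('a)) U}" by (intro sigma_sets.Basic) simp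
  qed
  obtain \<B> :: "'a set set" where B: "countable \<B>" "topological_basis \<B>" using ex_countable_basis by blast
  obtain \<V> :: "complex set set" where V: "countable \<V>" "topological_basis \<V>" using ex_countable_basis by blast
  define E where "E F = {c \<in> Ch. \<forall>(P,Q)\<in>F. c ` P \<subseteq> closure Q}" for F :: "('a set \<times> complex set) set"
  have E_sets: "E F \<in> sets (sigma Ch ev_sets)" if F: "finite F" "F \<subseteq> \<B> \<times> \<V>" for F
  proof -
    have "E F = {c \<in> space (sigma Ch ev_sets). \<forall>p\<in>F. c ` fst p \<subseteq> closure (snd p)}"
      unfolding E_def sigma_ev_sets by (simp add: split_beta')
    also have "\<dots> \<in> sets (sigma Ch ev_sets)"
    proof (rule sets.sets_Collect_finite_All[OF _ F(1)])
      fix p assume "p \<in> F"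
      then have "open (fst p)" using F(2) topological_basis_open[OF B(2)] by auto
      from closed_image_sigma[OF this closed_closure, of "snd p"]
      show "{c \<in> space (sigma Ch ev_sets). c ` fst p \<subseteq> closure (snd p)} \<in> sets (sigma Ch ev_sets)"
        unfolding sigma_ev_sets .
    qed
    finally show ?thesis .
  qed
  show "sets lam \<subseteq> sigma_sets Ch ev_sets"
    unfolding sl
  proof (rule sigma_sets_mono, rule subsetI)
    fix W assume "W \<in> {U. openin (dual_topology TYPE('a)) U}"
    then have W: "generate_topology_on dual_subbase W"
      by (simp add: dt openin_topology_generated_by_iff)
    let ?F = "{F. finite F \<and> F \<subseteq> \<B> \<times> \<V> \<and> E F \<subseteq> W}"
    have "W \<subseteq> Ch" using openin_subset[of "dual_topology TYPE('a)" W] W top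
      by (simp add: dt openin_topology_generated_by_iff)
    have "W = (\<Union>F\<in>?F. E F)"
    proof
      show "W \<subseteq> (\<Union>F\<in>?F. E F)"
      proof
        fix c assume c: "c \<in> W"
        from dual_network[OF B(2) V(2) W c] obtain F where F: "finite F" "F \<subseteq> \<B> \<times> \<V>"
          "\<forall>(P,Q)\<in>F. c ` P \<subseteq> closure Q" "E F \<subseteq> W" unfolding E_def[symmetric] by (elim exE conjE) (rule that)
        have "c \<in> Ch" using c \<open>W \<subseteq> Ch\<close> by blast
        then have "c \<in> E F" using F(3) unfolding E_def by simp
        with F show "c \<in> (\<Union>F\<in>?F. E F)" by blast
      qed
    qed blast
    moreover have "(\<Union>F\<in>?F. E F) \<in> sets (sigma Ch ev_sets)"
    proof (rule sets.countable_UN')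
      have "countable {F. finite F \<and> F \<subseteq> \<B> \<times> \<V>}"
        using B(1) V(1) by (intro countable_Collect_finite_subset) auto
      then show "countable ?F" by (rule countable_subset[rotated]) auto
      show "E ` ?F \<subseteq> sets (sigma Ch ev_sets)" using E_sets by blast
    qed
    ultimately show "W \<in> sigma_sets Ch ev_sets" unfolding sigma_ev_sets by simp
  qed
qed

lemma ev_measurable [measurable]: "(\<lambda>\<xi>. \<xi> a) \<in> borel_measurable lam"
  using ev_sigma[of a] by (subst measurable_cong_sets[of lam "sigma Ch ev_sets"]) (auto simp: sets_lam sigma_ev_sets)

lemma measurable_lamI:
  assumes f: "\<And>x. x \<in> space M \<Longrightarrow> f x \<in> Ch" and m: "\<And>a. (\<lambda>x. f x a) \<in> borel_measurable M"
  shows "f \<in> M \<rightarrow>\<^sub>M lam"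
proof (rule measurable_sigma_sets[OF sets_lam])
  show "ev_sets \<subseteq> Pow Ch" by auto
  show "f \<in> space M \<rightarrow> Ch" using f by auto
  fix W assume "W \<in> ev_sets"
  then obtain a U where W: "W = {\<xi> \<in> Ch. \<xi> a \<in> U}" "open U" by blast
  then have "f -` W \<inter> space M = (\<lambda>x. f x a) -` U \<inter> space M" using f by auto
  then show "f -` W \<inter> space M \<in> sets M" using measurable_sets[OF m[of a] borel_open[OF W(2)]] by simp
qed

text \<open>By continuity, \<open>\<xi> x \<in> U\<close> holds iff some basic neighbourhood
  \<open>P\<close> of \<open>x\<close> is mapped by \<open>\<xi>\<close> into
  \<open>closure Q\<close> for a basic \<open>Q\<close> with \<open>closure Q \<subseteq> U\<close>.
  The preimage is thus a countable union of measurable rectangles.\<close>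

lemma ev_joint_measurable: "(\<lambda>(\<xi>, x). \<xi> x) \<in> borel_measurable (lam \<Otimes>\<^sub>M (borel :: 'a measure))"
proof (rule borel_measurableI)
  fix U :: "complex set" assume U: "open U"
  obtain \<B> :: "'a set set" where B: "countable \<B>" "topological_basis \<B>" using ex_countable_basis by blast
  obtain \<V> :: "complex set set" where V: "countable \<V>" "topological_basis \<V>" using ex_countable_basis by blast
  let ?F = "{(P,Q) \<in> \<B> \<times> \<V>. closure Q \<subseteq> U}"
  let ?R = "\<lambda>(P,Q). {c \<in> Ch. c ` P \<subseteq> closure Q} \<times> P"
  have "(\<lambda>(\<xi>, x). \<xi> x) -` U \<inter> space (lam \<Otimes>\<^sub>M (borel :: 'a measure)) = (\<Union>p\<in>?F. ?R p)"
  proof (intro set_eqI iffI)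
    fix z assume z: "z \<in> (\<lambda>(\<xi>, x). \<xi> x) -` U \<inter> space (lam \<Otimes>\<^sub>M (borel :: 'a measure))"
    obtain c x where cx: "z = (c, x)" by (cases z)
    with z have c: "c \<in> Ch" "c x \<in> U" by (auto simp: space_pair_measure)
    obtain Q where Q: "Q \<in> \<V>" "c x \<in> Q" "closure Q \<subseteq> U"
      by (rule complex_basis_closure[OF V(2) U c(2)])
    have "open (c -` Q)" using Ch_continuous[OF c(1)] topological_basis_open[OF V(2) Q(1)]
      by (intro open_vimage)
    then obtain P where P: "P \<in> \<B>" "x \<in> P" "P \<subseteq> c -` Q"
      using topological_basisE[OF B(2), of "c -` Q" x] Q(2) by blast
    have "c ` P \<subseteq> closure Q" using P(3) closure_subset[of Q] by blast
    then have "z \<in> ?R (P,Q)" using c P cx by simp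
    moreover have "(P,Q) \<in> ?F" using P Q by simp
    ultimately show "z \<in> (\<Union>p\<in>?F. ?R p)" by blast
  next
    fix z assume "z \<in> (\<Union>p\<in>?F. ?R p)"
    then obtain P Q where "closure Q \<subseteq> U" "z \<in> {c \<in> Ch. c ` P \<subseteq> closure Q} \<times> P" by blast
    then show "z \<in> (\<lambda>(\<xi>, x). \<xi> x) -` U \<inter> space (lam \<Otimes>\<^sub>M (borel :: 'a measure))"
      by (auto simp: space_pair_measure)
  qed
  moreover have "(\<Union>p\<in>?F. ?R p) \<in> sets (lam \<Otimes>\<^sub>M (borel :: 'a measure))"
  proof (rule sets.countable_UN')
    show "countable ?F" using B(1) V(1) by (auto intro: countable_subset[of _ "\<B> \<times> \<V>"])
    show "?R ` ?F \<subseteq> sets (lam \<Otimes>\<^sub>M (borel :: 'a measure))"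
    proof safe
      fix P Q assume "P \<in> \<B>"
      then have "open P" using topological_basis_open[OF B(2)] by blast
      then show "{c \<in> Ch. c ` P \<subseteq> closure Q} \<times> P \<in> sets (lam \<Otimes>\<^sub>M (borel :: 'a measure))"
        using closed_image_sigma[of P "closure Q"] by (intro pair_measureI) (auto simp: sets_lam)
    qed
  qed
  ultimately show "(\<lambda>(\<xi>, x). \<xi> x) -` U \<inter> space (lam \<Otimes>\<^sub>M (borel :: 'a measure)) \<in> sets (lam \<Otimes>\<^sub>M (borel :: 'a measure))"
    by simp
qed

lemma ev_joint:
  assumes "f \<in> M \<rightarrow>\<^sub>M lam" "g \<in> M \<rightarrow>\<^sub>M borel"
  shows "(\<lambda>x. f x (g x)) \<in> borel_measurable M"
  using measurable_compose[OF measurable_Pair[OF assms] ev_joint_measurable] by simp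

lemma fourier_measurable [measurable]:
  assumes [measurable]: "f \<in> borel_measurable borel"
  shows "fourier dx f \<in> borel_measurable lam"
proof -
  have [measurable]: "(\<lambda>p. fst p (snd p)) \<in> borel_measurable (lam \<Otimes>\<^sub>M dx)"
    by (rule ev_joint) measurable
  have "(\<lambda>(\<xi>, x). f x * cnj (\<xi> x)) \<in> borel_measurable (lam \<Otimes>\<^sub>M dx)"
    unfolding split_beta' by measurable
  from dx.borel_measurable_lebesgue_integral[OF this] show ?thesis
    by (simp add: fourier_def[abs_def])
qed

section \<open>Group structure and finiteness properties of the two Haar measures\<close>

lemma dual_group: "measurable_group lam (\<lambda>\<xi> \<eta> x. \<xi> x * \<eta> x) (\<lambda>\<xi> x. cnj (\<xi> x)) (\<lambda>_. 1)"
proof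
  show "(\<lambda>(\<xi>, \<eta>) x. \<xi> x * \<eta> x) \<in> lam \<Otimes>\<^sub>M lam \<rightarrow>\<^sub>M lam"
    unfolding split_beta'
  proof (rule measurable_lamI)
    fix p assume "p \<in> space (lam \<Otimes>\<^sub>M lam)"
    then have p: "fst p \<in> Ch" "snd p \<in> Ch" by (auto simp: space_pair_measure)
    show "(\<lambda>x. fst p x * snd p x) \<in> Ch"
    proof (rule Ch_I)
      show "continuous_on UNIV (\<lambda>x. fst p x * snd p x)"
        by (intro continuous_on_mult Ch_continuous p)
    qed (simp_all add: norm_mult Ch_norm[OF p(1)] Ch_norm[OF p(2)] Ch_add[OF p(1)] Ch_add[OF p(2)])
  next
    fix a show "(\<lambda>p. fst p a * snd p a) \<in> borel_measurable (lam \<Otimes>\<^sub>M lam)"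
      using measurable_compose[OF measurable_fst ev_measurable[of a]]
        measurable_compose[OF measurable_snd ev_measurable[of a]] by (rule borel_measurable_times)
  qed
  show "(\<lambda>\<xi> x. cnj (\<xi> x)) \<in> lam \<rightarrow>\<^sub>M lam"
  proof (rule measurable_lamI)
    fix \<xi> assume "\<xi> \<in> space lam"
    then have x: "\<xi> \<in> Ch" by simp
    show "(\<lambda>x. cnj (\<xi> x)) \<in> Ch"
      by (rule Ch_I) (simp_all add: continuous_on_cnj Ch_continuous[OF x] Ch_norm[OF x] Ch_add[OF x])
  qed measurable
  show "(\<lambda>_. 1) \<in> space lam" unfolding space_lam by (rule Ch_I) simp_all
qed (auto simp: mult.assoc Ch_cnj_mult)

lemma left_inv_lam: "left_inv lam (\<lambda>\<xi> \<eta> x. \<xi> x * \<eta> x) lam"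
  using haar_dual by (simp add: left_inv_def is_plancherel_dual_haar_def)

lemma A_group: "measurable_group (borel :: 'a measure) (+) uminus 0"
proof
  show "uminus \<in> (borel :: 'a measure) \<rightarrow>\<^sub>M borel"
    by (intro borel_measurable_continuous_onI continuous_intros)
qed (auto simp: add.assoc)

lemma left_inv_dx: "left_inv borel (+) dx"
  using haarA by (simp add: left_inv_def is_haar_A_def)

text \<open>A compact neighbourhood bounds the measure from above, and Haar measure is positive on
  open sets. Taking a member of a given base keeps the separating family of transforms
  countable.\<close>

lemma finite_measure_nbhd:
  assumes "open U" "0 \<in> U" and B: "topological_basis \<B>"
  obtains B where "B \<in> \<B>" "0 \<in> B" "B \<subseteq> U" "0 < emeasure dx B" "emeasure dx B < \<infinity>"
proof -
  have "\<exists>P K. open P \<and> compact K \<and> (0::'a) \<in> P \<and> P \<subseteq> K"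
    using A_lc by (simp add: locally_compact_space_def)
  then obtain P K where P: "open P" "compact K" "(0::'a) \<in> P" "P \<subseteq> K" by blast
  obtain B where B': "B \<in> \<B>" "0 \<in> B" "B \<subseteq> U \<inter> P"
    by (rule topological_basisE[OF B, of "U \<inter> P" 0]) (use assms P in auto)
  have "open B" using topological_basis_open[OF B B'(1)] .
  then have "0 < emeasure dx B" using B'(2) haarA by (auto simp: is_haar_A_def)
  moreover have "emeasure dx B \<le> emeasure dx K"
    using B' P by (intro emeasure_mono) (auto simp: compact_imp_closed)
  moreover have "emeasure dx K < \<infinity>" using haarA P by (auto simp: is_haar_A_def)
  ultimately show thesis using B' that by (meson le_less_trans le_inf_iff)
qed

lemma dx_nonzero: "emeasure dx (space dx) \<noteq> 0"
proof -
  have "0 < emeasure dx UNIV" using haarA unfolding is_haar_A_def by (meson UNIV_not_empty open_UNIV)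
  then show ?thesis by simp
qed

text \<open>Near 0 a character has real part above 1/2, so the indicator of a small neighbourhood of
  0 has a transform with positive real part at that character. Letting the indicators run over all
  basic sets of finite measure gives one countable family for all characters; both sigma-finiteness
  of \<open>lam\<close> and surjectivity rest on it.\<close>

lemma fourier_separating:
  obtains f :: "nat \<Rightarrow> 'a \<Rightarrow> complex" where
    "\<And>j. f j \<in> L2 dx" "\<And>j. integrable dx (f j)"
    "\<And>\<xi>. \<xi> \<in> Ch \<Longrightarrow> \<exists>j. fourier dx (f j) \<xi> \<noteq> 0"
proof -
  obtain \<B> :: "'a set set" where B: "countable \<B>" "topological_basis \<B>" using ex_countable_basis by blast
  define \<C> where "\<C> = {B \<in> \<B>. emeasure dx B < \<infinity>}"
  have "countable \<C>" using B(1) by (auto simp: \<C>_def)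
  obtain B0 where "B0 \<in> \<C>"
    using finite_measure_nbhd[OF open_UNIV UNIV_I B(2)] unfolding \<C>_def by blast
  then have ne: "\<C> \<noteq> {}" by blast
  define b where "b j = from_nat_into \<C> j" for j
  have b: "b j \<in> \<C>" for j unfolding b_def by (rule from_nat_into[OF ne])
  have b_borel [measurable]: "b j \<in> sets borel" for j
    using b[of j] topological_basis_open[OF B(2)] by (auto simp: \<C>_def)
  have fin: "emeasure dx (b j) < \<infinity>" for j using b[of j] by (simp add: \<C>_def)
  have ir: "integrable dx (indicator (b j) :: 'a \<Rightarrow> real)" for j
    using fin[of j] by (intro integrable_real_indicator) auto
  show thesis
  proof (rule that[of "\<lambda>j. indicator (b j)"])
    fix j
    show i: "integrable dx (indicator (b j) :: 'a \<Rightarrow> complex)"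
      by (rule Bochner_Integration.integrable_bound[OF ir[of j]]) (auto split: split_indicator)
    have "(\<lambda>x. (cmod (indicator (b j) x))\<^sup>2) = (indicator (b j) :: 'a \<Rightarrow> real)"
      by (auto split: split_indicator)
    then show "(indicator (b j) :: 'a \<Rightarrow> complex) \<in> L2 dx"
      using ir[of j] unfolding L2_def by simp
  next
    fix \<xi> assume \<xi>: "\<xi> \<in> Ch"
    have "open {x. 1/2 < Re (\<xi> x)}"
      using Ch_continuous[OF \<xi>] by (intro open_Collect_less continuous_intros) auto
    moreover have "0 \<in> {x. 1/2 < Re (\<xi> x)}" using Ch_zero[OF \<xi>] by simp
    ultimately obtain P where P: "P \<in> \<B>" "P \<subseteq> {x. 1/2 < Re (\<xi> x)}" "0 < emeasure dx P" "emeasure dx P < \<infinity>"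
      using finite_measure_nbhd[OF _ _ B(2)] by metis
    then have "P \<in> \<C>" by (simp add: \<C>_def)
    then obtain j where j: "b j = P" unfolding b_def using from_nat_into_surj[OF \<open>countable \<C>\<close>] by blast
    have [measurable]: "P \<in> sets borel" using b_borel[of j] j by simp
    note [measurable] = Ch_measurable[OF \<xi>]
    have iP: "integrable dx (\<lambda>x. indicator P x :: real)" using P by (intro integrable_real_indicator) auto
    have int: "integrable dx (\<lambda>x. indicator P x * cnj (\<xi> x))"
      by (rule Bochner_Integration.integrable_bound[OF iP]) (auto simp: norm_mult Ch_norm[OF \<xi>] split: split_indicator)
    have "(1/2) * measure dx P = (\<integral>x. (1/2) * indicator P x \<partial>dx)" by simp
    also have "\<dots> \<le> (\<integral>x. Re (indicator P x * cnj (\<xi> x)) \<partial>dx)"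
    proof (rule integral_mono)
      show "integrable dx (\<lambda>x. (1/2) * indicator P x :: real)" using iP by simp
      show "integrable dx (\<lambda>x. Re (indicator P x * cnj (\<xi> x)))" using int by (rule integrable_Re)
    qed (use P(2) in \<open>auto split: split_indicator\<close>)
    also have "\<dots> = Re (fourier dx (indicator P) \<xi>)"
      unfolding fourier_def using int by (rule integral_Re)
    finally have "(1/2) * measure dx P \<le> Re (fourier dx (indicator P) \<xi>)" .
    moreover have "0 < measure dx P" using P by (simp add: measure_def enn2real_positive_iff)
    ultimately show "\<exists>j. fourier dx (indicator (b j)) \<xi> \<noteq> 0" using j by (intro exI[of _ j]) auto
  qed
qed

lemma plancherel_L1_L2:
  assumes "f \<in> L2 dx" "integrable dx f"
  shows "fourier dx f \<in> L2 lam" "n2 lam (fourier dx f) = n2 dx f"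
proof -
  have [measurable]: "f \<in> borel_measurable borel" using L2_measurable[OF assms(1)] by simp
  have e: "L2norm_sq lam (fourier dx f) = L2norm_sq dx f"
    using haar_dual assms by (simp add: is_plancherel_dual_haar_def)
  then show L: "fourier dx f \<in> L2 lam"
    by (subst L2_iff) (auto simp: L2norm_sq_eq[OF assms(1)])
  have "(n2 lam (fourier dx f))\<^sup>2 = (n2 dx f)\<^sup>2"
    using e by (simp add: L2norm_sq_eq[OF assms(1)] L2norm_sq_eq[OF L])
  then show "n2 lam (fourier dx f) = n2 dx f" by simp
qed

text \<open>Chebyshev's inequality: by Plancherel's formula the transform of \<open>f j\<close> is
  bounded away from 0 only on sets of finite measure, and every character lies in such a set for
  some \<open>j\<close>.\<close>

lemma sigma_finite_lam: "sigma_finite_measure lam"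
proof
  obtain f :: "nat \<Rightarrow> 'a \<Rightarrow> complex" where f: "\<And>j. f j \<in> L2 dx" "\<And>j. integrable dx (f j)"
    "\<And>\<xi>. \<xi> \<in> Ch \<Longrightarrow> \<exists>j. fourier dx (f j) \<xi> \<noteq> 0"
    by (rule fourier_separating, rule that)
  have [measurable]: "f j \<in> borel_measurable borel" for j using L2_measurable[OF f(1)] by simp
  define S where "S p = {\<xi> \<in> space lam. 1 / real (Suc (snd p)) \<le> (cmod (fourier dx (f (fst p)) \<xi>))\<^sup>2}" for p :: "nat \<times> nat"
  have S_sets [measurable]: "S p \<in> sets lam" for p unfolding S_def by measurable
  have "emeasure lam (S p) \<noteq> \<infinity>" for p
  proof -
    have "ennreal (1 / real (Suc (snd p))) * emeasure lam (S p)
        = (\<integral>\<^sup>+\<xi>. ennreal (1 / real (Suc (snd p))) * indicator (S p) \<xi> \<partial>lam)"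
      by (rule nn_integral_cmult_indicator[symmetric]) simp
    also have "\<dots> \<le> L2norm_sq lam (fourier dx (f (fst p)))"
      unfolding L2norm_sq_def by (rule nn_integral_mono) (auto simp: S_def split: split_indicator intro!: ennreal_leI)
    also have "\<dots> < \<infinity>" using plancherel_L1_L2(1)[OF f(1,2)] by (simp add: L2norm_sq_eq)
    finally show ?thesis by (auto simp: ennreal_mult_less_top)
  qed
  moreover have "(\<Union>p. S p) = space lam"
  proof
    show "space lam \<subseteq> (\<Union>p. S p)"
    proof
      fix \<xi> assume \<xi>: "\<xi> \<in> space lam"
      then obtain j where "fourier dx (f j) \<xi> \<noteq> 0" using f(3) by auto
      then have "0 < (cmod (fourier dx (f j) \<xi>))\<^sup>2" by simp
      then obtain n where "inverse (real (Suc n)) < (cmod (fourier dx (f j) \<xi>))\<^sup>2" using reals_Archimedean by blast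
      then have "\<xi> \<in> S (j, n)" using \<xi> by (simp add: S_def inverse_eq_divide)
      then show "\<xi> \<in> (\<Union>p. S p)" by blast
    qed
  qed (auto simp: S_def)
  ultimately show "\<exists>A. countable A \<and> A \<subseteq> sets lam \<and> \<Union>A = space lam \<and> (\<forall>a\<in>A. emeasure lam a \<noteq> \<infinity>)"
    by (intro exI[of _ "range S"]) auto
qed

sublocale lam: sigma_finite_measure lam by (rule sigma_finite_lam)

subsection \<open>Bounded measurable functions on the dual group\<close>

text \<open>Since \<open>cnj (\<xi> a) = \<xi> (- a)\<close>, the class contains the polynomials in
  the real and imaginary parts of \<open>\<xi> a\<close>. Characters have values in the unit circle,
  so Stone-Weierstrass leads to continuous functions of \<open>\<xi> a\<close>, and limits lead on
  to indicators and simple functions. The uniform \<open>C\<close> in \<open>lim\<close> is what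
  dominated convergence will ask for.\<close>

lemma dual_monotone_class:
  fixes P :: "(('a \<Rightarrow> complex) \<Rightarrow> complex) \<Rightarrow> bool"
  assumes bdd: "\<And>m. P m \<Longrightarrow> \<exists>C. \<forall>\<xi>\<in>Ch. cmod (m \<xi>) \<le> C"
    and ev: "\<And>a. P (\<lambda>\<xi>. \<xi> a)"
    and lin: "\<And>m k a b. P m \<Longrightarrow> P k \<Longrightarrow> P (\<lambda>\<xi>. a * m \<xi> + b * k \<xi>)"
    and prod: "\<And>m k. P m \<Longrightarrow> P k \<Longrightarrow> P (\<lambda>\<xi>. m \<xi> * k \<xi>)"
    and lim: "\<And>m k C. (\<And>n::nat. P (m n)) \<Longrightarrow> (\<And>n \<xi>. \<xi> \<in> Ch \<Longrightarrow> cmod (m n \<xi>) \<le> C) \<Longrightarrow>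
       (\<And>\<xi>. \<xi> \<in> Ch \<Longrightarrow> (\<lambda>n. m n \<xi>) \<longlonglongrightarrow> k \<xi>) \<Longrightarrow> P k"
    and k [measurable]: "k \<in> borel_measurable lam" and kb: "\<And>\<xi>. \<xi> \<in> Ch \<Longrightarrow> cmod (k \<xi>) \<le> C"
  shows "P k"
proof -
  \<comment> \<open>A constant sequence in \<open>lim\<close> shows that \<open>P\<close> depends
    only on the values on \<open>Ch\<close>.\<close>
  have cong: "P k" if m: "P m" and eq: "\<And>\<xi>. \<xi> \<in> Ch \<Longrightarrow> m \<xi> = k \<xi>" for m k
  proof -
    obtain C where C: "\<forall>\<xi>\<in>Ch. cmod (m \<xi>) \<le> C" using bdd[OF m] by blast
    show ?thesis by (rule lim[of "\<lambda>_. m" C]) (use m eq C in auto)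
  qed
  have one: "P (\<lambda>_. 1)" by (rule cong[OF ev[of 0]]) (rule Ch_zero)
  have const: "P (\<lambda>_. c)" for c by (rule cong[OF lin[OF one one, of c 0]]) simp
  have cnj_ev: "P (\<lambda>\<xi>. cnj (\<xi> a))" for a by (rule cong[OF ev[of "-a"]]) (rule Ch_minus)
  have poly: "P (\<lambda>\<xi>. complex_of_real (p (\<xi> a)))" if "real_polynomial_function p" for p :: "complex \<Rightarrow> real" and a
    using that
  proof (induction p)
    case (linear f)
    interpret bounded_linear f by (rule linear)
    have f: "f z = Re z * f 1 + Im z * f \<i>" for z
    proof -
      have "z = Re z *\<^sub>R 1 + Im z *\<^sub>R \<i>" by (simp add: complex_eq_iff)
      then have "f z = f (Re z *\<^sub>R 1 + Im z *\<^sub>R \<i>)" by simp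
      then show ?thesis by (simp only: add scaleR real_scaleR_def)
    qed
    \<comment> \<open>A real linear \<open>f\<close> is twice the real part of
      \<open>\<alpha> * z\<close> with \<open>\<alpha> = (f 1 - \<i> * f \<i>) / 2\<close>; the two
      coefficients are \<open>\<alpha>\<close> and its conjugate.\<close>
    show ?case
      by (rule cong[OF lin[OF ev[of a] cnj_ev[of a], of "Complex (f 1 / 2) (- f \<i> / 2)" "Complex (f 1 / 2) (f \<i> / 2)"]])
        (simp add: f[of "_ a"] complex_eq_iff algebra_simps)
  next
    case (const c)
    show ?case by (rule \<open>P (\<lambda>_. complex_of_real c)\<close>[OF const])
  next
    case (add f g)
    show ?case by (rule cong[OF lin[OF add.IH, of 1 1]]) simp
  next
    case (mult f g)
    show ?case by (rule cong[OF prod[OF mult.IH]]) simp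
  qed
  have cont: "P (\<lambda>\<xi>. complex_of_real (g (\<xi> a)))" if g: "continuous_on (sphere 0 1) g" for g :: "complex \<Rightarrow> real" and a
  proof -
    have "\<exists>p. real_polynomial_function p \<and> (\<forall>z\<in>sphere 0 1. \<bar>g z - p z\<bar> < 1 / Suc n)" for n
      by (rule Stone_Weierstrass_real_polynomial_function[OF compact_sphere g, of "1 / Suc n"]) auto
    then obtain p where p: "\<And>n. real_polynomial_function (p n)"
      "\<And>n z. z \<in> sphere 0 1 \<Longrightarrow> \<bar>g z - p n z\<bar> < 1 / Suc n" by metis
    obtain B where B': "\<forall>y\<in>g ` sphere 0 1. norm y \<le> B"
      using compact_imp_bounded[OF compact_continuous_image[OF g compact_sphere]]
      unfolding bounded_iff by blast
    have B: "\<bar>g z\<bar> \<le> B" if "z \<in> sphere 0 1" for z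
      using bspec[OF B' imageI[OF that]] by simp
    have mem: "\<xi> a \<in> sphere 0 1" if "\<xi> \<in> Ch" for \<xi> using Ch_norm[OF that] by simp
    show ?thesis
    proof (rule lim[of "\<lambda>n \<xi>. complex_of_real (p n (\<xi> a))" "B + 1"])
      show "P (\<lambda>\<xi>. complex_of_real (p n (\<xi> a)))" for n by (rule poly[OF p(1)])
      show "cmod (complex_of_real (p n (\<xi> a))) \<le> B + 1" if \<xi>: "\<xi> \<in> Ch" for n \<xi>
      proof -
        have "1 / real (Suc n) \<le> 1" by simp
        then show ?thesis using p(2)[OF mem[OF \<xi>], of n] B[OF mem[OF \<xi>]] unfolding norm_of_real by linarith
      qed
      show "(\<lambda>n. complex_of_real (p n (\<xi> a))) \<longlonglongrightarrow> complex_of_real (g (\<xi> a))" if \<xi>: "\<xi> \<in> Ch" for \<xi>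
      proof (rule tendsto_of_real)
        have "(\<lambda>n. g (\<xi> a) - p n (\<xi> a)) \<longlonglongrightarrow> 0"
        proof (rule Lim_null_comparison[OF always_eventually[OF allI] LIMSEQ_inverse_real_of_nat])
          show "norm (g (\<xi> a) - p n (\<xi> a)) \<le> inverse (real (Suc n))" for n
            using p(2)[OF mem[OF \<xi>], of n] by (simp add: inverse_eq_divide)
        qed
        from tendsto_diff[OF tendsto_const this, of "g (\<xi> a)"]
        show "(\<lambda>n. p n (\<xi> a)) \<longlonglongrightarrow> g (\<xi> a)" by simp
      qed
    qed
  qed
  have ind_open: "P (\<lambda>\<xi>. indicator U (\<xi> a))" if U: "open U" for U :: "complex set" and a
  proof (cases "U = UNIV")
    case True
    show ?thesis by (rule cong[OF one]) (simp add: True)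
  next
    case False
    then have ne: "- U \<noteq> {}" by blast
    have cl: "closed (- U)" by (rule closed_Compl[OF U])
    \<comment> \<open>These functions increase to the indicator of \<open>U\<close>. The case
      \<open>U = UNIV\<close> is separate because the distance to the empty set is 0 by
      convention.\<close>
    define g where "g n z = min 1 (real n * infdist z (- U))" for n z
    have gc: "continuous_on (sphere 0 1) (g n)" for n
      unfolding g_def by (intro continuous_intros)
    show ?thesis
    proof (rule lim[of "\<lambda>n \<xi>. complex_of_real (g n (\<xi> a))" 1])
      show "P (\<lambda>\<xi>. complex_of_real (g n (\<xi> a)))" for n by (rule cont[OF gc])
      show "cmod (complex_of_real (g n (\<xi> a))) \<le> 1" for n \<xi>
      proof -
        have "0 \<le> real n * infdist (\<xi> a) (- U)" by (intro mult_nonneg_nonneg infdist_nonneg) simp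
        then show ?thesis unfolding g_def norm_of_real by simp
      qed
      show "(\<lambda>n. complex_of_real (g n (\<xi> a))) \<longlonglongrightarrow> indicator U (\<xi> a)" for \<xi>
      proof (cases "\<xi> a \<in> U")
        case True
        then have d: "0 < infdist (\<xi> a) (- U)" using infdist_pos_not_in_closed[OF cl ne] by simp
        then obtain N where N: "1 < real N * infdist (\<xi> a) (- U)" using reals_Archimedean3 by blast
        have "g n (\<xi> a) = 1" if "n \<ge> N" for n
        proof -
          have "real N * infdist (\<xi> a) (- U) \<le> real n * infdist (\<xi> a) (- U)"
            using that d by (intro mult_right_mono) auto
          then show ?thesis using N unfolding g_def by simp
        qed
        then have "\<forall>\<^sub>F n in sequentially. complex_of_real (g n (\<xi> a)) = indicator U (\<xi> a)"
          using True by (intro eventually_sequentiallyI[of N]) simp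
        then show ?thesis by (rule tendsto_eventually)
      next
        case False
        then have "infdist (\<xi> a) (- U) = 0" by simp
        then have "complex_of_real (g n (\<xi> a)) = indicator U (\<xi> a)" for n using False by (simp add: g_def)
        then show ?thesis by simp
      qed
    qed
  qed
  have ind: "P (indicator B)" if "B \<in> sets lam" for B
    using that unfolding sets_lam
  proof (induction rule: sigma_sets.induct)
    case (Basic W)
    then obtain a U where W: "W = {\<xi> \<in> Ch. \<xi> a \<in> U}" "open U" by blast
    show ?case by (rule cong[OF ind_open[OF W(2), of a]]) (simp add: W indicator_def)
  next
    case Empty
    show ?case by (rule cong[OF const[of 0]]) simp
  next
    case (Compl W)
    show ?case by (rule cong[OF lin[OF one Compl.IH, of 1 "-1"]]) (simp add: indicator_def)
  next
    case (Union W)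
    \<comment> \<open>The sets may overlap, so the indicator of a finite union is assembled by
      inclusion and exclusion before the limit is taken.\<close>
    have fin: "P (indicator (\<Union>i<n. W i))" for n :: nat
    proof (induction n)
      case 0
      show ?case by (rule cong[OF const[of 0]]) simp
    next
      case (Suc n)
      have "P (\<lambda>\<xi>. 1 * (1 * indicator (\<Union>i<n. W i) \<xi> + 1 * indicator (W n) \<xi>)
          + (-1) * (indicator (\<Union>i<n. W i) \<xi> * indicator (W n) \<xi>))"
        by (intro lin prod Suc Union.IH)
      then show ?case by (rule cong) (auto simp: lessThan_Suc indicator_def)
    qed
    show ?case
      by (rule lim[of "\<lambda>n. indicator (\<Union>i<n. W i)" 1, OF fin _ LIMSEQ_indicator_UN])
        (auto simp: indicator_def)
  qed
  have simple: "P s" if s: "simple_function lam s" for s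
  proof -
    have fin: "finite (s ` Ch)" using simple_functionD(1)[OF s] by simp
    have sets: "s -` {y} \<inter> Ch \<in> sets lam" for y using simple_functionD(2)[OF s, of "{y}"] by simp
    have sum: "finite Y \<Longrightarrow> P (\<lambda>\<xi>. \<Sum>y\<in>Y. y * indicator (s -` {y} \<inter> Ch) \<xi>)" for Y
    proof (induction Y rule: finite_induct)
      case empty
      show ?case by (rule cong[OF const[of 0]]) simp
    next
      case (insert y Y)
      show ?case by (rule cong[OF lin[OF ind[OF sets[of y]] insert.IH, of y 1]]) (simp only: sum.insert[OF insert.hyps] mult_1_left)
    qed
    show ?thesis
    proof (rule cong[OF sum[OF fin]])
      fix \<xi> assume \<xi>: "\<xi> \<in> Ch"
      have "(\<Sum>y\<in>s ` Ch. y * indicator (s -` {y} \<inter> Ch) \<xi>) = (\<Sum>y\<in>s ` Ch. if y = s \<xi> then s \<xi> else 0)"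
        using \<xi> by (intro sum.cong) (auto simp: indicator_def)
      also have "\<dots> = s \<xi>" using fin \<xi> by (simp add: sum.delta)
      finally show "(\<Sum>y\<in>s ` Ch. y * indicator (s -` {y} \<inter> Ch) \<xi>) = s \<xi>" .
    qed
  qed
  from borel_measurable_implies_sequence_metric[OF k, of 0] obtain s where
    s': "\<forall>i. simple_function lam (s i)" "\<forall>\<xi>\<in>space lam. (\<lambda>i. s i \<xi>) \<longlonglongrightarrow> k \<xi>"
      "\<forall>i. \<forall>\<xi>\<in>space lam. dist (s i \<xi>) 0 \<le> 2 * dist (k \<xi>) 0" by (elim exE conjE) (rule that)
  have s: "simple_function lam (s i)" "\<xi> \<in> Ch \<Longrightarrow> (\<lambda>i. s i \<xi>) \<longlonglongrightarrow> k \<xi>"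
      "\<xi> \<in> Ch \<Longrightarrow> cmod (s i \<xi>) \<le> 2 * cmod (k \<xi>)" for i \<xi>
    using s' by simp_all
  show ?thesis
  proof (rule lim[of s "2 * C", OF simple[OF s(1)] _ s(2)])
    show "cmod (s n \<xi>) \<le> 2 * C" if "\<xi> \<in> Ch" for n \<xi> using s(3)[OF that, of n] kb[OF that] by simp
  qed
qed

subsection \<open>The Fourier transform on square-integrable functions\<close>

abbreviation L12 :: "('a \<Rightarrow> complex) set" where "L12 \<equiv> {g \<in> L2 dx. integrable dx g}"

text \<open>A relation, since the extended transform is fixed only up to null sets; any measurable
  representative \<open>F\<close> may stand for it, by \<open>FT_cong_AE\<close>.\<close>

definition FT :: "('a \<Rightarrow> complex) \<Rightarrow> (('a \<Rightarrow> complex) \<Rightarrow> complex) \<Rightarrow> bool" where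
  "FT f F \<longleftrightarrow> f \<in> L2 dx \<and> is_L2_fourier dx lam f F"

lemma FT_L2: "FT f F \<Longrightarrow> f \<in> L2 dx" "FT f F \<Longrightarrow> F \<in> L2 lam"
  by (simp_all add: FT_def is_L2_fourier_def)

text \<open>The approximating sequence is traded for one approximant within each \<open>e\<close>.
  Sums, limits and group actions then need to transport a single good \<open>g\<close> at a
  time.\<close>

lemma FT_iff:
  "FT f F \<longleftrightarrow> f \<in> L2 dx \<and> F \<in> L2 lam \<and>
     (\<forall>e>0. \<exists>g\<in>L12. n2 dx (\<lambda>x. g x - f x) < e \<and> n2 lam (\<lambda>\<xi>. fourier dx g \<xi> - F \<xi>) < e)"
  (is "_ \<longleftrightarrow> _ \<and> _ \<and> ?R")
proof (cases "f \<in> L2 dx \<and> F \<in> L2 lam")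
  case True
  then have f: "f \<in> L2 dx" and F: "F \<in> L2 lam" by auto
  have e1: "L2norm_sq dx (\<lambda>x. g x - f x) = ennreal ((n2 dx (\<lambda>x. g x - f x))\<^sup>2)" if "g \<in> L12" for g
    using that f by (intro L2norm_sq_eq L2_diff) auto
  have e2: "L2norm_sq lam (\<lambda>\<xi>. fourier dx g \<xi> - F \<xi>) = ennreal ((n2 lam (\<lambda>\<xi>. fourier dx g \<xi> - F \<xi>))\<^sup>2)"
    if "g \<in> L12" for g
    using that F plancherel_L1_L2 by (intro L2norm_sq_eq L2_diff) auto
  have "is_L2_fourier dx lam f F \<longleftrightarrow> ?R"
  proof
    assume "is_L2_fourier dx lam f F"
    then obtain g where g: "\<And>n::nat. g n \<in> L12"
      "(\<lambda>n. L2norm_sq dx (\<lambda>x. g n x - f x)) \<longlonglongrightarrow> 0"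
      "(\<lambda>n. L2norm_sq lam (\<lambda>\<xi>. fourier dx (g n) \<xi> - F \<xi>)) \<longlonglongrightarrow> 0"
      unfolding is_L2_fourier_def by auto
    have "(\<lambda>n. (n2 dx (\<lambda>x. g n x - f x))\<^sup>2) \<longlonglongrightarrow> 0"
      using g(2) unfolding e1[OF g(1)] by (subst (asm) ennreal_tendsto_0_iff) auto
    from tendsto_real_sqrt[OF this] have l1: "(\<lambda>n. n2 dx (\<lambda>x. g n x - f x)) \<longlonglongrightarrow> 0" by simp
    have "(\<lambda>n. (n2 lam (\<lambda>\<xi>. fourier dx (g n) \<xi> - F \<xi>))\<^sup>2) \<longlonglongrightarrow> 0"
      using g(3) unfolding e2[OF g(1)] by (subst (asm) ennreal_tendsto_0_iff) auto
    from tendsto_real_sqrt[OF this] have l2: "(\<lambda>n. n2 lam (\<lambda>\<xi>. fourier dx (g n) \<xi> - F \<xi>)) \<longlonglongrightarrow> 0" by simp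
    show ?R
    proof (intro allI impI)
      fix e :: real assume "0 < e"
      with l1 l2 have "\<forall>\<^sub>F n in sequentially. n2 dx (\<lambda>x. g n x - f x) < e
          \<and> n2 lam (\<lambda>\<xi>. fourier dx (g n) \<xi> - F \<xi>) < e"
        by (intro eventually_conj order_tendstoD(2))
      then obtain n where n: "n2 dx (\<lambda>x. g n x - f x) < e" "n2 lam (\<lambda>\<xi>. fourier dx (g n) \<xi> - F \<xi>) < e"
        by (auto simp: eventually_sequentially)
      then show "\<exists>g\<in>L12. n2 dx (\<lambda>x. g x - f x) < e \<and> n2 lam (\<lambda>\<xi>. fourier dx g \<xi> - F \<xi>) < e"
        by (intro bexI[of _ "g n"] conjI n g(1))
    qed
  next
    assume R: ?R
    have "\<exists>g. g \<in> L12 \<and> n2 dx (\<lambda>x. g x - f x) < inverse (real (Suc n)) \<and>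
        n2 lam (\<lambda>\<xi>. fourier dx g \<xi> - F \<xi>) < inverse (real (Suc n))" for n
      using R[rule_format, of "inverse (real (Suc n))"] unfolding Bex_def by simp
    then have "\<exists>g. \<forall>n. g n \<in> L12 \<and> n2 dx (\<lambda>x. g n x - f x) < inverse (real (Suc n)) \<and>
        n2 lam (\<lambda>\<xi>. fourier dx (g n) \<xi> - F \<xi>) < inverse (real (Suc n))"
      by (intro choice allI)
    then obtain g where g': "\<forall>n. g n \<in> L12 \<and> n2 dx (\<lambda>x. g n x - f x) < inverse (real (Suc n)) \<and>
        n2 lam (\<lambda>\<xi>. fourier dx (g n) \<xi> - F \<xi>) < inverse (real (Suc n))" by (rule exE)
    have g: "g n \<in> L12" "n2 dx (\<lambda>x. g n x - f x) < inverse (real (Suc n))"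
        "n2 lam (\<lambda>\<xi>. fourier dx (g n) \<xi> - F \<xi>) < inverse (real (Suc n))" for n
      using g' by blast+
    have "(\<lambda>n. n2 dx (\<lambda>x. g n x - f x)) \<longlonglongrightarrow> 0"
      by (rule Lim_null_comparison[OF always_eventually[OF allI] LIMSEQ_inverse_real_of_nat])
        (simp only: real_norm_def abs_of_nonneg n2_nonneg less_imp_le[OF g(2)])
    from tendsto_power[OF this, of 2] have l1: "(\<lambda>n. (n2 dx (\<lambda>x. g n x - f x))\<^sup>2) \<longlonglongrightarrow> 0" by simp
    have "(\<lambda>n. n2 lam (\<lambda>\<xi>. fourier dx (g n) \<xi> - F \<xi>)) \<longlonglongrightarrow> 0"
      by (rule Lim_null_comparison[OF always_eventually[OF allI] LIMSEQ_inverse_real_of_nat])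
        (simp only: real_norm_def abs_of_nonneg n2_nonneg less_imp_le[OF g(3)])
    from tendsto_power[OF this, of 2] have l2: "(\<lambda>n. (n2 lam (\<lambda>\<xi>. fourier dx (g n) \<xi> - F \<xi>))\<^sup>2) \<longlonglongrightarrow> 0" by simp
    have "(\<lambda>n. L2norm_sq dx (\<lambda>x. g n x - f x)) \<longlonglongrightarrow> 0"
      using l1 unfolding e1[OF g(1)] by (subst ennreal_tendsto_0_iff) auto
    moreover have "(\<lambda>n. L2norm_sq lam (\<lambda>\<xi>. fourier dx (g n) \<xi> - F \<xi>)) \<longlonglongrightarrow> 0"
      using l2 unfolding e2[OF g(1)] by (subst ennreal_tendsto_0_iff) auto
    ultimately show "is_L2_fourier dx lam f F"
      unfolding is_L2_fourier_def using F g(1) by (intro conjI exI[of _ g]) auto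
  qed
  with True show ?thesis by (simp add: FT_def)
next
  case False
  then show ?thesis by (auto simp: FT_def is_L2_fourier_def)
qed

lemma fourier_integrable:
  assumes "integrable dx f" "\<xi> \<in> Ch" shows "integrable dx (\<lambda>x. f x * cnj (\<xi> x))"
proof -
  note [measurable] = Ch_measurable[OF assms(2)]
  have [measurable]: "f \<in> borel_measurable borel" using borel_measurable_integrable[OF assms(1)] by simp
  show ?thesis
    by (rule Bochner_Integration.integrable_bound[OF assms(1)]) (auto simp: norm_mult Ch_norm[OF assms(2)])
qed

lemma fourier_add: "integrable dx f \<Longrightarrow> integrable dx g \<Longrightarrow> \<xi> \<in> Ch \<Longrightarrow>
    fourier dx (\<lambda>x. f x + g x) \<xi> = fourier dx f \<xi> + fourier dx g \<xi>"
  using fourier_integrable[of f \<xi>] fourier_integrable[of g \<xi>] by (simp add: fourier_def distrib_right)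

lemma fourier_cmult: "fourier dx (\<lambda>x. c * f x) \<xi> = c * fourier dx f \<xi>"
  by (simp add: fourier_def mult.assoc)

lemma n2_cong: "(\<And>x. x \<in> space M \<Longrightarrow> cmod (f x) = cmod (g x)) \<Longrightarrow> n2 M f = n2 M g"
  unfolding n2_def by (simp cong: Bochner_Integration.integral_cong)

lemma FT_fourier: "g \<in> L12 \<Longrightarrow> FT g (fourier dx g)"
  unfolding FT_iff using plancherel_L1_L2(1)[of g] by (auto simp: n2_def intro!: bexI[of _ g])

lemma FT_add:
  assumes f: "FT f F" and g: "FT g G"
  shows "FT (\<lambda>x. f x + g x) (\<lambda>\<xi>. F \<xi> + G \<xi>)"
  unfolding FT_iff
proof (intro conjI allI impI)
  show "(\<lambda>x. f x + g x) \<in> L2 dx" "(\<lambda>\<xi>. F \<xi> + G \<xi>) \<in> L2 lam"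
    by (intro L2_add FT_L2[OF f] FT_L2[OF g])+
  fix e :: real assume "0 < e"
  then have e: "0 < e/2" by simp
  obtain u where u: "u \<in> L12" "n2 dx (\<lambda>x. u x - f x) < e/2" "n2 lam (\<lambda>\<xi>. fourier dx u \<xi> - F \<xi>) < e/2"
    using f e unfolding FT_iff by blast
  obtain v where v: "v \<in> L12" "n2 dx (\<lambda>x. v x - g x) < e/2" "n2 lam (\<lambda>\<xi>. fourier dx v \<xi> - G \<xi>) < e/2"
    using g e unfolding FT_iff by blast
  have u': "u \<in> L2 dx" "integrable dx u" and v': "v \<in> L2 dx" "integrable dx v" using u v by auto
  show "\<exists>k\<in>L12. n2 dx (\<lambda>x. k x - (f x + g x)) < e \<and> n2 lam (\<lambda>\<xi>. fourier dx k \<xi> - (F \<xi> + G \<xi>)) < e"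
  proof (intro bexI[of _ "\<lambda>x. u x + v x"] conjI)
    show "(\<lambda>x. u x + v x) \<in> L12" using u' v' by (auto intro: L2_add)
    have "n2 dx (\<lambda>x. (u x - f x) + (v x - g x)) \<le> n2 dx (\<lambda>x. u x - f x) + n2 dx (\<lambda>x. v x - g x)"
      by (intro n2_add_le L2_diff u' v' FT_L2[OF f] FT_L2[OF g])
    then show "n2 dx (\<lambda>x. u x + v x - (f x + g x)) < e" using u v by (simp add: algebra_simps)
    have "n2 lam (\<lambda>\<xi>. (fourier dx u \<xi> - F \<xi>) + (fourier dx v \<xi> - G \<xi>))
        \<le> n2 lam (\<lambda>\<xi>. fourier dx u \<xi> - F \<xi>) + n2 lam (\<lambda>\<xi>. fourier dx v \<xi> - G \<xi>)"
      by (intro n2_add_le L2_diff plancherel_L1_L2(1) u' v' FT_L2[OF f] FT_L2[OF g])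
    moreover have "n2 lam (\<lambda>\<xi>. fourier dx (\<lambda>x. u x + v x) \<xi> - (F \<xi> + G \<xi>))
        = n2 lam (\<lambda>\<xi>. (fourier dx u \<xi> - F \<xi>) + (fourier dx v \<xi> - G \<xi>))"
      by (rule n2_cong) (simp add: fourier_add u' v' algebra_simps)
    ultimately show "n2 lam (\<lambda>\<xi>. fourier dx (\<lambda>x. u x + v x) \<xi> - (F \<xi> + G \<xi>)) < e" using u v by simp
  qed
qed

lemma FT_cmult:
  assumes f: "FT f F"
  shows "FT (\<lambda>x. c * f x) (\<lambda>\<xi>. c * F \<xi>)"
  unfolding FT_iff
proof (intro conjI allI impI)
  show "(\<lambda>x. c * f x) \<in> L2 dx" "(\<lambda>\<xi>. c * F \<xi>) \<in> L2 lam"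
    by (intro L2_cmult FT_L2[OF f])+
  fix e :: real assume "0 < e"
  then have e: "0 < e / (cmod c + 1)" by (intro divide_pos_pos add_nonneg_pos) auto
  obtain u where u: "u \<in> L12" "n2 dx (\<lambda>x. u x - f x) < e / (cmod c + 1)"
      "n2 lam (\<lambda>\<xi>. fourier dx u \<xi> - F \<xi>) < e / (cmod c + 1)"
    using f e unfolding FT_iff by blast
  have b: "cmod c * t < e" if "t < e / (cmod c + 1)" "0 \<le> t" for t
  proof -
    have "cmod c * t \<le> (cmod c + 1) * t" using that by (intro mult_right_mono) auto
    also have "\<dots> < e" using that norm_ge_zero[of c] by (simp add: field_simps)
    finally show ?thesis .
  qed
  show "\<exists>k\<in>L12. n2 dx (\<lambda>x. k x - c * f x) < e \<and> n2 lam (\<lambda>\<xi>. fourier dx k \<xi> - c * F \<xi>) < e"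
  proof (intro bexI[of _ "\<lambda>x. c * u x"] conjI)
    show "(\<lambda>x. c * u x) \<in> L12" using u by (auto intro: L2_cmult)
    show "n2 dx (\<lambda>x. c * u x - c * f x) < e"
      unfolding right_diff_distrib[symmetric] n2_cmult by (rule b[OF u(2)]) simp
    show "n2 lam (\<lambda>\<xi>. fourier dx (\<lambda>x. c * u x) \<xi> - c * F \<xi>) < e"
      unfolding fourier_cmult right_diff_distrib[symmetric] n2_cmult by (rule b[OF u(3)]) simp
  qed
qed

lemma FT_diff: "FT f F \<Longrightarrow> FT g G \<Longrightarrow> FT (\<lambda>x. f x - g x) (\<lambda>\<xi>. F \<xi> - G \<xi>)"
  using FT_add[of f F, OF _ FT_cmult[of g G "-1"]] by simp

text \<open>An approximant has the same norm on both sides by Plancherel, and by the reverse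
  triangle inequality that common value is close to each of the two norms.\<close>

lemma FT_isometry:
  assumes f: "FT f F" shows "n2 lam F = n2 dx f"
proof (rule ccontr)
  assume "n2 lam F \<noteq> n2 dx f"
  then have e: "0 < \<bar>n2 lam F - n2 dx f\<bar> / 2" by simp
  obtain u where u: "u \<in> L12" "n2 dx (\<lambda>x. u x - f x) < \<bar>n2 lam F - n2 dx f\<bar> / 2"
      "n2 lam (\<lambda>\<xi>. fourier dx u \<xi> - F \<xi>) < \<bar>n2 lam F - n2 dx f\<bar> / 2"
    using f e unfolding FT_iff by blast
  have u': "u \<in> L2 dx" "integrable dx u" using u by auto
  have "\<bar>n2 dx u - n2 dx f\<bar> \<le> n2 dx (\<lambda>x. u x - f x)"
    by (rule n2_triangle_abs[OF u'(1) FT_L2(1)[OF f]])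
  moreover have "\<bar>n2 lam (fourier dx u) - n2 lam F\<bar> \<le> n2 lam (\<lambda>\<xi>. fourier dx u \<xi> - F \<xi>)"
    by (rule n2_triangle_abs[OF plancherel_L1_L2(1)[OF u'] FT_L2(2)[OF f]])
  moreover have "\<bar>n2 lam F - n2 dx f\<bar> \<le> \<bar>n2 dx u - n2 lam F\<bar> + \<bar>n2 dx u - n2 dx f\<bar>" by arith
  ultimately have "\<bar>n2 lam F - n2 dx f\<bar> \<le> n2 lam (\<lambda>\<xi>. fourier dx u \<xi> - F \<xi>) + n2 dx (\<lambda>x. u x - f x)"
    unfolding plancherel_L1_L2(2)[OF u'] by (meson add_mono order_trans)
  with add_strict_mono[OF u(3,2)] show False by simp
qed

text \<open>Parseval's identity follows from Plancherel's by polarization, because the relation is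
  linear in both arguments at once.\<close>

lemma FT_ip:
  assumes f: "FT f F" and g: "FT g G" shows "ip dx f g = ip lam F G"
proof -
  have e: "n2 dx (\<lambda>x. f x + c * g x) = n2 lam (\<lambda>\<xi>. F \<xi> + c * G \<xi>)" for c
    by (rule FT_isometry[symmetric]) (intro FT_add FT_cmult f g)
  have e1: "n2 dx (\<lambda>x. f x + g x) = n2 lam (\<lambda>\<xi>. F \<xi> + G \<xi>)" using e[of 1] by simp
  have "4 * ip dx f g = 4 * ip lam F G"
    unfolding ip_polarization[OF FT_L2(1)[OF f] FT_L2(1)[OF g]] ip_polarization[OF FT_L2(2)[OF f] FT_L2(2)[OF g]]
      e e1 ..
  then show ?thesis by simp
qed

lemma FT_cong_AE:
  assumes f: "FT f F" and G: "G \<in> borel_measurable lam" and eq: "AE \<xi> in lam. F \<xi> = G \<xi>"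
  shows "FT f G"
proof -
  note [measurable] = G L2_measurable[OF FT_L2(2)[OF f]]
  have "n2 lam (\<lambda>\<xi>. fourier dx g \<xi> - G \<xi>) = n2 lam (\<lambda>\<xi>. fourier dx g \<xi> - F \<xi>)" if "g \<in> L12" for g
  proof (rule n2_cong_AE)
    have [measurable]: "fourier dx g \<in> borel_measurable lam"
      using plancherel_L1_L2(1)[of g] that by (auto intro: L2_measurable)
    show "(\<lambda>\<xi>. fourier dx g \<xi> - G \<xi>) \<in> borel_measurable lam" "(\<lambda>\<xi>. fourier dx g \<xi> - F \<xi>) \<in> borel_measurable lam"
      by measurable
    show "AE \<xi> in lam. fourier dx g \<xi> - G \<xi> = fourier dx g \<xi> - F \<xi>" using eq by eventually_elim simp
  qed
  moreover have "G \<in> L2 lam" by (rule L2_cong_AE[OF FT_L2(2)[OF f] G eq])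
  ultimately show ?thesis using f unfolding FT_iff by simp
qed

lemma FT_cong:
  assumes f: "FT f F" and eq: "\<And>\<xi>. \<xi> \<in> Ch \<Longrightarrow> F \<xi> = G \<xi>" shows "FT f G"
proof (rule FT_cong_AE[OF f])
  have "F \<in> borel_measurable lam \<longleftrightarrow> G \<in> borel_measurable lam"
    by (rule measurable_cong) (simp add: eq)
  then show "G \<in> borel_measurable lam" using L2_measurable[OF FT_L2(2)[OF f]] by simp
  show "AE \<xi> in lam. F \<xi> = G \<xi>" by (rule AE_I2) (simp add: eq)
qed

text \<open>An isometry on a complete space has closed range: the \<open>f n\<close> are Cauchy
  because the \<open>F n\<close> are, and \<open>riesz_fischer\<close> supplies a limit.
  Approximants of \<open>f n\<close> for large \<open>n\<close> also approximate that limit, so it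
  is related to \<open>G\<close>.\<close>

lemma FT_closed:
  assumes f: "\<And>n::nat. FT (f n) (F n)" and G: "G \<in> L2 lam"
    and lim: "(\<lambda>n. n2 lam (\<lambda>\<xi>. F n \<xi> - G \<xi>)) \<longlonglongrightarrow> 0"
  shows "\<exists>g. FT g G"
proof -
  have Fn: "n2 lam (\<lambda>\<xi>. F m \<xi> - F n \<xi>) \<le> n2 lam (\<lambda>\<xi>. F m \<xi> - G \<xi>) + n2 lam (\<lambda>\<xi>. F n \<xi> - G \<xi>)" for m n
    using n2_diff_triangle[OF FT_L2(2)[OF f[of m]] G FT_L2(2)[OF f[of n]]] n2_minus_commute[of lam G "F n"] by simp
  have cauchy: "\<exists>N. \<forall>m\<ge>N. \<forall>n\<ge>N. n2 dx (\<lambda>x. f m x - f n x) < e" if e: "0 < e" for e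
  proof -
    from order_tendstoD(2)[OF lim, of "e/2"] e
    obtain N where N: "\<And>n. n \<ge> N \<Longrightarrow> n2 lam (\<lambda>\<xi>. F n \<xi> - G \<xi>) < e/2" by (auto simp: eventually_sequentially)
    show ?thesis
    proof (intro exI[of _ N] allI impI)
      fix m n assume mn: "N \<le> m" "N \<le> n"
      have "n2 dx (\<lambda>x. f m x - f n x) = n2 lam (\<lambda>\<xi>. F m \<xi> - F n \<xi>)"
        by (rule FT_isometry[symmetric, OF FT_diff[OF f f]])
      then show "n2 dx (\<lambda>x. f m x - f n x) < e" using Fn[of m n] N[OF mn(1)] N[OF mn(2)] by simp
    qed
  qed
  obtain g where g: "g \<in> L2 dx" "(\<lambda>n. n2 dx (\<lambda>x. f n x - g x)) \<longlonglongrightarrow> 0"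
    by (rule riesz_fischer[OF FT_L2(1)[OF f] cauchy])
  have "FT g G"
    unfolding FT_iff
  proof (intro conjI allI impI g(1) G)
    fix e :: real assume e: "0 < e"
    then have "\<forall>\<^sub>F n in sequentially. n2 dx (\<lambda>x. f n x - g x) < e/2 \<and> n2 lam (\<lambda>\<xi>. F n \<xi> - G \<xi>) < e/2"
      by (intro eventually_conj order_tendstoD(2)[OF g(2)] order_tendstoD(2)[OF lim]) auto
    then obtain n where n: "n2 dx (\<lambda>x. f n x - g x) < e/2" "n2 lam (\<lambda>\<xi>. F n \<xi> - G \<xi>) < e/2"
      by (auto simp: eventually_sequentially)
    from e have "0 < e/2" by simp
    then obtain u where u: "u \<in> L12" "n2 dx (\<lambda>x. u x - f n x) < e/2" "n2 lam (\<lambda>\<xi>. fourier dx u \<xi> - F n \<xi>) < e/2"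
      using f[of n] unfolding FT_iff by blast
    have u': "u \<in> L2 dx" "integrable dx u" using u by auto
    have "n2 dx (\<lambda>x. u x - g x) \<le> n2 dx (\<lambda>x. u x - f n x) + n2 dx (\<lambda>x. f n x - g x)"
      by (intro n2_diff_triangle u' FT_L2(1)[OF f] g)
    moreover have "n2 lam (\<lambda>\<xi>. fourier dx u \<xi> - G \<xi>) \<le> n2 lam (\<lambda>\<xi>. fourier dx u \<xi> - F n \<xi>) + n2 lam (\<lambda>\<xi>. F n \<xi> - G \<xi>)"
      by (intro n2_diff_triangle plancherel_L1_L2(1) u' FT_L2(2)[OF f] G)
    ultimately show "\<exists>k\<in>L12. n2 dx (\<lambda>x. k x - g x) < e \<and> n2 lam (\<lambda>\<xi>. fourier dx k \<xi> - G \<xi>) < e"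
      using u n by (intro bexI[of _ u]) auto
  qed
  then show ?thesis by blast
qed

section \<open>Translations, multipliers and inversion\<close>

lemma nn_integral_translate:
  assumes [measurable]: "f \<in> borel_measurable borel"
  shows "(\<integral>\<^sup>+t. f (t - a) \<partial>dx) = (\<integral>\<^sup>+t. f t \<partial>dx)"
proof -
  interpret A: measurable_group "borel :: 'a measure" "(+)" uminus 0 by (rule A_group)
  show ?thesis using A.nn_integral_left_inv[OF left_inv_dx, of "-a" f] by simp
qed

lemma minus_measurable [measurable]: "(\<lambda>t::'a. t - a) \<in> borel_measurable borel"
  by (intro borel_measurable_continuous_onI continuous_intros)

lemma distr_translate: "distr dx borel (\<lambda>t. t - a) = dx"
proof (rule measure_eqI)
  fix B assume "B \<in> sets (distr dx borel (\<lambda>t. t - a))"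
  then have B [measurable]: "B \<in> sets borel" by simp
  have "emeasure (distr dx borel (\<lambda>t. t - a)) B = (\<integral>\<^sup>+t. indicator B t \<partial>distr dx borel (\<lambda>t. t - a))"
    by simp
  also have "\<dots> = (\<integral>\<^sup>+t. indicator B (t - a) \<partial>dx)" by (rule nn_integral_distr) measurable
  also have "\<dots> = emeasure dx B" by (subst nn_integral_translate) auto
  finally show "emeasure (distr dx borel (\<lambda>t. t - a)) B = emeasure dx B" .
qed simp

lemma integral_translate:
  fixes f :: "'a \<Rightarrow> 'c::{banach, second_countable_topology}"
  assumes [measurable]: "f \<in> borel_measurable borel"
  shows "(\<integral>t. f (t - a) \<partial>dx) = (\<integral>t. f t \<partial>dx)"
    and "integrable dx (\<lambda>t. f (t - a)) \<longleftrightarrow> integrable dx f"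
proof -
  have m: "(\<lambda>t. t - a) \<in> dx \<rightarrow>\<^sub>M borel" by measurable
  show "(\<integral>t. f (t - a) \<partial>dx) = (\<integral>t. f t \<partial>dx)"
    using integral_distr[OF m assms] unfolding distr_translate by (rule sym)
  show "integrable dx (\<lambda>t. f (t - a)) \<longleftrightarrow> integrable dx f"
    using integrable_distr_eq[OF m assms] unfolding distr_translate by (rule sym)
qed

lemma L2_translate:
  assumes f: "f \<in> L2 dx" shows "(\<lambda>t. f (t - a)) \<in> L2 dx" "n2 dx (\<lambda>t. f (t - a)) = n2 dx f"
proof -
  have [measurable]: "f \<in> borel_measurable borel" using L2_measurable[OF f] by simp
  show "(\<lambda>t. f (t - a)) \<in> L2 dx" using L2_integrable[OF f] integral_translate(2)[of "\<lambda>t. (cmod (f t))\<^sup>2" a]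
    by (simp add: L2_def)
  show "n2 dx (\<lambda>t. f (t - a)) = n2 dx f" using integral_translate(1)[of "\<lambda>t. (cmod (f t))\<^sup>2" a]
    by (simp add: n2_def)
qed

lemma fourier_translate:
  assumes f: "integrable dx f" and \<xi>: "\<xi> \<in> Ch"
  shows "fourier dx (\<lambda>t. f (t - a)) \<xi> = cnj (\<xi> a) * fourier dx f \<xi>"
proof -
  note [measurable] = Ch_measurable[OF \<xi>]
  have [measurable]: "f \<in> borel_measurable borel" using borel_measurable_integrable[OF f] by simp
  have "fourier dx (\<lambda>t. f (t - a)) \<xi> = (\<integral>t. (\<lambda>s. f s * cnj (\<xi> (s + a))) (t - a) \<partial>dx)"
    by (simp add: fourier_def)
  also have "\<dots> = (\<integral>s. f s * cnj (\<xi> (s + a)) \<partial>dx)"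
    unfolding Ch_add[OF \<xi>] by (rule integral_translate(1)) measurable
  also have "\<dots> = (\<integral>s. cnj (\<xi> a) * (f s * cnj (\<xi> s)) \<partial>dx)" by (simp add: Ch_add[OF \<xi>] mult_ac)
  finally show ?thesis by (simp add: fourier_def)
qed

lemma FT_translate:
  assumes f: "FT f F" shows "FT (\<lambda>t. f (t - a)) (\<lambda>\<xi>. cnj (\<xi> a) * F \<xi>)"
  unfolding FT_iff
proof (intro conjI allI impI)
  show "(\<lambda>t. f (t - a)) \<in> L2 dx" by (rule L2_translate(1)[OF FT_L2(1)[OF f]])
  show "(\<lambda>\<xi>. cnj (\<xi> a) * F \<xi>) \<in> L2 lam"
    by (rule L2_mult_bounded[OF FT_L2(2)[OF f], where C = 1]) (auto simp: Ch_norm)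
  fix e :: real assume "0 < e"
  then obtain u where u: "u \<in> L12" "n2 dx (\<lambda>x. u x - f x) < e" "n2 lam (\<lambda>\<xi>. fourier dx u \<xi> - F \<xi>) < e"
    using f unfolding FT_iff by blast
  have u': "u \<in> L2 dx" "integrable dx u" using u by auto
  have [measurable]: "u \<in> borel_measurable borel" using L2_measurable[OF u'(1)] by simp
  show "\<exists>k\<in>L12. n2 dx (\<lambda>x. k x - f (x - a)) < e \<and> n2 lam (\<lambda>\<xi>. fourier dx k \<xi> - cnj (\<xi> a) * F \<xi>) < e"
  proof (intro bexI[of _ "\<lambda>t. u (t - a)"] conjI)
    show "(\<lambda>t. u (t - a)) \<in> L12" using L2_translate(1)[OF u'(1)] integral_translate(2)[of u a] u'(2) by simp
    show "n2 dx (\<lambda>x. u (x - a) - f (x - a)) < e"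
      using L2_translate(2)[OF L2_diff[OF u'(1) FT_L2(1)[OF f]], of a] u by simp
    have "n2 lam (\<lambda>\<xi>. fourier dx (\<lambda>t. u (t - a)) \<xi> - cnj (\<xi> a) * F \<xi>) = n2 lam (\<lambda>\<xi>. fourier dx u \<xi> - F \<xi>)"
      by (rule n2_cong) (simp add: fourier_translate[OF u'(2)] right_diff_distrib[symmetric] norm_mult Ch_norm)
    then show "n2 lam (\<lambda>\<xi>. fourier dx (\<lambda>t. u (t - a)) \<xi> - cnj (\<xi> a) * F \<xi>) < e" using u by simp
  qed
qed

text \<open>Translations of \<open>f\<close> provide the evaluations as multipliers; dominated
  convergence together with \<open>FT_closed\<close> provides the bounded limits.\<close>

lemma FT_multiplier:
  assumes m [measurable]: "m \<in> borel_measurable lam" and mb: "\<And>\<xi>. \<xi> \<in> Ch \<Longrightarrow> cmod (m \<xi>) \<le> C"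
    and F: "\<exists>f. FT f F"
  shows "\<exists>f. FT f (\<lambda>\<xi>. m \<xi> * F \<xi>)"
proof -
  \<comment> \<open>Quantifying over all \<open>F\<close> of the range inside \<open>P\<close> makes
    a product of multipliers their composition. The bound is carried along because the monotone
    class argument handles bounded functions only.\<close>
  define P where "P m \<longleftrightarrow> m \<in> borel_measurable lam \<and> (\<exists>C. \<forall>\<xi>\<in>Ch. cmod (m \<xi>) \<le> C) \<and>
    (\<forall>F. (\<exists>f. FT f F) \<longrightarrow> (\<exists>f. FT f (\<lambda>\<xi>. m \<xi> * F \<xi>)))" for m
  have "P m"
  proof (rule dual_monotone_class[where P = P, OF _ _ _ _ _ m mb])
    show "\<exists>C. \<forall>\<xi>\<in>Ch. cmod (m \<xi>) \<le> C" if "P m" for m using that by (simp add: P_def)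
    show "P (\<lambda>\<xi>. \<xi> a)" for a
      unfolding P_def
    proof (intro conjI allI impI)
      show "\<exists>C. \<forall>\<xi>\<in>Ch. cmod (\<xi> a) \<le> C" by (rule exI[of _ 1]) (simp add: Ch_norm)
      fix F assume "\<exists>f. FT f F"
      then obtain f where f: "FT f F" ..
      have "FT (\<lambda>t. f (t - - a)) (\<lambda>\<xi>. \<xi> a * F \<xi>)"
        by (rule FT_cong[OF FT_translate[OF f]]) (simp add: Ch_minus)
      then show "\<exists>f. FT f (\<lambda>\<xi>. \<xi> a * F \<xi>)" by blast
    qed measurable
  next
    fix m k a b assume m: "P m" and k: "P k"
    have [measurable]: "m \<in> borel_measurable lam" "k \<in> borel_measurable lam" using m k by (auto simp: P_def)
    obtain C D where C: "\<And>\<xi>. \<xi> \<in> Ch \<Longrightarrow> cmod (m \<xi>) \<le> C" and D: "\<And>\<xi>. \<xi> \<in> Ch \<Longrightarrow> cmod (k \<xi>) \<le> D"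
      using m k unfolding P_def by blast
    show "P (\<lambda>\<xi>. a * m \<xi> + b * k \<xi>)"
      unfolding P_def
    proof (intro conjI allI impI)
      show "\<exists>C. \<forall>\<xi>\<in>Ch. cmod (a * m \<xi> + b * k \<xi>) \<le> C"
      proof (intro exI ballI)
        fix \<xi> assume \<xi>: "\<xi> \<in> Ch"
        have "cmod (a * m \<xi> + b * k \<xi>) \<le> cmod a * cmod (m \<xi>) + cmod b * cmod (k \<xi>)"
          using norm_triangle_ineq[of "a * m \<xi>" "b * k \<xi>"] by (simp add: norm_mult)
        also have "\<dots> \<le> cmod a * C + cmod b * D"
          by (intro add_mono mult_left_mono C D \<xi>) auto
        finally show "cmod (a * m \<xi> + b * k \<xi>) \<le> cmod a * C + cmod b * D" .
      qed
      fix F assume F: "\<exists>f. FT f F"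
      obtain u v where uv: "FT u (\<lambda>\<xi>. m \<xi> * F \<xi>)" "FT v (\<lambda>\<xi>. k \<xi> * F \<xi>)"
        using m k F unfolding P_def by blast
      have "FT (\<lambda>x. a * u x + b * v x) (\<lambda>\<xi>. (a * m \<xi> + b * k \<xi>) * F \<xi>)"
        by (rule FT_cong[OF FT_add[OF FT_cmult[OF uv(1), of a] FT_cmult[OF uv(2), of b]]]) (simp add: algebra_simps)
      then show "\<exists>f. FT f (\<lambda>\<xi>. (a * m \<xi> + b * k \<xi>) * F \<xi>)" by blast
    qed measurable
    show "P (\<lambda>\<xi>. m \<xi> * k \<xi>)"
      unfolding P_def
    proof (intro conjI allI impI)
      show "\<exists>C. \<forall>\<xi>\<in>Ch. cmod (m \<xi> * k \<xi>) \<le> C"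
      proof (intro exI ballI)
        fix \<xi> assume \<xi>: "\<xi> \<in> Ch"
        show "cmod (m \<xi> * k \<xi>) \<le> \<bar>C\<bar> * \<bar>D\<bar>"
          unfolding norm_mult using C[OF \<xi>] D[OF \<xi>] by (intro mult_mono) auto
      qed
      fix F assume F: "\<exists>f. FT f F"
      then have "\<exists>v. FT v (\<lambda>\<xi>. k \<xi> * F \<xi>)" using k unfolding P_def by blast
      then have "\<exists>u. FT u (\<lambda>\<xi>. m \<xi> * (k \<xi> * F \<xi>))" using m unfolding P_def by blast
      then show "\<exists>f. FT f (\<lambda>\<xi>. m \<xi> * k \<xi> * F \<xi>)" by (simp add: mult.assoc)
    qed measurable
  next
    fix m k C assume m: "\<And>n::nat. P (m n)" and b: "\<And>n \<xi>. \<xi> \<in> Ch \<Longrightarrow> cmod (m n \<xi>) \<le> C"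
      and lim: "\<And>\<xi>. \<xi> \<in> Ch \<Longrightarrow> (\<lambda>n. m n \<xi>) \<longlonglongrightarrow> k \<xi>"
    have mm [measurable]: "m n \<in> borel_measurable lam" for n using m by (auto simp: P_def)
    have km [measurable]: "k \<in> borel_measurable lam"
      by (rule borel_measurable_LIMSEQ_metric[of m, OF mm]) (simp add: lim)
    have kb: "cmod (k \<xi>) \<le> C" if "\<xi> \<in> Ch" for \<xi>
      by (rule LIMSEQ_le_const2[OF tendsto_norm[OF lim[OF that]]]) (intro exI[of _ 0] allI impI b[OF that])
    show "P k"
      unfolding P_def
    proof (intro conjI allI impI)
      show "\<exists>C. \<forall>\<xi>\<in>Ch. cmod (k \<xi>) \<le> C" by (intro exI[of _ C] ballI kb)
      fix F assume F: "\<exists>f. FT f F"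
      then have FL: "F \<in> L2 lam" using FT_L2(2) by blast
      have "\<forall>n. \<exists>f. FT f (\<lambda>\<xi>. m n \<xi> * F \<xi>)" using m F unfolding P_def by blast
      then obtain f where f: "\<And>n. FT (f n) (\<lambda>\<xi>. m n \<xi> * F \<xi>)" by metis
      show "\<exists>f. FT f (\<lambda>\<xi>. k \<xi> * F \<xi>)"
      proof (rule FT_closed[OF f])
        show "(\<lambda>\<xi>. k \<xi> * F \<xi>) \<in> L2 lam" by (rule L2_mult_bounded[OF FL km, where C = C]) (simp add: kb)
        show "(\<lambda>n. n2 lam (\<lambda>\<xi>. m n \<xi> * F \<xi> - k \<xi> * F \<xi>)) \<longlonglongrightarrow> 0"
          by (rule L2_dominated_convergence[OF FL mm _ km, where C = C]) (simp_all add: b lim)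
      qed
    qed measurable
  qed
  with F show ?thesis unfolding P_def by blast
qed

text \<open>Where \<open>cmod (G j \<xi>)\<close> is bounded below and \<open>F\<close> is bounded,
  \<open>F\<close> is a bounded multiple of the transform \<open>G j\<close>, so this piece of
  \<open>F\<close> lies in the range. Countably many such pieces cover the dual because the
  \<open>G j\<close> have no common zero.\<close>

theorem FT_surj:
  assumes F: "F \<in> L2 lam" shows "\<exists>f. FT f F"
proof -
  note [measurable] = L2_measurable[OF F]
  obtain g :: "nat \<Rightarrow> 'a \<Rightarrow> complex" where g: "\<And>j. g j \<in> L2 dx" "\<And>j. integrable dx (g j)"
    "\<And>\<xi>. \<xi> \<in> Ch \<Longrightarrow> \<exists>j. fourier dx (g j) \<xi> \<noteq> 0"
    by (rule fourier_separating, rule that)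
  define G where "G j = fourier dx (g j)" for j
  have G_L2: "G j \<in> L2 lam" for j unfolding G_def by (rule plancherel_L1_L2(1)[OF g(1,2)])
  note [measurable] = L2_measurable[OF G_L2]
  have FTG: "FT (g j) (G j)" for j unfolding G_def using g by (intro FT_fourier) simp
  \<comment> \<open>\<open>i\<close> encodes the index \<open>j\<close> together with a level
    \<open>n\<close>; both bounds use \<open>Suc n\<close>, so on \<open>S i\<close> the quotient of
    \<open>F\<close> by \<open>G j\<close> is at most the square of \<open>Suc n\<close>.\<close>
  define S where "S i = {\<xi> \<in> Ch. 1 / real (Suc (snd (prod_decode i))) \<le> cmod (G (fst (prod_decode i)) \<xi>)
      \<and> cmod (F \<xi>) \<le> real (Suc (snd (prod_decode i)))}" for i
  have S_sets [measurable]: "S i \<in> sets lam" for i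
    unfolding S_def space_lam[symmetric] by measurable
  have cover: "(\<Union>i. S i) = Ch"
  proof
    show "Ch \<subseteq> (\<Union>i. S i)"
    proof
      fix \<xi> assume \<xi>: "\<xi> \<in> Ch"
      then obtain j where j: "G j \<xi> \<noteq> 0" using g(3) unfolding G_def by blast
      obtain n1 where n1: "inverse (real (Suc n1)) < cmod (G j \<xi>)" using reals_Archimedean[of "cmod (G j \<xi>)"] j by auto
      obtain n2 where n2: "cmod (F \<xi>) < real n2" using reals_Archimedean2 by blast
      let ?n = "max n1 n2"
      have "1 / real (Suc ?n) \<le> 1 / real (Suc n1)" by (intro divide_left_mono) auto
      then have "1 / real (Suc ?n) \<le> cmod (G j \<xi>)" using n1 by (simp add: inverse_eq_divide)
      moreover have "cmod (F \<xi>) \<le> real (Suc ?n)" using n2 by simp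
      ultimately have "\<xi> \<in> S (prod_encode (j, ?n))" using \<xi> unfolding S_def by simp
      then show "\<xi> \<in> (\<Union>i. S i)" by blast
    qed
  qed (auto simp: S_def)
  have piece: "\<exists>f. FT f (\<lambda>\<xi>. indicator (S i) \<xi> * F \<xi>)" for i
  proof -
    let ?j = "fst (prod_decode i)" and ?N = "real (Suc (snd (prod_decode i)))"
    have "\<exists>f. FT f (\<lambda>\<xi>. (indicator (S i) \<xi> * F \<xi> / G ?j \<xi>) * G ?j \<xi>)"
    proof (rule FT_multiplier[where C = "?N * ?N"])
      show "\<exists>f. FT f (G ?j)" using FTG by blast
      show "cmod (indicator (S i) \<xi> * F \<xi> / G ?j \<xi>) \<le> ?N * ?N" if "\<xi> \<in> Ch" for \<xi>
      proof (cases "\<xi> \<in> S i")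
        case True
        then have 1: "1 / ?N \<le> cmod (G ?j \<xi>)" "cmod (F \<xi>) \<le> ?N" by (auto simp: S_def)
        have "0 < 1 / ?N" by simp
        then have "0 < cmod (G ?j \<xi>)" using 1(1) by linarith
        then have "inverse (cmod (G ?j \<xi>)) \<le> inverse (1 / ?N)" using 1(1) by (intro le_imp_inverse_le) simp_all
        then have "cmod (F \<xi>) * inverse (cmod (G ?j \<xi>)) \<le> ?N * inverse (1 / ?N)"
          using 1(2) by (intro mult_mono) auto
        then show ?thesis using True by (simp add: norm_divide divide_inverse norm_mult norm_inverse)
      qed simp
    qed measurable
    then obtain f where f: "FT f (\<lambda>\<xi>. (indicator (S i) \<xi> * F \<xi> / G ?j \<xi>) * G ?j \<xi>)" ..
    have "FT f (\<lambda>\<xi>. indicator (S i) \<xi> * F \<xi>)"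
    proof (rule FT_cong[OF f])
      fix \<xi>
      show "(indicator (S i) \<xi> * F \<xi> / G ?j \<xi>) * G ?j \<xi> = indicator (S i) \<xi> * F \<xi>"
      proof (cases "\<xi> \<in> S i")
        case True
        then have "1 / ?N \<le> cmod (G ?j \<xi>)" by (auto simp: S_def)
        moreover have "0 < 1 / ?N" by simp
        ultimately have "G ?j \<xi> \<noteq> 0" by auto
        then show ?thesis by simp
      qed simp
    qed
    then show ?thesis by blast
  qed
  have fin: "\<exists>f. FT f (\<lambda>\<xi>. indicator (\<Union>i<n. S i) \<xi> * F \<xi>)" for n :: nat
  proof (induction n)
    case 0
    obtain f where "FT f (G 0)" using FTG by blast
    from FT_cong[OF FT_cmult[OF this, of 0], of "\<lambda>\<xi>. indicator (\<Union>i<0. S i) \<xi> * F \<xi>"] show ?case by auto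
  next
    case (Suc n)
    then obtain u where u: "FT u (\<lambda>\<xi>. indicator (\<Union>i<n. S i) \<xi> * F \<xi>)" ..
    \<comment> \<open>The pieces overlap; the part of \<open>S n\<close> that is already covered is
      removed by another bounded multiplier.\<close>
    have "\<exists>v. FT v (\<lambda>\<xi>. indicator (Ch - (\<Union>i<n. S i)) \<xi> * (indicator (S n) \<xi> * F \<xi>))"
    proof (rule FT_multiplier[OF _ _ piece])
      have "Ch - (\<Union>i<n. S i) \<in> sets lam" using sets.compl_sets[of "\<Union>i<n. S i" lam] by simp
      then show "indicator (Ch - (\<Union>i<n. S i)) \<in> borel_measurable lam" by simp
      show "cmod (indicator (Ch - (\<Union>i<n. S i)) \<xi>) \<le> 1" for \<xi> by (simp add: indicator_def)
    qed
    then obtain v where v: "FT v (\<lambda>\<xi>. indicator (Ch - (\<Union>i<n. S i)) \<xi> * (indicator (S n) \<xi> * F \<xi>))" ..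
    have "FT (\<lambda>x. u x + v x) (\<lambda>\<xi>. indicator (\<Union>i<Suc n. S i) \<xi> * F \<xi>)"
      by (rule FT_cong[OF FT_add[OF u v]]) (auto simp: lessThan_Suc indicator_def)
    then show ?case by blast
  qed
  then obtain f where f: "\<And>n. FT (f n) (\<lambda>\<xi>. indicator (\<Union>i<n. S i) \<xi> * F \<xi>)" by metis
  show ?thesis
  proof (rule FT_closed[OF f F])
    have "(\<lambda>n. n2 lam (\<lambda>\<xi>. indicator (\<Union>i<n. S i) \<xi> * F \<xi> - 1 * F \<xi>)) \<longlonglongrightarrow> 0"
    proof (rule L2_dominated_convergence[OF F, where C = 1])
      fix \<xi> assume "\<xi> \<in> space lam"
      then have "\<xi> \<in> (\<Union>i. S i)" using cover by simp
      then have "(indicator (\<Union>i. S i) \<xi> :: complex) = 1" by simp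
      moreover have "(\<lambda>n. indicator (\<Union>i<n. S i) \<xi> :: complex) \<longlonglongrightarrow> indicator (\<Union>i. S i) \<xi>"
        by (rule LIMSEQ_indicator_UN)
      ultimately show "(\<lambda>n. indicator (\<Union>i<n. S i) \<xi>) \<longlonglongrightarrow> (1::complex)" by simp
    qed (auto simp: indicator_def)
    then show "(\<lambda>n. n2 lam (\<lambda>\<xi>. indicator (\<Union>i<n. S i) \<xi> * F \<xi> - F \<xi>)) \<longlonglongrightarrow> 0" by simp
  qed
qed

text \<open>Both sides are integrated over sets of finite measure: the left one by Parseval's
  identity, the right one by Fubini's theorem, where integrability of \<open>G\<close> permits the
  exchange. Equal integrals over all such sets force equality almost everywhere.\<close>

lemma FT_inverse:
  assumes g: "FT g G" and G: "integrable lam G"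
  shows "AE a in dx. g a = (\<integral>\<xi>. G \<xi> * \<xi> a \<partial>lam)"
proof -
  interpret LA: pair_sigma_finite lam dx ..
  have [measurable]: "g \<in> borel_measurable dx" "G \<in> borel_measurable lam"
    using L2_measurable[OF FT_L2(1)[OF g]] L2_measurable[OF FT_L2(2)[OF g]] by auto
  have ev' [measurable]: "(\<lambda>p. fst p (snd p)) \<in> borel_measurable (lam \<Otimes>\<^sub>M dx)"
    by (rule ev_joint) measurable
  have [measurable]: "(\<lambda>p. snd p (fst p)) \<in> borel_measurable (dx \<Otimes>\<^sub>M lam)"
    by (rule ev_joint) measurable
  define I where "I a = (\<integral>\<xi>. G \<xi> * \<xi> a \<partial>lam)" for a
  have "(\<lambda>(a, \<xi>). G \<xi> * \<xi> a) \<in> borel_measurable (dx \<Otimes>\<^sub>M lam)"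
    unfolding split_beta' by measurable
  from lam.borel_measurable_lebesgue_integral[OF this]
  have I_meas [measurable]: "I \<in> borel_measurable dx" unfolding I_def[abs_def] by simp
  have Ib: "cmod (I a) \<le> (\<integral>\<xi>. cmod (G \<xi>) \<partial>lam)" for a
  proof -
    have "cmod (I a) \<le> (\<integral>\<xi>. norm (G \<xi> * \<xi> a) \<partial>lam)" unfolding I_def by (rule integral_norm_bound)
    also have "\<dots> = (\<integral>\<xi>. cmod (G \<xi>) \<partial>lam)"
      by (intro Bochner_Integration.integral_cong) (simp_all add: norm_mult Ch_norm)
    finally show ?thesis .
  qed
  have key: "(\<integral>x. indicator E x * g x \<partial>dx) = (\<integral>x. indicator E x * I x \<partial>dx)"
    if E [measurable]: "E \<in> sets borel" and fin: "emeasure dx E < \<infinity>" for E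
  proof -
    have iE: "integrable dx (indicator E :: 'a \<Rightarrow> real)" using fin by (intro integrable_real_indicator) auto
    have iEc: "integrable dx (indicator E :: 'a \<Rightarrow> complex)"
      by (rule Bochner_Integration.integrable_bound[OF iE]) (auto split: split_indicator)
    have "(\<lambda>x. (cmod (indicator E x))\<^sup>2) = (indicator E :: 'a \<Rightarrow> real)" by (auto split: split_indicator)
    then have EL: "indicator E \<in> L12" using iE iEc by (auto simp: L2_def)
    have "(\<integral>x. indicator E x * g x \<partial>dx) = ip dx g (indicator E)"
      unfolding ip_def by (intro Bochner_Integration.integral_cong) (auto split: split_indicator)
    also have "\<dots> = ip lam G (fourier dx (indicator E))" by (rule FT_ip[OF g FT_fourier[OF EL]])
    also have "\<dots> = (\<integral>\<xi>. (\<integral>x. indicator E x * (G \<xi> * \<xi> x) \<partial>dx) \<partial>lam)"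
      unfolding ip_def
    proof (intro Bochner_Integration.integral_cong refl)
      fix \<xi>
      have "cnj (fourier dx (indicator E) \<xi>) = (\<integral>x. cnj (indicator E x * cnj (\<xi> x)) \<partial>dx)"
        unfolding fourier_def by (rule Bochner_Integration.integral_cnj[symmetric])
      also have "\<dots> = (\<integral>x. indicator E x * \<xi> x \<partial>dx)"
        by (intro Bochner_Integration.integral_cong) (auto split: split_indicator)
      finally have "G \<xi> * cnj (fourier dx (indicator E) \<xi>) = (\<integral>x. G \<xi> * (indicator E x * \<xi> x) \<partial>dx)" by simp
      also have "\<dots> = (\<integral>x. indicator E x * (G \<xi> * \<xi> x) \<partial>dx)" by (simp add: mult.left_commute)
      finally show "G \<xi> * cnj (fourier dx (indicator E) \<xi>) = (\<integral>x. indicator E x * (G \<xi> * \<xi> x) \<partial>dx)" .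
    qed
    also have "\<dots> = (\<integral>x. (\<integral>\<xi>. indicator E x * (G \<xi> * \<xi> x) \<partial>lam) \<partial>dx)"
    proof (rule LA.Fubini_integral[symmetric])
      have m: "(\<lambda>(\<xi>, x). indicator E x * (G \<xi> * \<xi> x)) \<in> borel_measurable (lam \<Otimes>\<^sub>M dx)"
        unfolding split_beta' by measurable
      show "integrable (lam \<Otimes>\<^sub>M dx) (\<lambda>(\<xi>, x). indicator E x * (G \<xi> * \<xi> x))"
      proof (rule LA.Fubini_integrable[OF m])
        have "(\<integral>x. norm (case (\<xi>, x) of (\<xi>, x) \<Rightarrow> indicator E x * (G \<xi> * \<xi> x)) \<partial>dx) = cmod (G \<xi>) * measure dx E"
          if "\<xi> \<in> Ch" for \<xi>
        proof -
          have "(\<integral>x. norm (case (\<xi>, x) of (\<xi>, x) \<Rightarrow> indicator E x * (G \<xi> * \<xi> x)) \<partial>dx)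
              = (\<integral>x. cmod (G \<xi>) * indicator E x \<partial>dx)"
            by (intro Bochner_Integration.integral_cong) (auto simp: norm_mult Ch_norm[OF that] split: split_indicator)
          then show ?thesis by simp
        qed
        then have "integrable lam (\<lambda>\<xi>. \<integral>x. norm (case (\<xi>, x) of (\<xi>, x) \<Rightarrow> indicator E x * (G \<xi> * \<xi> x)) \<partial>dx)
            \<longleftrightarrow> integrable lam (\<lambda>\<xi>. cmod (G \<xi>) * measure dx E)"
          by (intro Bochner_Integration.integrable_cong) auto
        then show "integrable lam (\<lambda>\<xi>. \<integral>x. norm (case (\<xi>, x) of (\<xi>, x) \<Rightarrow> indicator E x * (G \<xi> * \<xi> x)) \<partial>dx)"
          using G by simp
        show "AE \<xi> in lam. integrable dx (\<lambda>x. case (\<xi>, x) of (\<xi>, x) \<Rightarrow> indicator E x * (G \<xi> * \<xi> x))"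
        proof (rule AE_I2)
          fix \<xi> assume "\<xi> \<in> space lam"
          then have \<xi>: "\<xi> \<in> Ch" by simp
          note [measurable] = Ch_measurable[OF \<xi>]
          have "integrable dx (\<lambda>x. cmod (G \<xi>) * indicator E x)" using iE by simp
          then show "integrable dx (\<lambda>x. case (\<xi>, x) of (\<xi>, x) \<Rightarrow> indicator E x * (G \<xi> * \<xi> x))"
            by (rule Bochner_Integration.integrable_bound) (auto simp: norm_mult Ch_norm[OF \<xi>] split: split_indicator)
        qed
      qed
    qed
    also have "\<dots> = (\<integral>x. indicator E x * I x \<partial>dx)" unfolding I_def by simp
    finally show ?thesis .
  qed
  obtain A :: "nat \<Rightarrow> 'a set" where A: "range A \<subseteq> sets dx" "(\<Union>i. A i) = space dx" "\<And>i. emeasure dx (A i) \<noteq> \<infinity>"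
    using dx.sigma_finite by blast
  \<comment> \<open>The two sides may fail to be integrable on all of \<open>A\<close>, so they are
    compared on pieces of finite measure.\<close>
  have "AE x in dx. x \<in> A i \<longrightarrow> g x = I x" for i
  proof -
    have Ai [measurable]: "A i \<in> sets borel" using A(1) by auto
    have Ai_fin: "emeasure dx (A i) < \<infinity>" using A(3)[of i] by (simp add: less_top)
    have iA: "integrable dx (indicator (A i) :: 'a \<Rightarrow> real)" using Ai_fin by (intro integrable_real_indicator) auto
    have "(\<lambda>x. (cmod (indicator (A i) x))\<^sup>2) = (indicator (A i) :: 'a \<Rightarrow> real)" by (auto split: split_indicator)
    then have "indicator (A i) \<in> L2 dx" using iA by (auto simp: L2_def)
    from L2_prod_integrable(3)[OF this FT_L2(1)[OF g]]
    have i1: "integrable dx (\<lambda>x. indicator (A i) x * g x)" .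
    have i2: "integrable dx (\<lambda>x. indicator (A i) x * I x)"
    proof (rule Bochner_Integration.integrable_bound)
      show "integrable dx (\<lambda>x. (\<integral>\<xi>. cmod (G \<xi>) \<partial>lam) * indicator (A i) x)" using iA by simp
      show "AE x in dx. norm (indicator (A i) x * I x) \<le> norm ((\<integral>\<xi>. cmod (G \<xi>) \<partial>lam) * indicator (A i) x)"
        using Ib by (intro AE_I2) (auto split: split_indicator intro: order_trans)
    qed measurable
    have "AE x in dx. indicator (A i) x * g x = indicator (A i) x * I x"
    proof (rule dx.density_unique_banach[OF i1 i2])
      fix B assume B [measurable]: "B \<in> sets dx"
      have e: "set_lebesgue_integral dx B (\<lambda>x. indicator (A i) x * k x) = (\<integral>x. indicator (A i \<inter> B) x * k x \<partial>dx)" for k :: "'a \<Rightarrow> complex"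
        unfolding set_lebesgue_integral_def by (intro Bochner_Integration.integral_cong) (auto split: split_indicator)
      have "emeasure dx (A i \<inter> B) \<le> emeasure dx (A i)" by (intro emeasure_mono) auto
      then have "emeasure dx (A i \<inter> B) < \<infinity>" using Ai_fin by (rule le_less_trans)
      moreover have "A i \<inter> B \<in> sets borel" using B Ai by auto
      ultimately show "set_lebesgue_integral dx B (\<lambda>x. indicator (A i) x * g x) = set_lebesgue_integral dx B (\<lambda>x. indicator (A i) x * I x)"
        unfolding e by (intro key)
    qed
    then show ?thesis by eventually_elim auto
  qed
  then have "AE x in dx. \<forall>i. x \<in> A i \<longrightarrow> g x = I x" by (subst AE_all_countable) blast
  then show ?thesis
  proof (rule AE_mp, intro AE_I2 impI)
    fix x assume x: "x \<in> space dx" "\<forall>i. x \<in> A i \<longrightarrow> g x = I x"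
    then have "x \<in> (\<Union>i. A i)" using A(2) by simp
    then show "g x = (\<integral>\<xi>. G \<xi> * \<xi> x \<partial>lam)" using x(2) unfolding I_def by blast
  qed
qed

end

section \<open>The automorphism group acting on A and on its dual\<close>

locale semidirect = dual_pair dx lam
  for dx :: "'a::{topological_ab_group_add, t2_space, second_countable_topology} measure"
    and lam :: "('a \<Rightarrow> complex) measure" +
  fixes HH :: "('a \<Rightarrow> 'a) set"
    and TH :: "('a \<Rightarrow> 'a) topology"
    and dh :: "('a \<Rightarrow> 'a) measure"
    and X :: "('a \<Rightarrow> complex) set"
  assumes Hgrp: "is_auto_group HH TH"
    and haarH: "is_left_haar_H HH TH dh"
    and X_borel: "X \<in> sets lam"
    and X_inv: "\<forall>\<xi>\<in>X. \<forall>h\<in>HH. \<xi> \<circ> h \<in> X"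
begin

subsection \<open>The acting group\<close>

lemma topspace_TH [simp]: "topspace TH = HH" using Hgrp by (simp add: is_auto_group_def)

abbreviation NH :: "('a \<Rightarrow> 'a) measure" where "NH \<equiv> borel_of_top TH"

lemma space_NH [simp]: "space NH = HH" by (simp add: topspace_TH)

lemma sets_dh [measurable_cong, simp]: "sets dh = sets NH"
  using haarH by (simp add: is_left_haar_H_def)

lemma space_dh [simp]: "space dh = HH"
  using haarH by (simp add: is_left_haar_H_def)

lemma HH_bij: "h \<in> HH \<Longrightarrow> bij h"
  and HH_hom: "h \<in> HH \<Longrightarrow> homeomorphism UNIV UNIV h (inv h)"
  and HH_add: "h \<in> HH \<Longrightarrow> h (x + y) = h x + h y"
  and id_HH: "id \<in> HH"
  and comp_HH: "g \<in> HH \<Longrightarrow> h \<in> HH \<Longrightarrow> g \<circ> h \<in> HH"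
  and inv_HH: "h \<in> HH \<Longrightarrow> inv h \<in> HH"
  using Hgrp unfolding is_auto_group_def by blast+

lemma HH_inv_simps:
  assumes "h \<in> HH"
  shows "inv h (h x) = x" "h (inv h x) = x" "inv h \<circ> h = id" "h \<circ> inv h = id" "inv (inv h) = h"
  using HH_bij[OF assms]
  by (auto simp: bij_is_inj bij_is_surj surj_f_inv_f inv_inv_eq surj_iff[symmetric] fun_eq_iff)

lemma HH_continuous: "h \<in> HH \<Longrightarrow> continuous_on UNIV h"
  using HH_hom by (auto simp: homeomorphism_def)

lemma HH_measurable [measurable_dest]: "h \<in> HH \<Longrightarrow> h \<in> borel_measurable borel"
  by (rule borel_measurable_continuous_onI[OF HH_continuous])

lemma H_group: "measurable_group NH (\<circ>) inv id"
proof
  show "(\<lambda>(x, y). x \<circ> y) \<in> NH \<Otimes>\<^sub>M NH \<rightarrow>\<^sub>M NH"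
    using Hgrp by (intro measurable_borel_of_top_prod) (auto simp: is_auto_group_def)
  show "inv \<in> NH \<rightarrow>\<^sub>M NH"
    using Hgrp by (intro measurable_borel_of_top) (auto simp: is_auto_group_def)
qed (auto simp: id_HH HH_inv_simps comp_assoc)

sublocale H: measurable_group NH "(\<circ>)" inv id by (rule H_group)

lemma left_inv_dh: "left_inv NH (\<circ>) dh"
  using haarH by (simp add: left_inv_def is_left_haar_H_def)

lemma sigma_finite_dh: "sigma_finite_measure dh"
  using Hgrp haarH
  by (intro sigma_finite_borel_of_top[of TH]) (auto simp: is_auto_group_def is_left_haar_H_def)

sublocale dh: sigma_finite_measure dh by (rule sigma_finite_dh)

lemma dh_nonzero: "emeasure dh (space dh) \<noteq> 0"
proof -
  have "openin TH HH" using openin_topspace[of TH] by (simp add: topspace_TH)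
  then have "0 < emeasure dh HH" using haarH id_HH unfolding is_left_haar_H_def by blast
  then show ?thesis by simp
qed

lemma act_measurable:
  assumes "f \<in> M \<rightarrow>\<^sub>M NH" "g \<in> borel_measurable M"
  shows "(\<lambda>x. (f x) (g x)) \<in> M \<rightarrow>\<^sub>M (borel :: 'a measure)"
proof -
  have "(\<lambda>(h, x). h x) \<in> NH \<Otimes>\<^sub>M borel_of_top euclidean \<rightarrow>\<^sub>M borel_of_top (euclidean :: 'a topology)"
    using Hgrp second_countable_euclidean by (intro measurable_borel_of_top_prod) (auto simp: is_auto_group_def)
  moreover have "g \<in> M \<rightarrow>\<^sub>M borel_of_top euclidean"
    using assms(2) by (subst measurable_cong_sets[OF refl sets_borel_of_top_euclidean])
  ultimately have "(\<lambda>x. (f x) (g x)) \<in> M \<rightarrow>\<^sub>M borel_of_top (euclidean :: 'a topology)"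
    using measurable_compose[OF measurable_Pair[OF assms(1)], of g "borel_of_top euclidean" "\<lambda>(h, x). h x"] by simp
  then show ?thesis by (subst (asm) measurable_cong_sets[OF refl sets_borel_of_top_euclidean])
qed

lemma comp_Ch: "\<xi> \<in> Ch \<Longrightarrow> h \<in> HH \<Longrightarrow> \<xi> \<circ> h \<in> Ch"
proof (rule Ch_I)
  assume "\<xi> \<in> Ch" "h \<in> HH"
  then show "continuous_on UNIV (\<xi> \<circ> h)"
    by (intro continuous_on_compose HH_continuous continuous_on_subset[OF Ch_continuous]) auto
qed (simp_all add: Ch_norm Ch_add HH_add)

text \<open>Tested on evaluations, the value at \<open>a\<close> is the joint evaluation of a
  measurable character at the measurable point \<open>g x a\<close>; measurability of the dual
  action is thus inherited from the action on \<open>A\<close>.\<close>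

lemma dual_act_measurable [measurable (raw)]:
  assumes f: "f \<in> M \<rightarrow>\<^sub>M lam" and g: "g \<in> M \<rightarrow>\<^sub>M NH"
  shows "(\<lambda>x. f x \<circ> g x) \<in> M \<rightarrow>\<^sub>M lam"
proof (rule measurable_lamI)
  show "f x \<circ> g x \<in> Ch" if "x \<in> space M" for x
    using measurable_space[OF f that] measurable_space[OF g that] by (intro comp_Ch) auto
  have "(\<lambda>x. g x a) \<in> borel_measurable M" for a by (rule act_measurable[OF g]) simp
  from ev_joint[OF f this] show "(\<lambda>x. (f x \<circ> g x) a) \<in> borel_measurable M" for a by simp
qed

lemma dual_act_const [measurable]: "h \<in> HH \<Longrightarrow> (\<lambda>\<xi>. \<xi> \<circ> h) \<in> lam \<rightarrow>\<^sub>M lam"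
  by (rule dual_act_measurable) auto

subsection \<open>The modular functions\<close>

lemma left_inv_distr_inv:
  assumes h: "h \<in> HH" shows "left_inv borel (+) (distr dx borel (inv h))"
proof -
  interpret A: measurable_group "borel :: 'a measure" "(+)" uminus 0 by (rule A_group)
  show ?thesis
    using HH_measurable[OF inv_HH[OF h]] HH_measurable[OF h]
    by (rule A.left_inv_distr_automorphism[OF left_inv_dx]) (simp_all add: HH_inv_simps[OF h] HH_add[OF inv_HH[OF h]])
qed

text \<open>The set chosen in \<open>delta\<close> is immaterial: the image of \<open>dx\<close>
  under \<open>inv h\<close> is again translation invariant, so it is a constant multiple of
  \<open>dx\<close>, and the chosen set reveals the constant.\<close>

lemma delta_scaling:
  assumes h: "h \<in> HH"
  shows delta_pos: "0 < delta dx h"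
    and nn_integral_inv: "\<And>f. f \<in> borel_measurable borel \<Longrightarrow>
      (\<integral>\<^sup>+t. f (inv h t) \<partial>dx) = ennreal (delta dx h) * (\<integral>\<^sup>+t. f t \<partial>dx)"
proof -
  interpret A: measurable_group "borel :: 'a measure" "(+)" uminus 0 by (rule A_group)
  define B where "B = (SOME B. B \<in> sets dx \<and> 0 < emeasure dx B \<and> emeasure dx B < \<infinity>)"
  have B: "B \<in> sets dx \<and> 0 < emeasure dx B \<and> emeasure dx B < \<infinity>"
    unfolding B_def by (rule someI_ex) (rule dx.obtain_pos_finite_set[OF dx_nonzero], blast)
  have d: "delta dx h = measure dx (h ` B) / measure dx B" unfolding delta_def B_def[symmetric] Let_def ..
  note hm [measurable] = HH_measurable[OF h] HH_measurable[OF inv_HH[OF h]]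
  let ?K = "distr dx borel (inv h)"
  have K: "left_inv borel (+) ?K" by (rule left_inv_distr_inv[OF h])
  have sfK: "sigma_finite_measure ?K"
    by (rule sigma_finite_distr_inverse[OF sigma_finite_dx, where g = h]) (simp_all add: HH_inv_simps[OF h])
  interpret K: sigma_finite_measure ?K by (rule sfK)
  have "emeasure ?K (space ?K) = emeasure dx (space dx)" by (simp add: emeasure_distr)
  then have "emeasure ?K (space ?K) \<noteq> 0" using dx_nonzero by simp
  then obtain C where C: "C \<in> sets ?K" "0 < emeasure ?K C" "emeasure ?K C < \<infinity>" by (rule K.obtain_pos_finite_set)
  have Bm [measurable]: "B \<in> sets borel" using B by simp
  have Cm [measurable]: "C \<in> sets borel" using C(1) by simp
  have U: "(\<integral>\<^sup>+x. f x \<partial>dx) * emeasure ?K B = emeasure dx B * (\<integral>\<^sup>+x. f x \<partial>?K)"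
    if [measurable]: "f \<in> borel_measurable borel" for f
  proof -
    have "(\<integral>\<^sup>+x. f x \<partial>dx) * (\<integral>\<^sup>+x. indicator B x \<partial>?K) = (\<integral>\<^sup>+x. indicator B x \<partial>dx) * (\<integral>\<^sup>+x. f x \<partial>?K)"
      by (rule A.left_inv_unique_comm[OF left_inv_dx K sigma_finite_dx sfK]) (use B in \<open>auto simp: add.commute\<close>)
    then show ?thesis by simp
  qed
  from U[of "indicator C"] have UC: "emeasure dx C * emeasure ?K B = emeasure dx B * emeasure ?K C" by simp
  \<comment> \<open>The product on the right of \<open>UC\<close> is positive and finite by the
    choice of \<open>B\<close> and \<open>C\<close>. This forces both factors on the left to be
    positive, and then \<open>emeasure ?K B\<close> to be finite.\<close>
  have KB: "0 < emeasure ?K B" "emeasure ?K B < \<infinity>"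
  proof -
    have p: "0 < emeasure dx C * emeasure ?K B" "emeasure dx C * emeasure ?K B < \<infinity>"
      unfolding UC using B C by (auto simp: ennreal_zero_less_mult_iff ennreal_mult_less_top)
    show "0 < emeasure ?K B" using p(1) by (auto simp: ennreal_zero_less_mult_iff)
    show "emeasure ?K B < \<infinity>" using p by (auto simp: ennreal_mult_less_top ennreal_zero_less_mult_iff)
  qed
  have "inv h -` B \<inter> space dx = h ` B"
    using HH_inv_simps[OF h] by (auto intro!: image_eqI[of _ h "inv h _"])
  then have eK: "emeasure ?K B = emeasure dx (h ` B)" by (subst emeasure_distr) auto
  obtain b k where bk: "emeasure dx B = ennreal b" "emeasure ?K B = ennreal k" "0 < b" "0 < k"
    using B KB by (cases "emeasure dx B"; cases "emeasure ?K B") auto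
  have dk: "delta dx h = k / b" unfolding d measure_def eK[symmetric] bk using bk(3,4) by simp
  show "0 < delta dx h" unfolding dk using bk by simp
  show "(\<integral>\<^sup>+t. f (inv h t) \<partial>dx) = ennreal (delta dx h) * (\<integral>\<^sup>+t. f t \<partial>dx)"
    if f [measurable]: "f \<in> borel_measurable borel" for f
  proof -
    have "(\<integral>\<^sup>+t. f (inv h t) \<partial>dx) = (\<integral>\<^sup>+x. f x \<partial>?K)" by (rule nn_integral_distr[symmetric]) auto
    moreover have "ennreal b * (\<integral>\<^sup>+x. f x \<partial>?K) = ennreal b * (ennreal (k / b) * (\<integral>\<^sup>+x. f x \<partial>dx))"
      using U[OF f] bk by (simp add: mult.assoc[symmetric] ennreal_mult[symmetric] mult.commute)
    ultimately show ?thesis unfolding dk using bk(3) by (auto simp: ennreal_mult_cancel_left)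
  qed
qed

text \<open>Packages the scaling as an equality of measures, so that it passes from nonnegative
  integrals to Bochner integrals and to integrability.\<close>

lemma distr_inv: "h \<in> HH \<Longrightarrow> distr dx borel (inv h) = density dx (\<lambda>_. ennreal (delta dx h))"
proof (rule measure_eqI)
  assume h: "h \<in> HH"
  note [measurable] = HH_measurable[OF inv_HH[OF h]]
  fix B assume "B \<in> sets (distr dx borel (inv h))"
  then have B [measurable]: "B \<in> sets borel" by simp
  have "emeasure (distr dx borel (inv h)) B = (\<integral>\<^sup>+t. indicator B t \<partial>distr dx borel (inv h))" by simp
  also have "\<dots> = (\<integral>\<^sup>+t. indicator B (inv h t) \<partial>dx)" by (rule nn_integral_distr) auto
  also have "\<dots> = ennreal (delta dx h) * emeasure dx B" by (subst nn_integral_inv[OF h]) auto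
  also have "\<dots> = emeasure (density dx (\<lambda>_. ennreal (delta dx h))) B"
    by (subst emeasure_density_const) auto
  finally show "emeasure (distr dx borel (inv h)) B = emeasure (density dx (\<lambda>_. ennreal (delta dx h))) B" .
qed simp

lemma integral_inv:
  fixes f :: "'a \<Rightarrow> 'c::{banach, second_countable_topology}"
  assumes h: "h \<in> HH" and f [measurable]: "f \<in> borel_measurable borel"
  shows "(\<integral>t. f (inv h t) \<partial>dx) = delta dx h *\<^sub>R (\<integral>t. f t \<partial>dx)"
    and "integrable dx (\<lambda>t. f (inv h t)) \<longleftrightarrow> integrable dx f"
proof -
  have m: "inv h \<in> dx \<rightarrow>\<^sub>M borel" using HH_measurable[OF inv_HH[OF h]] by simp
  note d = delta_pos[OF h]
  have "(\<integral>t. f (inv h t) \<partial>dx) = (\<integral>t. f t \<partial>density dx (\<lambda>_. ennreal (delta dx h)))"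
    using integral_distr[OF m f] unfolding distr_inv[OF h] by (rule sym)
  also have "\<dots> = (\<integral>t. delta dx h *\<^sub>R f t \<partial>dx)" using d by (intro integral_density) auto
  finally show "(\<integral>t. f (inv h t) \<partial>dx) = delta dx h *\<^sub>R (\<integral>t. f t \<partial>dx)" by simp
  have "integrable dx (\<lambda>t. f (inv h t)) \<longleftrightarrow> integrable (density dx (\<lambda>_. ennreal (delta dx h))) f"
    using integrable_distr_eq[OF m f] unfolding distr_inv[OF h] by (rule sym)
  also have "\<dots> \<longleftrightarrow> integrable dx (\<lambda>t. delta dx h *\<^sub>R f t)" using d by (intro integrable_density) auto
  also have "\<dots> \<longleftrightarrow> integrable dx f"
  proof
    assume "integrable dx (\<lambda>t. delta dx h *\<^sub>R f t)"
    from integrable_scaleR_right[OF this, of "1 / delta dx h"] show "integrable dx f" using d by simp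
  qed (rule integrable_scaleR_right)
  finally show "integrable dx (\<lambda>t. f (inv h t)) \<longleftrightarrow> integrable dx f" .
qed

lemma L2_inv:
  assumes h: "h \<in> HH" and f: "f \<in> L2 dx"
  shows "(\<lambda>t. f (inv h t)) \<in> L2 dx" "(n2 dx (\<lambda>t. f (inv h t)))\<^sup>2 = delta dx h * (n2 dx f)\<^sup>2"
proof -
  have [measurable]: "f \<in> borel_measurable borel" using L2_measurable[OF f] by simp
  note [measurable] = HH_measurable[OF inv_HH[OF h]]
  show "(\<lambda>t. f (inv h t)) \<in> L2 dx"
    using L2_integrable[OF f] integral_inv(2)[OF h, of "\<lambda>t. (cmod (f t))\<^sup>2"] by (simp add: L2_def)
  show "(n2 dx (\<lambda>t. f (inv h t)))\<^sup>2 = delta dx h * (n2 dx f)\<^sup>2"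
    using integral_inv(1)[OF h, of "\<lambda>t. (cmod (f t))\<^sup>2"] by (simp add: n2_sq)
qed

lemma fourier_inv:
  assumes h: "h \<in> HH" and f: "integrable dx f" and \<xi>: "\<xi> \<in> Ch"
  shows "fourier dx (\<lambda>t. f (inv h t)) \<xi> = complex_of_real (delta dx h) * fourier dx f (\<xi> \<circ> h)"
proof -
  have [measurable]: "f \<in> borel_measurable borel" using borel_measurable_integrable[OF f] by simp
  note [measurable] = HH_measurable[OF h] Ch_measurable[OF \<xi>]
  have "fourier dx (\<lambda>t. f (inv h t)) \<xi> = (\<integral>t. (\<lambda>s. f s * cnj (\<xi> (h s))) (inv h t) \<partial>dx)"
    by (simp add: fourier_def HH_inv_simps[OF h])
  also have "\<dots> = delta dx h *\<^sub>R (\<integral>s. f s * cnj (\<xi> (h s)) \<partial>dx)"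
    by (rule integral_inv(1)[OF h]) measurable
  finally show ?thesis by (simp add: fourier_def scaleR_conv_of_real)
qed

text \<open>Haar measure on the dual group is scaled by the inverse factor: both sides are Haar measures,
  and Plancherel's formula determines the constant.\<close>
lemma nn_integral_dual_act:
  assumes h: "h \<in> HH" and F [measurable]: "F \<in> borel_measurable lam"
  shows "(\<integral>\<^sup>+\<xi>. F (\<xi> \<circ> h) \<partial>lam) = ennreal (1 / delta dx h) * (\<integral>\<^sup>+\<xi>. F \<xi> \<partial>lam)"
proof -
  interpret D: measurable_group lam "\<lambda>\<xi> \<eta> x. \<xi> x * \<eta> x" "\<lambda>\<xi> x. cnj (\<xi> x)" "\<lambda>_. 1" by (rule dual_group)
  note [measurable] = dual_act_const[OF h] dual_act_const[OF inv_HH[OF h]]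
  let ?K = "distr lam lam (\<lambda>\<xi>. \<xi> \<circ> h)"
  have K: "left_inv lam (\<lambda>\<xi> \<eta> x. \<xi> x * \<eta> x) ?K"
    by (rule D.left_inv_distr_automorphism[OF left_inv_lam dual_act_const[OF h] dual_act_const[OF inv_HH[OF h]]])
      (simp_all add: comp_assoc HH_inv_simps[OF h], simp add: comp_def)
  have sfK: "sigma_finite_measure ?K"
    by (rule sigma_finite_distr_inverse[OF sigma_finite_lam dual_act_const[OF h] dual_act_const[OF inv_HH[OF h]]])
      (simp add: comp_assoc HH_inv_simps[OF h])
  obtain B where B: "B \<in> sets dx" "0 < emeasure dx B" "emeasure dx B < \<infinity>"
    by (rule dx.obtain_pos_finite_set[OF dx_nonzero])
  have iB: "integrable dx (indicator B :: 'a \<Rightarrow> real)" using B by (intro integrable_real_indicator) auto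
  have iBc: "integrable dx (indicator B :: 'a \<Rightarrow> complex)"
    by (rule Bochner_Integration.integrable_bound[OF iB]) (use B in \<open>auto split: split_indicator\<close>)
  have sq: "(\<lambda>x. (cmod (indicator B x))\<^sup>2) = (indicator B :: 'a \<Rightarrow> real)" by (auto split: split_indicator)
  let ?b = "indicator B :: 'a \<Rightarrow> complex"
  have bL: "?b \<in> L2 dx" using iB B(1) by (simp add: L2_def sq)
  have [measurable]: "?b \<in> borel_measurable borel" using B(1) by simp
  have n: "(n2 dx ?b)\<^sup>2 = measure dx B" unfolding n2_sq sq by simp
  have npos: "0 < (n2 dx ?b)\<^sup>2" unfolding n using B by (simp add: measure_def enn2real_positive_iff)
  define d where "d = delta dx h"
  have d: "0 < d" unfolding d_def by (rule delta_pos[OF h])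
  let ?g = "\<lambda>\<xi>. ennreal ((cmod (fourier dx ?b \<xi>))\<^sup>2)"
  have g1: "(\<integral>\<^sup>+\<xi>. ?g \<xi> \<partial>lam) = ennreal ((n2 dx ?b)\<^sup>2)"
    using L2norm_sq_eq[OF plancherel_L1_L2(1)[OF bL iBc]] plancherel_L1_L2(2)[OF bL iBc] by (simp add: L2norm_sq_def)
  have gi: "(\<lambda>t. ?b (inv h t)) \<in> L2 dx" "integrable dx (\<lambda>t. ?b (inv h t))"
    using L2_inv(1)[OF h bL] integral_inv(2)[OF h, of ?b] iBc by auto
  \<comment> \<open>The transform of the dilated function carries the factor \<open>d\<close>, hence
    \<open>d\<^sup>2\<close> after squaring, while its squared norm on \<open>A\<close> gains only
    \<open>d\<close>; the quotient \<open>1 / d\<close> is the factor on the dual.\<close>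
  have "ennreal (d\<^sup>2) * (\<integral>\<^sup>+\<xi>. ?g (\<xi> \<circ> h) \<partial>lam) = (\<integral>\<^sup>+\<xi>. ennreal (d\<^sup>2) * ?g (\<xi> \<circ> h) \<partial>lam)"
    by (rule nn_integral_cmult[symmetric]) measurable
  also have "\<dots> = L2norm_sq lam (fourier dx (\<lambda>t. ?b (inv h t)))"
    unfolding L2norm_sq_def
    by (intro nn_integral_cong)
      (simp add: fourier_inv[OF h iBc] norm_mult power_mult_distrib ennreal_mult d_def[symmetric])
  also have "\<dots> = ennreal (d * (n2 dx ?b)\<^sup>2)"
    using L2norm_sq_eq[OF plancherel_L1_L2(1)[OF gi]] plancherel_L1_L2(2)[OF gi] L2_inv(2)[OF h bL] by (simp add: d_def)
  finally have "ennreal (d\<^sup>2) * (\<integral>\<^sup>+\<xi>. ?g (\<xi> \<circ> h) \<partial>lam) = ennreal (d\<^sup>2) * ennreal (1 / d * (n2 dx ?b)\<^sup>2)"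
    using d by (simp add: ennreal_mult[symmetric] power2_eq_square)
  then have g2: "(\<integral>\<^sup>+\<xi>. ?g (\<xi> \<circ> h) \<partial>lam) = ennreal (1 / d * (n2 dx ?b)\<^sup>2)"
    using d by (auto simp: ennreal_mult_cancel_left)
  have "(\<integral>\<^sup>+\<xi>. F \<xi> \<partial>lam) * (\<integral>\<^sup>+\<xi>. ?g \<xi> \<partial>?K) = (\<integral>\<^sup>+\<xi>. ?g \<xi> \<partial>lam) * (\<integral>\<^sup>+\<xi>. F \<xi> \<partial>?K)"
    by (rule D.left_inv_unique_comm[OF left_inv_lam K sigma_finite_lam sfK])
      (use npos in \<open>auto simp: mult.commute g1\<close>)
  moreover have "(\<integral>\<^sup>+\<xi>. ?g \<xi> \<partial>?K) = ennreal (1 / d * (n2 dx ?b)\<^sup>2)"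
    unfolding g2[symmetric] by (rule nn_integral_distr) measurable
  moreover have "(\<integral>\<^sup>+\<xi>. F \<xi> \<partial>?K) = (\<integral>\<^sup>+\<xi>. F (\<xi> \<circ> h) \<partial>lam)" by (rule nn_integral_distr) measurable
  ultimately have "ennreal ((n2 dx ?b)\<^sup>2) * (\<integral>\<^sup>+\<xi>. F (\<xi> \<circ> h) \<partial>lam)
      = (\<integral>\<^sup>+\<xi>. F \<xi> \<partial>lam) * ennreal (1 / d * (n2 dx ?b)\<^sup>2)" unfolding g1 by simp
  also have "\<dots> = ennreal ((n2 dx ?b)\<^sup>2) * (ennreal (1 / d) * (\<integral>\<^sup>+\<xi>. F \<xi> \<partial>lam))"
    using d by (subst ennreal_mult) (simp_all add: mult_ac)
  finally show ?thesis using npos unfolding d_def[symmetric] by (auto simp: ennreal_mult_cancel_left)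
qed

lemma L2_dual_act:
  assumes h: "h \<in> HH" and F: "F \<in> L2 lam"
  shows "(\<lambda>\<xi>. F (\<xi> \<circ> h)) \<in> L2 lam"
    and "(n2 lam (\<lambda>\<xi>. F (\<xi> \<circ> h)))\<^sup>2 = (1 / delta dx h) * (n2 lam F)\<^sup>2"
proof -
  note [measurable] = dual_act_const[OF h] L2_measurable[OF F]
  have e: "L2norm_sq lam (\<lambda>\<xi>. F (\<xi> \<circ> h)) = ennreal (1 / delta dx h * (n2 lam F)\<^sup>2)"
  proof -
    have "L2norm_sq lam (\<lambda>\<xi>. F (\<xi> \<circ> h)) = ennreal (1 / delta dx h) * L2norm_sq lam F"
      unfolding L2norm_sq_def by (rule nn_integral_dual_act[OF h, of "\<lambda>\<xi>. ennreal ((cmod (F \<xi>))\<^sup>2)"]) measurable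
    then show ?thesis using delta_pos[OF h] by (simp only: L2norm_sq_eq[OF F]) (subst ennreal_mult, auto)
  qed
  then show L: "(\<lambda>\<xi>. F (\<xi> \<circ> h)) \<in> L2 lam" by (subst L2_iff) auto
  from e show "(n2 lam (\<lambda>\<xi>. F (\<xi> \<circ> h)))\<^sup>2 = (1 / delta dx h) * (n2 lam F)\<^sup>2"
    unfolding L2norm_sq_eq[OF L] using delta_pos[OF h] by (subst (asm) ennreal_inj) auto
qed

lemma FT_inv:
  assumes h: "h \<in> HH" and f: "FT f F"
  shows "FT (\<lambda>t. f (inv h t)) (\<lambda>\<xi>. complex_of_real (delta dx h) * F (\<xi> \<circ> h))"
  unfolding FT_iff
proof (intro conjI allI impI)
  show "(\<lambda>t. f (inv h t)) \<in> L2 dx" by (rule L2_inv(1)[OF h FT_L2(1)[OF f]])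
  show "(\<lambda>\<xi>. complex_of_real (delta dx h) * F (\<xi> \<circ> h)) \<in> L2 lam"
    by (intro L2_cmult L2_dual_act(1)[OF h FT_L2(2)[OF f]])
  define d where "d = delta dx h"
  have d: "0 < d" unfolding d_def by (rule delta_pos[OF h])
  fix e :: real assume "0 < e"
  \<comment> \<open>The dilation scales norms on \<open>A\<close> by \<open>sqrt d\<close>, and on
    the dual by \<open>d\<close> times \<open>1 / sqrt d\<close>, so one tolerance serves both
    sides.\<close>
  then have "0 < e / sqrt d" using d by simp
  then obtain u where u: "u \<in> L12" "n2 dx (\<lambda>x. u x - f x) < e / sqrt d" "n2 lam (\<lambda>\<xi>. fourier dx u \<xi> - F \<xi>) < e / sqrt d"
    using f unfolding FT_iff by blast
  have u': "u \<in> L2 dx" "integrable dx u" using u by auto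
  have [measurable]: "u \<in> borel_measurable borel" using L2_measurable[OF u'(1)] by simp
  have sd: "0 < sqrt d" using d by simp
  show "\<exists>k\<in>L12. n2 dx (\<lambda>x. k x - f (inv h x)) < e \<and>
      n2 lam (\<lambda>\<xi>. fourier dx k \<xi> - complex_of_real (delta dx h) * F (\<xi> \<circ> h)) < e"
  proof (intro bexI[of _ "\<lambda>t. u (inv h t)"] conjI)
    show "(\<lambda>t. u (inv h t)) \<in> L12" using L2_inv(1)[OF h u'(1)] integral_inv(2)[OF h, of u] u'(2) by simp
    have "(n2 dx (\<lambda>x. u (inv h x) - f (inv h x)))\<^sup>2 = (sqrt d * n2 dx (\<lambda>x. u x - f x))\<^sup>2"
      using L2_inv(2)[OF h L2_diff[OF u'(1) FT_L2(1)[OF f]]] d by (simp add: d_def power_mult_distrib)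
    then have "n2 dx (\<lambda>x. u (inv h x) - f (inv h x)) = sqrt d * n2 dx (\<lambda>x. u x - f x)"
      by (rule power2_eq_imp_eq) (simp_all add: less_imp_le[OF d])
    then show "n2 dx (\<lambda>x. u (inv h x) - f (inv h x)) < e" using u(2) sd by (simp add: pos_less_divide_eq mult.commute)
    have L: "(\<lambda>\<xi>. fourier dx u \<xi> - F \<xi>) \<in> L2 lam" by (intro L2_diff plancherel_L1_L2(1) u' FT_L2(2)[OF f])
    have "n2 lam (\<lambda>\<xi>. fourier dx (\<lambda>t. u (inv h t)) \<xi> - complex_of_real (delta dx h) * F (\<xi> \<circ> h))
        = n2 lam (\<lambda>\<xi>. complex_of_real d * (fourier dx u (\<xi> \<circ> h) - F (\<xi> \<circ> h)))"
      by (rule n2_cong) (simp add: fourier_inv[OF h u'(2)] right_diff_distrib d_def)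
    also have "\<dots> = d * n2 lam (\<lambda>\<xi>. fourier dx u (\<xi> \<circ> h) - F (\<xi> \<circ> h))" using d by (simp add: n2_cmult)
    also have "\<dots> = sqrt d * n2 lam (\<lambda>\<xi>. fourier dx u \<xi> - F \<xi>)"
    proof (rule power2_eq_imp_eq)
      show "(d * n2 lam (\<lambda>\<xi>. fourier dx u (\<xi> \<circ> h) - F (\<xi> \<circ> h)))\<^sup>2 = (sqrt d * n2 lam (\<lambda>\<xi>. fourier dx u \<xi> - F \<xi>))\<^sup>2"
        using L2_dual_act(2)[OF h L] d by (simp add: d_def power_mult_distrib power2_eq_square[of "delta dx h"])
    qed (use d in auto)
    finally show "n2 lam (\<lambda>\<xi>. fourier dx (\<lambda>t. u (inv h t)) \<xi> - complex_of_real (delta dx h) * F (\<xi> \<circ> h)) < e"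
      using u(3) sd by (simp add: pos_less_divide_eq mult.commute)
  qed
qed

text \<open>\<open>right_translate_scaling\<close> provides one constant for all functions, and
  evaluating it on the chosen set identifies it. The inverse appears because
  \<open>y \<mapsto> indicator B (y \<circ> inv h)\<close> is the indicator of the right translate
  of \<open>B\<close> by \<open>h\<close>.\<close>

lemma modular_H_scaling:
  assumes h: "h \<in> HH"
  shows modular_H_pos: "0 < modular_H dh h"
    and nn_integral_right: "\<And>f. f \<in> borel_measurable NH \<Longrightarrow>
      (\<integral>\<^sup>+y. f (y \<circ> inv h) \<partial>dh) = ennreal (modular_H dh h) * (\<integral>\<^sup>+y. f y \<partial>dh)"
proof -
  define B where "B = (SOME B. B \<in> sets dh \<and> 0 < emeasure dh B \<and> emeasure dh B < \<infinity>)"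
  have B: "B \<in> sets dh \<and> 0 < emeasure dh B \<and> emeasure dh B < \<infinity>"
    unfolding B_def by (rule someI_ex) (rule dh.obtain_pos_finite_set[OF dh_nonzero], blast)
  have m: "modular_H dh h = measure dh ((\<lambda>g. g \<circ> h) ` B) / measure dh B"
    unfolding modular_H_def B_def[symmetric] Let_def ..
  have ih: "inv h \<in> space NH" using inv_HH[OF h] by simp
  obtain c where c: "0 < c" "\<And>g. g \<in> borel_measurable NH \<Longrightarrow>
      (\<integral>\<^sup>+y. g (y \<circ> inv h) \<partial>dh) = ennreal c * (\<integral>\<^sup>+y. g y \<partial>dh)"
    by (rule H.right_translate_scaling[OF left_inv_dh sigma_finite_dh dh_nonzero ih], rule that)
  have Bm [measurable]: "B \<in> sets NH" using B by simp
  have im: "(\<lambda>g. g \<circ> h) ` B = (\<lambda>y. y \<circ> inv h) -` B \<inter> space NH"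
    using H.right_image[of h B] h Bm by simp
  note ih[measurable]
  have "(\<lambda>y. y \<circ> inv h) -` B \<inter> space NH \<in> sets NH" by measurable
  then have "emeasure dh ((\<lambda>g. g \<circ> h) ` B) = (\<integral>\<^sup>+y. indicator ((\<lambda>y. y \<circ> inv h) -` B \<inter> space NH) y \<partial>dh)"
    unfolding im by simp
  also have "\<dots> = (\<integral>\<^sup>+y. indicator B (y \<circ> inv h) \<partial>dh)"
    by (intro nn_integral_cong) (auto split: split_indicator)
  also have "\<dots> = ennreal c * (\<integral>\<^sup>+y. indicator B y \<partial>dh)" by (rule c(2)) simp
  also have "\<dots> = ennreal c * emeasure dh B" using B by simp
  finally have e: "emeasure dh ((\<lambda>g. g \<circ> h) ` B) = ennreal c * emeasure dh B" .
  obtain b where b: "emeasure dh B = ennreal b" "0 < b" using B by (cases "emeasure dh B") auto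
  have "modular_H dh h = c"
    unfolding m measure_def e unfolding b(1) using b(2) c(1) by (simp add: ennreal_mult[symmetric])
  then have mc: "c = modular_H dh h" by (rule sym)
  show "0 < modular_H dh h" using c(1) unfolding mc .
  show "(\<integral>\<^sup>+y. f (y \<circ> inv h) \<partial>dh) = ennreal (modular_H dh h) * (\<integral>\<^sup>+y. f y \<partial>dh)"
    if "f \<in> borel_measurable NH" for f
    using c(2)[OF that] unfolding mc .
qed

text \<open>Inversion turns left Haar measure into right Haar measure, whose density is the modulus
  of the inverse. In \<open>tonelli_identity\<close> an indicator is taken for \<open>g\<close>,
  since the integrals of its right translates are known.\<close>

lemma nn_integral_inverse_H:
  assumes f [measurable]: "f \<in> borel_measurable NH"
  shows "(\<integral>\<^sup>+y. f (inv y) \<partial>dh) = (\<integral>\<^sup>+y. f y * ennreal (modular_H dh (inv y)) \<partial>dh)"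
proof -
  obtain B where B: "B \<in> sets dh" "0 < emeasure dh B" "emeasure dh B < \<infinity>"
    by (rule dh.obtain_pos_finite_set[OF dh_nonzero])
  have Bm [measurable]: "B \<in> sets NH" using B by simp
  have iB: "(\<integral>\<^sup>+y. indicator B (y \<circ> x) \<partial>dh) = emeasure dh B * ennreal (modular_H dh (inv x))" if x: "x \<in> HH" for x
  proof -
    have "(\<integral>\<^sup>+y. indicator B (y \<circ> inv (inv x)) \<partial>dh) = ennreal (modular_H dh (inv x)) * (\<integral>\<^sup>+y. indicator B y \<partial>dh)"
      by (rule nn_integral_right[OF inv_HH[OF x]]) measurable
    then show ?thesis using B by (simp add: HH_inv_simps[OF x] mult.commute)
  qed
  have m: "(\<lambda>x. \<integral>\<^sup>+y. indicator B (y \<circ> x) \<partial>dh) \<in> borel_measurable NH" by measurable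
  \<comment> \<open>The choice in the definition of \<open>modular_H\<close> hides its
    measurability; a parameter integral divided by a constant shows it.\<close>
  have mm: "(\<lambda>x. ennreal (modular_H dh (inv x))) \<in> borel_measurable NH"
  proof -
    have m': "(\<lambda>x. (\<integral>\<^sup>+y. indicator B (y \<circ> x) \<partial>dh) / emeasure dh B) \<in> borel_measurable NH" using m by measurable
    have eq: "(\<integral>\<^sup>+y. indicator B (y \<circ> x) \<partial>dh) / emeasure dh B = ennreal (modular_H dh (inv x))" if "x \<in> space NH" for x
      using iB[of x] that B by (auto simp: ennreal_mult_divide_eq less_top mult.commute[of "emeasure dh B"])
    show ?thesis by (rule iffD1[OF measurable_cong[OF eq] m'])
  qed
  note mm[measurable]
  have "(\<integral>\<^sup>+x. indicator B x \<partial>dh) * (\<integral>\<^sup>+y. f (inv y) \<partial>dh) = (\<integral>\<^sup>+x. f x * (\<integral>\<^sup>+y. indicator B (y \<circ> x) \<partial>dh) \<partial>dh)"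
    by (rule H.tonelli_identity[OF left_inv_dh left_inv_dh sigma_finite_dh sigma_finite_dh, symmetric]) measurable
  also have "\<dots> = (\<integral>\<^sup>+x. emeasure dh B * (f x * ennreal (modular_H dh (inv x))) \<partial>dh)"
    by (intro nn_integral_cong) (simp add: iB mult_ac)
  also have "\<dots> = emeasure dh B * (\<integral>\<^sup>+x. f x * ennreal (modular_H dh (inv x)) \<partial>dh)"
    by (rule nn_integral_cmult) measurable
  finally show ?thesis using B by (auto simp: ennreal_mult_cancel_left less_top)
qed

section \<open>The invariant subspace and the multiplicativity of the moduli\<close>

lemma HX_iff: "f \<in> HX dx lam X \<longleftrightarrow> (\<exists>F. FT f F \<and> (AE \<xi> in lam. \<xi> \<notin> X \<longrightarrow> F \<xi> = 0))"
  unfolding HX_def FT_def by blast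

lemma X_subset: "X \<subseteq> Ch"
  using sets.sets_into_space[OF X_borel] by simp

lemma X_inv_iff: "\<xi> \<in> Ch \<Longrightarrow> h \<in> HH \<Longrightarrow> \<xi> \<circ> h \<in> X \<longleftrightarrow> \<xi> \<in> X"
proof
  assume h: "h \<in> HH" and "\<xi> \<circ> h \<in> X"
  then have "(\<xi> \<circ> h) \<circ> inv h \<in> X" using X_inv inv_HH by blast
  then show "\<xi> \<in> X" by (simp add: comp_assoc HH_inv_simps[OF h])
qed (use X_inv in blast)

lemma delta_comp: assumes g: "g \<in> HH" and h: "h \<in> HH" shows "delta dx (g \<circ> h) = delta dx g * delta dx h"
proof -
  obtain B where B: "B \<in> sets dx" "0 < emeasure dx B" "emeasure dx B < \<infinity>"
    by (rule dx.obtain_pos_finite_set[OF dx_nonzero])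
  have iB [measurable]: "indicator B \<in> borel_measurable (borel :: 'a measure)" using B(1) by simp
  note [measurable] = HH_measurable[OF inv_HH[OF h]]
  have i: "inv (g \<circ> h) = inv h \<circ> inv g" by (rule o_inv_distrib[OF HH_bij[OF g] HH_bij[OF h]])
  have "ennreal (delta dx (g \<circ> h)) * emeasure dx B = (\<integral>\<^sup>+t. indicator B (inv (g \<circ> h) t) \<partial>dx)"
    using nn_integral_inv[OF comp_HH[OF g h] iB] B(1) by simp
  also have "\<dots> = (\<integral>\<^sup>+t. (\<lambda>s. indicator B (inv h s)) (inv g t) \<partial>dx)" by (simp add: i)
  also have "\<dots> = ennreal (delta dx g) * (\<integral>\<^sup>+s. indicator B (inv h s) \<partial>dx)"
    by (rule nn_integral_inv[OF g]) measurable
  also have "\<dots> = ennreal (delta dx g * delta dx h) * emeasure dx B"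
    using nn_integral_inv[OF h iB] B(1) delta_pos[OF g] delta_pos[OF h] by (simp add: ennreal_mult mult.assoc)
  finally have "emeasure dx B * ennreal (delta dx (g \<circ> h)) = emeasure dx B * ennreal (delta dx g * delta dx h)"
    by (simp only: mult.commute)
  then have "ennreal (delta dx (g \<circ> h)) = ennreal (delta dx g * delta dx h)"
    using B by (auto simp: ennreal_mult_cancel_left less_top)
  then show ?thesis using delta_pos[OF g] delta_pos[OF h] delta_pos[OF comp_HH[OF g h]] by simp
qed

lemma modular_H_comp:
  assumes g: "g \<in> HH" and h: "h \<in> HH" shows "modular_H dh (g \<circ> h) = modular_H dh g * modular_H dh h"
proof -
  obtain B where B: "B \<in> sets dh" "0 < emeasure dh B" "emeasure dh B < \<infinity>"
    by (rule dh.obtain_pos_finite_set[OF dh_nonzero])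
  have iB [measurable]: "indicator B \<in> borel_measurable NH" using B(1) by simp
  have [measurable]: "inv g \<in> space NH" using inv_HH[OF g] by simp
  have i: "inv (g \<circ> h) = inv h \<circ> inv g" by (rule o_inv_distrib[OF HH_bij[OF g] HH_bij[OF h]])
  have "ennreal (modular_H dh (g \<circ> h)) * emeasure dh B = (\<integral>\<^sup>+y. indicator B (y \<circ> inv (g \<circ> h)) \<partial>dh)"
    using nn_integral_right[OF comp_HH[OF g h] iB] B(1) by simp
  also have "\<dots> = (\<integral>\<^sup>+y. (\<lambda>z. indicator B (z \<circ> inv g)) (y \<circ> inv h) \<partial>dh)" by (simp add: i comp_assoc)
  also have "\<dots> = ennreal (modular_H dh h) * (\<integral>\<^sup>+z. indicator B (z \<circ> inv g) \<partial>dh)"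
    by (rule nn_integral_right[OF h]) measurable
  also have "\<dots> = ennreal (modular_H dh g * modular_H dh h) * emeasure dh B"
    using nn_integral_right[OF g iB] B(1) modular_H_pos[OF g] modular_H_pos[OF h] by (simp add: ennreal_mult mult_ac)
  finally have "emeasure dh B * ennreal (modular_H dh (g \<circ> h)) = emeasure dh B * ennreal (modular_H dh g * modular_H dh h)"
    by (simp only: mult.commute)
  then have "ennreal (modular_H dh (g \<circ> h)) = ennreal (modular_H dh g * modular_H dh h)"
    using B by (auto simp: ennreal_mult_cancel_left less_top)
  then show ?thesis using modular_H_pos[OF g] modular_H_pos[OF h] modular_H_pos[OF comp_HH[OF g h]] by simp
qed

lemma delta_id: "delta dx id = 1"
  using delta_comp[OF id_HH id_HH] delta_pos[OF id_HH] by simp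

lemma modular_H_id: "modular_H dh id = 1"
  using modular_H_comp[OF id_HH id_HH] modular_H_pos[OF id_HH] by simp

lemma delta_inverse: "h \<in> HH \<Longrightarrow> delta dx (inv h) = 1 / delta dx h"
  using delta_comp[of h "inv h"] delta_pos[of h] by (simp add: inv_HH HH_inv_simps delta_id field_simps)

lemma modular_H_inverse: "h \<in> HH \<Longrightarrow> modular_H dh (inv h) = 1 / modular_H dh h"
  using modular_H_comp[of h "inv h"] modular_H_pos[of h] by (simp add: inv_HH HH_inv_simps modular_H_id field_simps)

lemma inverse_act_measurable:
  assumes "f \<in> M \<rightarrow>\<^sub>M NH" "g \<in> borel_measurable M"
  shows "(\<lambda>x. inv (f x) (g x)) \<in> M \<rightarrow>\<^sub>M (borel :: 'a measure)"
  by (rule act_measurable[OF measurable_compose[OF assms(1) H.iv_measurable] assms(2)])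

text \<open>The measure of an image under a varying \<open>h\<close> is rewritten as the parameter
  integral of \<open>indicator B (inv h t)\<close>, to which Tonelli's theorem applies.\<close>

lemma delta_measurable [measurable]: "delta dx \<in> borel_measurable NH"
proof -
  obtain B where B: "B \<in> sets dx" "0 < emeasure dx B" "emeasure dx B < \<infinity>"
    by (rule dx.obtain_pos_finite_set[OF dx_nonzero])
  have iB [measurable]: "indicator B \<in> borel_measurable (borel :: 'a measure)" using B(1) by simp
  have a [measurable]: "(\<lambda>p. inv (fst p) (snd p)) \<in> NH \<Otimes>\<^sub>M dx \<rightarrow>\<^sub>M (borel :: 'a measure)"
    by (rule inverse_act_measurable) measurable
  have "(\<lambda>(h, t). indicator B (inv h t) :: ennreal) \<in> borel_measurable (NH \<Otimes>\<^sub>M dx)"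
    unfolding split_beta' using measurable_compose[OF a iB] .
  from dx.borel_measurable_nn_integral[OF this]
  have [measurable]: "(\<lambda>h. \<integral>\<^sup>+t. indicator B (inv h t) \<partial>dx) \<in> borel_measurable NH" by simp
  have m: "(\<lambda>h. enn2real ((\<integral>\<^sup>+t. indicator B (inv h t) \<partial>dx) / emeasure dx B)) \<in> borel_measurable NH"
    by measurable
  have eq: "enn2real ((\<integral>\<^sup>+t. indicator B (inv h t) \<partial>dx) / emeasure dx B) = delta dx h" if "h \<in> space NH" for h
  proof -
    have "(\<integral>\<^sup>+t. indicator B (inv h t) \<partial>dx) = ennreal (delta dx h) * emeasure dx B"
      using nn_integral_inv[of h, OF _ iB] that B(1) by simp
    then show ?thesis using B that delta_pos[of h] by (auto simp: ennreal_mult_divide_eq less_top)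
  qed
  show ?thesis by (rule iffD1[OF measurable_cong[OF eq] m])
qed

subsection \<open>The Calderon function\<close>

text \<open>The orbital integral. For an indicator it is the orbit measure of the set, for a squared
  modulus the Calderon function \<open>W\<close>; sharing one definition lets a disintegration act
  directly on \<open>W\<close>.\<close>

definition V :: "(('a \<Rightarrow> complex) \<Rightarrow> ennreal) \<Rightarrow> ('a \<Rightarrow> complex) \<Rightarrow> ennreal" where
  "V u \<xi> = (\<integral>\<^sup>+h. u (\<xi> \<circ> h) \<partial>dh)"

definition W :: "(('a \<Rightarrow> complex) \<Rightarrow> complex) \<Rightarrow> ('a \<Rightarrow> complex) \<Rightarrow> ennreal" where
  "W P = V (\<lambda>\<xi>. ennreal ((cmod (P \<xi>))\<^sup>2))"

lemma orbit_map_measurable: "\<xi> \<in> Ch \<Longrightarrow> (\<lambda>h. \<xi> \<circ> h) \<in> NH \<rightarrow>\<^sub>M lam"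
  by (rule dual_act_measurable) auto

lemma joint_act [measurable]: "(\<lambda>p. fst p \<circ> snd p) \<in> lam \<Otimes>\<^sub>M dh \<rightarrow>\<^sub>M lam"
  by (rule dual_act_measurable) measurable

lemma V_measurable [measurable]:
  assumes u [measurable]: "u \<in> borel_measurable lam" shows "V u \<in> borel_measurable lam"
proof -
  have "(\<lambda>(\<xi>, h). u (\<xi> \<circ> h)) \<in> borel_measurable (lam \<Otimes>\<^sub>M dh)"
    unfolding split_beta' using measurable_compose[OF joint_act u] .
  from dh.borel_measurable_nn_integral[OF this] show ?thesis by (simp add: V_def[abs_def])
qed

lemma W_measurable [measurable]:
  assumes [measurable]: "P \<in> borel_measurable lam" shows "W P \<in> borel_measurable lam"
  unfolding W_def by (rule V_measurable) measurable

text \<open>The dual action is a right action,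
  \<open>(\<xi> \<circ> g) \<circ> h = \<xi> \<circ> (g \<circ> h)\<close>, which is why left Haar
  measure is the one that makes \<open>V\<close> constant on orbits.\<close>

lemma V_invariant:
  assumes u [measurable]: "u \<in> borel_measurable lam" and \<xi>: "\<xi> \<in> Ch" and g: "g \<in> HH"
  shows "V u (\<xi> \<circ> g) = V u \<xi>"
proof -
  have m: "(\<lambda>h. u (\<xi> \<circ> h)) \<in> borel_measurable NH"
    using measurable_compose[OF orbit_map_measurable[OF \<xi>] u] .
  show ?thesis
    using H.nn_integral_left_inv[OF left_inv_dh, of g, OF _ m] g by (simp add: V_def comp_assoc)
qed

lemma W_invariant:
  assumes [measurable]: "P \<in> borel_measurable lam" and "\<xi> \<in> Ch" "g \<in> HH"
  shows "W P (\<xi> \<circ> g) = W P \<xi>"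
  unfolding W_def by (rule V_invariant[OF _ assms(2,3)]) measurable

text \<open>The exchange puts \<open>\<xi>\<close> inside, so that for each fixed \<open>h\<close>
  Plancherel's formula or the substitution \<open>\<xi> \<mapsto> \<xi> \<circ> h\<close> can be
  applied.\<close>

lemma nn_integral_mult_V:
  assumes [measurable]: "v \<in> borel_measurable lam" "u \<in> borel_measurable lam"
  shows "(\<integral>\<^sup>+\<xi>. v \<xi> * V u \<xi> \<partial>lam) = (\<integral>\<^sup>+h. (\<integral>\<^sup>+\<xi>. v \<xi> * u (\<xi> \<circ> h) \<partial>lam) \<partial>dh)"
proof -
  interpret LH: pair_sigma_finite lam dh ..
  have "(\<integral>\<^sup>+\<xi>. v \<xi> * V u \<xi> \<partial>lam) = (\<integral>\<^sup>+\<xi>. (\<integral>\<^sup>+h. v \<xi> * u (\<xi> \<circ> h) \<partial>dh) \<partial>lam)"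
  proof (rule nn_integral_cong)
    fix \<xi> assume "\<xi> \<in> space lam"
    then have "(\<lambda>h. u (\<xi> \<circ> h)) \<in> borel_measurable dh"
      using measurable_compose[OF orbit_map_measurable, of \<xi> u borel] by simp
    then show "v \<xi> * V u \<xi> = (\<integral>\<^sup>+h. v \<xi> * u (\<xi> \<circ> h) \<partial>dh)"
      unfolding V_def by (rule nn_integral_cmult[symmetric])
  qed
  also have "\<dots> = (\<integral>\<^sup>+h. (\<integral>\<^sup>+\<xi>. v \<xi> * u (\<xi> \<circ> h) \<partial>lam) \<partial>dh)"
  proof (rule LH.Fubini'[symmetric])
    have "(\<lambda>p. u (fst p \<circ> snd p)) \<in> borel_measurable (lam \<Otimes>\<^sub>M dh)"
      by (rule measurable_compose[OF joint_act]) measurable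
    then show "(\<lambda>(\<xi>, h). v \<xi> * u (\<xi> \<circ> h)) \<in> borel_measurable (lam \<Otimes>\<^sub>M dh)"
      unfolding split_beta' by measurable
  qed
  finally show ?thesis .
qed

text \<open>For fixed \<open>h\<close> the coefficient is, up to a constant, the inverse transform
  of \<open>F \<xi> * cnj (P (\<xi> \<circ> h))\<close>. The constant combines
  \<open>delta dx h\<close> to the power \<open>-1/2\<close> from the representation with
  \<open>delta dx h\<close> from the dilated transform.\<close>

lemma coeff_map_eq:
  assumes f: "FT f F" and p: "FT \<psi> P" and h: "h \<in> HH"
  shows "coeff_map dx \<psi> f (a, h)
    = complex_of_real (sqrt (delta dx h)) * (\<integral>\<xi>. F \<xi> * cnj (P (\<xi> \<circ> h)) * \<xi> a \<partial>lam)"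
proof -
  define d where "d = delta dx h"
  have d: "0 < d" unfolding d_def by (rule delta_pos[OF h])
  let ?c = "complex_of_real (d powr (-1/2))"
  have q: "FT (quasi_reg dx a h \<psi>) (\<lambda>\<xi>. ?c * (cnj (\<xi> a) * (complex_of_real d * P (\<xi> \<circ> h))))"
    using FT_cmult[OF FT_translate[OF FT_inv[OF h p]], of ?c a] by (simp add: quasi_reg_def[abs_def] d_def)
  have "d powr (-1/2) * d = d powr (-1/2) * d powr 1" using d by simp
  also have "\<dots> = d powr (1/2)" unfolding powr_add[symmetric] by simp
  also have "\<dots> = sqrt d" using d by (simp add: powr_half_sqrt)
  finally have cd: "?c * complex_of_real d = complex_of_real (sqrt d)" by (simp only: of_real_mult[symmetric])
  have "coeff_map dx \<psi> f (a, h) = ip dx f (quasi_reg dx a h \<psi>)" by (simp add: coeff_map_def ip_def)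
  also have "\<dots> = ip lam F (\<lambda>\<xi>. ?c * (cnj (\<xi> a) * (complex_of_real d * P (\<xi> \<circ> h))))" by (rule FT_ip[OF f q])
  also have "\<dots> = (\<integral>\<xi>. (?c * complex_of_real d) * (F \<xi> * cnj (P (\<xi> \<circ> h)) * \<xi> a) \<partial>lam)"
    unfolding ip_def by (intro Bochner_Integration.integral_cong refl) simp
  also have "\<dots> = complex_of_real (sqrt d) * (\<integral>\<xi>. F \<xi> * cnj (P (\<xi> \<circ> h)) * \<xi> a \<partial>lam)"
    unfolding cd by simp
  finally show ?thesis unfolding d_def .
qed

lemma sets_haar_G [simp, measurable_cong]: "sets (haar_G dx dh) = sets (dx \<Otimes>\<^sub>M dh)"
  by (simp add: haar_G_def)

lemma coeff_map_measurable:
  assumes f: "f \<in> L2 dx" and p: "\<psi> \<in> L2 dx"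
  shows "coeff_map dx \<psi> f \<in> borel_measurable (dx \<Otimes>\<^sub>M dh)"
proof -
  interpret A: measurable_group "borel :: 'a measure" "(+)" uminus 0 by (rule A_group)
  have [measurable]: "f \<in> borel_measurable borel" "\<psi> \<in> borel_measurable borel"
    using L2_measurable[OF f] L2_measurable[OF p] by simp_all
  let ?M = "(dx \<Otimes>\<^sub>M dh) \<Otimes>\<^sub>M dx"
  have m1: "(\<lambda>q. snd q + - fst (fst q)) \<in> ?M \<rightarrow>\<^sub>M (borel :: 'a measure)" by measurable
  have m2: "(\<lambda>q. snd (fst q)) \<in> ?M \<rightarrow>\<^sub>M NH" by measurable
  from inverse_act_measurable[OF m2 m1]
  have m3 [measurable]: "(\<lambda>q. inv (snd (fst q)) (snd q - fst (fst q))) \<in> ?M \<rightarrow>\<^sub>M (borel :: 'a measure)" by simp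
  have m4 [measurable]: "(\<lambda>q. delta dx (snd (fst q))) \<in> borel_measurable ?M"
    using measurable_compose[OF m2 delta_measurable] .
  have "(\<lambda>(q, t). f t * cnj (quasi_reg dx (fst q) (snd q) \<psi> t)) \<in> borel_measurable ?M"
    unfolding split_beta' quasi_reg_def by measurable
  from dx.borel_measurable_lebesgue_integral[OF this]
  show ?thesis unfolding coeff_map_def by (simp add: split_beta')
qed

text \<open>The Calderon identity: by the Fourier inversion formula and Plancherel's theorem in the variable
  of \<open>A\<close>, the norm of the wavelet transform is a weighted norm of the Fourier transform.\<close>
lemma calderon:
  assumes f: "FT f F" and p: "FT \<psi> P"
    and fin: "AE h in dh. (\<integral>\<^sup>+\<xi>. ennreal ((cmod (F \<xi>))\<^sup>2) * ennreal ((cmod (P (\<xi> \<circ> h)))\<^sup>2) \<partial>lam) < \<infinity>"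
  shows "L2norm_sq (haar_G dx dh) (coeff_map dx \<psi> f) = (\<integral>\<^sup>+\<xi>. ennreal ((cmod (F \<xi>))\<^sup>2) * W P \<xi> \<partial>lam)"
proof -
  interpret AH: pair_sigma_finite dx dh ..
  note cm [measurable] = coeff_map_measurable[OF FT_L2(1)[OF f] FT_L2(1)[OF p]]
  note [measurable] = L2_measurable[OF FT_L2(2)[OF f]] L2_measurable[OF FT_L2(2)[OF p]]
  have dm [measurable]: "(\<lambda>q. delta dx (snd q)) \<in> borel_measurable (dx \<Otimes>\<^sub>M dh)"
    by (rule measurable_compose[OF _ delta_measurable]) measurable
  have inner: "(\<integral>\<^sup>+a. ennreal (1 / delta dx h) * ennreal ((cmod (coeff_map dx \<psi> f (a, h)))\<^sup>2) \<partial>dx)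
      = (\<integral>\<^sup>+\<xi>. ennreal ((cmod (F \<xi>))\<^sup>2) * ennreal ((cmod (P (\<xi> \<circ> h)))\<^sup>2) \<partial>lam)"
    if h: "h \<in> HH" and fin: "(\<integral>\<^sup>+\<xi>. ennreal ((cmod (F \<xi>))\<^sup>2) * ennreal ((cmod (P (\<xi> \<circ> h)))\<^sup>2) \<partial>lam) < \<infinity>" for h
  proof -
    note [measurable] = dual_act_const[OF h]
    define G where "G \<xi> = F \<xi> * cnj (P (\<xi> \<circ> h))" for \<xi>
    \<comment> \<open>A product of two square-integrable functions is integrable, so the inversion
      formula applies. The hypothesis on \<open>h\<close> adds that \<open>G\<close> is
      square-integrable and hence a transform.\<close>
    have G_int: "integrable lam G"
      unfolding G_def by (rule L2_prod_integrable(2)[OF FT_L2(2)[OF f] L2_dual_act(1)[OF h FT_L2(2)[OF p]]])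
    have G_meas [measurable]: "G \<in> borel_measurable lam" unfolding G_def by measurable
    have Gn: "L2norm_sq lam G = (\<integral>\<^sup>+\<xi>. ennreal ((cmod (F \<xi>))\<^sup>2) * ennreal ((cmod (P (\<xi> \<circ> h)))\<^sup>2) \<partial>lam)"
      unfolding L2norm_sq_def G_def by (simp add: norm_mult power_mult_distrib ennreal_mult)
    have GL: "G \<in> L2 lam" using fin by (subst L2_iff) (simp_all add: Gn)
    obtain g where g: "FT g G" using FT_surj[OF GL] by blast
    have [measurable]: "g \<in> borel_measurable dx" by (rule L2_measurable[OF FT_L2(1)[OF g]])
    define d where "d = delta dx h"
    have d: "0 < d" unfolding d_def by (rule delta_pos[OF h])
    have "(\<integral>\<^sup>+a. ennreal (1 / d) * ennreal ((cmod (coeff_map dx \<psi> f (a, h)))\<^sup>2) \<partial>dx)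
        = (\<integral>\<^sup>+a. ennreal ((cmod (g a))\<^sup>2) \<partial>dx)"
    proof (rule nn_integral_cong_AE, rule AE_mp[OF FT_inverse[OF g G_int]], intro AE_I2 impI)
      fix a assume a: "g a = (\<integral>\<xi>. G \<xi> * \<xi> a \<partial>lam)"
      \<comment> \<open>The square of \<open>sqrt d\<close> that appears here is cancelled by the
        density \<open>1 / d\<close> of Haar measure on \<open>G\<close>.\<close>
      have "coeff_map dx \<psi> f (a, h) = complex_of_real (sqrt d) * g a"
        unfolding coeff_map_eq[OF f p h] a G_def d_def ..
      then have "(cmod (coeff_map dx \<psi> f (a, h)))\<^sup>2 = d * (cmod (g a))\<^sup>2"
        using d by (simp add: norm_mult power_mult_distrib)
      then show "ennreal (1 / d) * ennreal ((cmod (coeff_map dx \<psi> f (a, h)))\<^sup>2) = ennreal ((cmod (g a))\<^sup>2)"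
        using d by (simp add: ennreal_mult[symmetric])
    qed
    also have "\<dots> = L2norm_sq dx g" by (simp add: L2norm_sq_def)
    also have "\<dots> = L2norm_sq lam G"
      by (simp add: L2norm_sq_eq[OF FT_L2(1)[OF g]] L2norm_sq_eq[OF GL] FT_isometry[OF g])
    finally show ?thesis unfolding Gn d_def .
  qed
  have "L2norm_sq (haar_G dx dh) (coeff_map dx \<psi> f)
      = (\<integral>\<^sup>+q. ennreal (1 / delta dx (snd q)) * ennreal ((cmod (coeff_map dx \<psi> f q))\<^sup>2) \<partial>(dx \<Otimes>\<^sub>M dh))"
    unfolding L2norm_sq_def haar_G_def split_beta' by (rule nn_integral_density) measurable
  also have "\<dots> = (\<integral>\<^sup>+h. (\<integral>\<^sup>+a. ennreal (1 / delta dx h) * ennreal ((cmod (coeff_map dx \<psi> f (a, h)))\<^sup>2) \<partial>dx) \<partial>dh)"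
    by (subst AH.nn_integral_snd[symmetric]) simp_all
  also have "\<dots> = (\<integral>\<^sup>+h. (\<integral>\<^sup>+\<xi>. ennreal ((cmod (F \<xi>))\<^sup>2) * ennreal ((cmod (P (\<xi> \<circ> h)))\<^sup>2) \<partial>lam) \<partial>dh)"
    by (rule nn_integral_cong_AE, rule AE_mp[OF fin]) (auto intro!: AE_I2 inner)
  also have "\<dots> = (\<integral>\<^sup>+\<xi>. ennreal ((cmod (F \<xi>))\<^sup>2) * W P \<xi> \<partial>lam)"
    unfolding W_def by (rule nn_integral_mult_V[symmetric]) measurable
  finally show ?thesis .
qed

text \<open>An indicator is bounded, so the finiteness condition of \<open>calderon\<close> holds
  for every \<open>h\<close>, whatever \<open>W P\<close> may be. Sets of finite measure inside
  \<open>X\<close> are then enough to determine \<open>W P\<close> almost everywhere on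
  \<open>X\<close>.\<close>

lemma test_function:
  assumes p: "FT \<psi> P" and B: "B \<in> sets lam" "B \<subseteq> X" "emeasure lam B < \<infinity>"
  obtains f where "f \<in> HX dx lam X" "L2norm_sq dx f = emeasure lam B"
    "L2norm_sq (haar_G dx dh) (coeff_map dx \<psi> f) = (\<integral>\<^sup>+\<xi>. indicator B \<xi> * W P \<xi> \<partial>lam)"
proof -
  obtain f where f: "FT f (indicator B)" using FT_surj[OF indicator_L2(1)[OF B(1,3)]] by blast
  have sq: "ennreal ((cmod (indicator B \<xi>))\<^sup>2) = indicator B \<xi>" for \<xi> by (auto split: split_indicator)
  show thesis
  proof (rule that[of f])
    show "f \<in> HX dx lam X" unfolding HX_iff using f B(2) by (intro exI[of _ "indicator B"]) (auto split: split_indicator)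
    have "L2norm_sq dx f = L2norm_sq lam (indicator B)"
      by (simp add: L2norm_sq_eq[OF FT_L2(1)[OF f]] L2norm_sq_eq[OF FT_L2(2)[OF f]] FT_isometry[OF f])
    then show "L2norm_sq dx f = emeasure lam B" by (simp add: indicator_L2(2)[OF B(1,3)])
    have "(\<integral>\<^sup>+\<xi>. ennreal ((cmod (indicator B \<xi>))\<^sup>2) * ennreal ((cmod (P (\<xi> \<circ> h)))\<^sup>2) \<partial>lam) < \<infinity>" if h: "h \<in> HH" for h
    proof -
      have "(\<integral>\<^sup>+\<xi>. ennreal ((cmod (indicator B \<xi>))\<^sup>2) * ennreal ((cmod (P (\<xi> \<circ> h)))\<^sup>2) \<partial>lam)
          \<le> L2norm_sq lam (\<lambda>\<xi>. P (\<xi> \<circ> h))"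
        unfolding L2norm_sq_def by (rule nn_integral_mono) (auto split: split_indicator)
      also have "\<dots> < \<infinity>" by (simp add: L2norm_sq_eq[OF L2_dual_act(1)[OF h FT_L2(2)[OF p]]])
      finally show ?thesis .
    qed
    then have "AE h in dh. (\<integral>\<^sup>+\<xi>. ennreal ((cmod (indicator B \<xi>))\<^sup>2) * ennreal ((cmod (P (\<xi> \<circ> h)))\<^sup>2) \<partial>lam) < \<infinity>"
      by (intro AE_I2) simp
    from calderon[OF f p this] show "L2norm_sq (haar_G dx dh) (coeff_map dx \<psi> f) = (\<integral>\<^sup>+\<xi>. indicator B \<xi> * W P \<xi> \<partial>lam)"
      unfolding sq .
  qed
qed

lemma admissible_imp_W:
  assumes "admissible dx dh (HX dx lam X) \<psi>"
  obtains P where "P \<in> L2 lam" "AE \<xi> in lam. \<xi> \<in> X \<longrightarrow> W P \<xi> = 1"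
proof -
  have "\<psi> \<in> HX dx lam X" and adm: "\<And>f. f \<in> HX dx lam X \<Longrightarrow>
      L2norm_sq (haar_G dx dh) (coeff_map dx \<psi> f) = L2norm_sq dx f"
    using assms by (auto simp: admissible_def)
  then obtain P where p: "FT \<psi> P" unfolding HX_iff by blast
  have PL: "P \<in> L2 lam" by (rule FT_L2(2)[OF p])
  note [measurable] = L2_measurable[OF PL] X_borel
  have eq: "(\<integral>\<^sup>+\<xi>. indicator B \<xi> * W P \<xi> \<partial>lam) = (\<integral>\<^sup>+\<xi>. indicator B \<xi> * 1 \<partial>lam)"
    if B: "B \<in> sets lam" "B \<subseteq> X" "emeasure lam B < \<infinity>" for B
  proof -
    obtain f where f: "f \<in> HX dx lam X" "L2norm_sq dx f = emeasure lam B"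
      "L2norm_sq (haar_G dx dh) (coeff_map dx \<psi> f) = (\<integral>\<^sup>+\<xi>. indicator B \<xi> * W P \<xi> \<partial>lam)"
      by (rule test_function[OF p B])
    show ?thesis using adm[OF f(1)] f B(1) by simp
  qed
  have "AE \<xi> in lam. \<xi> \<in> X \<longrightarrow> W P \<xi> \<le> 1"
    by (rule lam.AE_le_of_integral_le[where c = 1]) (auto simp: eq)
  \<comment> \<open>Here \<open>W P\<close> takes the place of the bounded function: it is below 1
    wherever the inequality fails.\<close>
  moreover have "AE \<xi> in lam. \<xi> \<in> X \<longrightarrow> 1 \<le> W P \<xi>"
    by (rule lam.AE_le_of_integral_le[where c = 1]) (auto simp: eq)
  ultimately have "AE \<xi> in lam. \<xi> \<in> X \<longrightarrow> W P \<xi> = 1" by eventually_elim auto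
  with PL show thesis by (rule that)
qed

text \<open>For a general \<open>F\<close> the finiteness condition of \<open>calderon\<close> may
  fail for some \<open>h\<close>. Integrated over \<open>H\<close>, however, the inner integrals
  give the squared norm of \<open>F\<close>, so they are finite for almost all
  \<open>h\<close>.\<close>

lemma W_imp_admissible:
  assumes P: "P \<in> L2 lam" and off: "AE \<xi> in lam. \<xi> \<notin> X \<longrightarrow> P \<xi> = 0"
    and W1: "AE \<xi> in lam. \<xi> \<in> X \<longrightarrow> W P \<xi> = 1"
  shows "\<exists>\<psi>. admissible dx dh (HX dx lam X) \<psi>"
proof -
  obtain \<psi> where p: "FT \<psi> P" using FT_surj[OF P] by blast
  note [measurable] = L2_measurable[OF P]
  have \<psi>: "\<psi> \<in> HX dx lam X" unfolding HX_iff using p off by blast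
  have n: "L2norm_sq (haar_G dx dh) (coeff_map dx \<psi> f) = L2norm_sq dx f" if fH: "f \<in> HX dx lam X" for f
  proof -
    obtain F where f: "FT f F" and F: "AE \<xi> in lam. \<xi> \<notin> X \<longrightarrow> F \<xi> = 0" using fH unfolding HX_iff by blast
    have [measurable]: "F \<in> borel_measurable lam" by (rule L2_measurable[OF FT_L2(2)[OF f]])
    have e: "(\<integral>\<^sup>+\<xi>. ennreal ((cmod (F \<xi>))\<^sup>2) * W P \<xi> \<partial>lam) = L2norm_sq lam F"
      unfolding L2norm_sq_def
    proof (rule nn_integral_cong_AE)
      show "AE \<xi> in lam. ennreal ((cmod (F \<xi>))\<^sup>2) * W P \<xi> = ennreal ((cmod (F \<xi>))\<^sup>2)"
        using F W1 by eventually_elim auto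
    qed
    have fin: "L2norm_sq lam F < \<infinity>" by (simp add: L2norm_sq_eq[OF FT_L2(2)[OF f]])
    have "(\<integral>\<^sup>+h. (\<integral>\<^sup>+\<xi>. ennreal ((cmod (F \<xi>))\<^sup>2) * ennreal ((cmod (P (\<xi> \<circ> h)))\<^sup>2) \<partial>lam) \<partial>dh)
        = (\<integral>\<^sup>+\<xi>. ennreal ((cmod (F \<xi>))\<^sup>2) * W P \<xi> \<partial>lam)"
      unfolding W_def by (rule nn_integral_mult_V[symmetric]) measurable
    then have fin': "(\<integral>\<^sup>+h. (\<integral>\<^sup>+\<xi>. ennreal ((cmod (F \<xi>))\<^sup>2) * ennreal ((cmod (P (\<xi> \<circ> h)))\<^sup>2) \<partial>lam) \<partial>dh) \<noteq> \<infinity>"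
      using e fin by simp
    have m: "(\<lambda>h. \<integral>\<^sup>+\<xi>. ennreal ((cmod (F \<xi>))\<^sup>2) * ennreal ((cmod (P (\<xi> \<circ> h)))\<^sup>2) \<partial>lam) \<in> borel_measurable dh"
    proof -
      have a: "(\<lambda>q. snd q \<circ> fst q) \<in> dh \<Otimes>\<^sub>M lam \<rightarrow>\<^sub>M lam" by (rule dual_act_measurable) measurable
      have [measurable]: "(\<lambda>q. P (snd q \<circ> fst q)) \<in> borel_measurable (dh \<Otimes>\<^sub>M lam)"
        by (rule measurable_compose[OF a]) measurable
      have "(\<lambda>(h, \<xi>). ennreal ((cmod (F \<xi>))\<^sup>2) * ennreal ((cmod (P (\<xi> \<circ> h)))\<^sup>2)) \<in> borel_measurable (dh \<Otimes>\<^sub>M lam)"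
        unfolding split_beta' by measurable
      from lam.borel_measurable_nn_integral[OF this] show ?thesis by simp
    qed
    have "AE h in dh. (\<integral>\<^sup>+\<xi>. ennreal ((cmod (F \<xi>))\<^sup>2) * ennreal ((cmod (P (\<xi> \<circ> h)))\<^sup>2) \<partial>lam) < \<infinity>"
      using nn_integral_PInf_AE[OF m fin'] by eventually_elim (simp add: less_top)
    from calderon[OF f p this] e show ?thesis
      by (simp add: L2norm_sq_eq[OF FT_L2(1)[OF f]] L2norm_sq_eq[OF FT_L2(2)[OF f]] FT_isometry[OF f])
  qed
  have "coeff_map dx \<psi> f \<in> L2 (haar_G dx dh)" if f: "f \<in> HX dx lam X" for f
  proof -
    have fL: "f \<in> L2 dx" using f by (simp add: HX_def)
    have "coeff_map dx \<psi> f \<in> borel_measurable (haar_G dx dh)"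
      using coeff_map_measurable[OF fL FT_L2(1)[OF p]] by (simp cong: measurable_cong_sets)
    then show ?thesis using n[OF f] by (subst L2_iff) (auto simp: L2norm_sq_eq[OF fL])
  qed
  with \<psi> n show ?thesis unfolding admissible_def by blast
qed

section \<open>Injectivity and positivity of the Calderon function\<close>

lemma coeff_map_diff:
  assumes f: "f \<in> L2 dx" and g: "g \<in> L2 dx" and p: "\<psi> \<in> L2 dx" and h: "h \<in> HH"
  shows "coeff_map dx \<psi> (\<lambda>x. f x - g x) (a, h) = coeff_map dx \<psi> f (a, h) - coeff_map dx \<psi> g (a, h)"
proof -
  have "quasi_reg dx a h \<psi> \<in> L2 dx"
    unfolding quasi_reg_def[abs_def] by (intro L2_cmult L2_translate(1) L2_inv(1)[OF h p])
  from ip_diff_left[OF f g this] show ?thesis by (simp add: coeff_map_def ip_def)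
qed

lemma HX_diff: "f \<in> HX dx lam X \<Longrightarrow> g \<in> HX dx lam X \<Longrightarrow> (\<lambda>x. f x - g x) \<in> HX dx lam X"
proof -
  assume "f \<in> HX dx lam X" "g \<in> HX dx lam X"
  then obtain F G where FG: "FT f F" "FT g G" "AE \<xi> in lam. \<xi> \<notin> X \<longrightarrow> F \<xi> = 0" "AE \<xi> in lam. \<xi> \<notin> X \<longrightarrow> G \<xi> = 0"
    unfolding HX_iff by blast
  from FG(3,4) have "AE \<xi> in lam. \<xi> \<notin> X \<longrightarrow> F \<xi> - G \<xi> = 0" by eventually_elim auto
  with FT_diff[OF FG(1,2)] show ?thesis unfolding HX_iff by blast
qed

lemma L2norm_sq_eq_0_iff: "f \<in> borel_measurable M \<Longrightarrow> L2norm_sq M f = 0 \<longleftrightarrow> (AE x in M. f x = 0)"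
  unfolding L2norm_sq_def by (subst nn_integral_0_iff_AE) auto

lemma AE_haar_G_HH: "AE p in haar_G dx dh. snd p \<in> HH"
  by (rule AE_I2) (auto simp: haar_G_def space_pair_measure)

text \<open>By linearity of the coefficient map, injectivity amounts to the trivial kernel of an
  isometry.\<close>

lemma admissible_imp_weakly_admissible:
  assumes a: "admissible dx dh (HX dx lam X) \<psi>"
  shows "weakly_admissible dx dh (HX dx lam X) \<psi>"
  unfolding weakly_admissible_def
proof (intro conjI ballI impI)
  have n: "\<And>f. f \<in> HX dx lam X \<Longrightarrow> L2norm_sq (haar_G dx dh) (coeff_map dx \<psi> f) = L2norm_sq dx f"
    and cL: "\<And>f. f \<in> HX dx lam X \<Longrightarrow> coeff_map dx \<psi> f \<in> L2 (haar_G dx dh)"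
    and pH: "\<psi> \<in> HX dx lam X"
    using a by (auto simp: admissible_def)
  show "\<psi> \<in> HX dx lam X" by (rule pH)
  show "coeff_map dx \<psi> f \<in> L2 (haar_G dx dh)" if "f \<in> HX dx lam X" for f by (rule cL[OF that])
  show "\<exists>C. \<forall>f\<in>HX dx lam X. L2norm_sq (haar_G dx dh) (coeff_map dx \<psi> f) \<le> ennreal C * L2norm_sq dx f"
    by (rule exI[of _ 1]) (simp add: n)
  fix f g assume f: "f \<in> HX dx lam X" and g: "g \<in> HX dx lam X"
    and eq: "AE p in haar_G dx dh. coeff_map dx \<psi> f p = coeff_map dx \<psi> g p"
  have L: "f \<in> L2 dx" "g \<in> L2 dx" "\<psi> \<in> L2 dx" using f g pH by (auto simp: HX_def)
  let ?d = "\<lambda>x. f x - g x"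
  have dH: "?d \<in> HX dx lam X" by (rule HX_diff[OF f g])
  have "AE p in haar_G dx dh. coeff_map dx \<psi> ?d p = 0"
    using eq AE_haar_G_HH
  proof eventually_elim
    case (elim p)
    then show ?case using coeff_map_diff[OF L, of "snd p" "fst p"] by simp
  qed
  then have "L2norm_sq (haar_G dx dh) (coeff_map dx \<psi> ?d) = 0"
    using L2_measurable[OF cL[OF dH]] by (subst L2norm_sq_eq_0_iff) auto
  then have "L2norm_sq dx ?d = 0" using n[OF dH] by simp
  then have "AE x in dx. ?d x = 0" using L2_measurable[OF L2_diff[OF L(1,2)]] by (subst (asm) L2norm_sq_eq_0_iff) auto
  then show "AE x in dx. f x = g x" by eventually_elim simp
qed

text \<open>Boundedness caps \<open>W P\<close> by the constant \<open>C\<close>. Injectivity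
  prevents zeros: a function whose transform is an indicator supported where \<open>W P = 0\<close>
  has vanishing wavelet transform, so it is a null function and the support is null.\<close>

lemma weakly_admissible_imp_W:
  assumes wa: "weakly_admissible dx dh (HX dx lam X) \<psi>"
  obtains P where "P \<in> L2 lam" "AE \<xi> in lam. \<xi> \<in> X \<longrightarrow> 0 < W P \<xi> \<and> W P \<xi> < \<infinity>"
proof -
  obtain C where pH: "\<psi> \<in> HX dx lam X"
    and bd: "\<And>f. f \<in> HX dx lam X \<Longrightarrow> L2norm_sq (haar_G dx dh) (coeff_map dx \<psi> f) \<le> ennreal C * L2norm_sq dx f"
    and cL: "\<And>f. f \<in> HX dx lam X \<Longrightarrow> coeff_map dx \<psi> f \<in> L2 (haar_G dx dh)"
    and inj: "\<And>f g. f \<in> HX dx lam X \<Longrightarrow> g \<in> HX dx lam X \<Longrightarrow>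
      AE p in haar_G dx dh. coeff_map dx \<psi> f p = coeff_map dx \<psi> g p \<Longrightarrow> AE x in dx. f x = g x"
    using wa unfolding weakly_admissible_def by blast
  obtain P where p: "FT \<psi> P" using pH unfolding HX_iff by blast
  have PL: "P \<in> L2 lam" by (rule FT_L2(2)[OF p])
  note [measurable] = L2_measurable[OF PL] X_borel
  have "AE \<xi> in lam. \<xi> \<in> X \<longrightarrow> W P \<xi> \<le> ennreal C"
  proof (rule lam.AE_le_of_integral_le[where c = "ennreal C"])
    fix B assume B: "B \<in> sets lam" "B \<subseteq> X" "emeasure lam B < \<infinity>"
    obtain f where f: "f \<in> HX dx lam X" "L2norm_sq dx f = emeasure lam B"
      "L2norm_sq (haar_G dx dh) (coeff_map dx \<psi> f) = (\<integral>\<^sup>+\<xi>. indicator B \<xi> * W P \<xi> \<partial>lam)"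
      by (rule test_function[OF p B])
    have "(\<integral>\<^sup>+\<xi>. indicator B \<xi> * ennreal C \<partial>lam) = ennreal C * emeasure lam B"
      using nn_integral_cmult_indicator[OF B(1), of "ennreal C"] by (simp add: mult.commute)
    then show "(\<integral>\<^sup>+\<xi>. indicator B \<xi> * W P \<xi> \<partial>lam) \<le> (\<integral>\<^sup>+\<xi>. indicator B \<xi> * ennreal C \<partial>lam)"
      using bd[OF f(1)] f by simp
  qed auto
  \<comment> \<open>The failure of positivity is encoded as the indicator of
    \<open>W P \<xi> = 0\<close>, so that the comparison lemma used for the upper bound shows it to
    vanish.\<close>
  moreover have "AE \<xi> in lam. \<xi> \<in> X \<longrightarrow> (if W P \<xi> = 0 then 1 else 0) \<le> (0 :: ennreal)"
  proof (rule lam.AE_le_of_integral_le[where c = 0])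
    fix B assume B [measurable]: "B \<in> sets lam" and BX: "B \<subseteq> X" and Bf: "emeasure lam B < \<infinity>"
    define D where "D = {\<xi> \<in> space lam. \<xi> \<in> B \<and> W P \<xi> = 0}"
    have D [measurable]: "D \<in> sets lam" unfolding D_def by measurable
    have "emeasure lam D \<le> emeasure lam B" by (intro emeasure_mono) (auto simp: D_def)
    then have Df: "emeasure lam D < \<infinity>" using Bf by (rule le_less_trans)
    have DX: "D \<subseteq> X" using BX by (auto simp: D_def)
    obtain f where f: "f \<in> HX dx lam X" "L2norm_sq dx f = emeasure lam D"
      "L2norm_sq (haar_G dx dh) (coeff_map dx \<psi> f) = (\<integral>\<^sup>+\<xi>. indicator D \<xi> * W P \<xi> \<partial>lam)"
      by (rule test_function[OF p D DX Df])
    have fL: "f \<in> L2 dx" using f(1) by (simp add: HX_def)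
    have "(\<integral>\<^sup>+\<xi>. indicator D \<xi> * W P \<xi> \<partial>lam) = (\<integral>\<^sup>+\<xi>. 0 \<partial>lam)"
      by (intro nn_integral_cong) (auto simp: D_def split: split_indicator)
    then have "L2norm_sq (haar_G dx dh) (coeff_map dx \<psi> f) = 0" using f(3) by simp
    then have "AE q in haar_G dx dh. coeff_map dx \<psi> f q = 0"
      using L2_measurable[OF cL[OF f(1)]] by (subst (asm) L2norm_sq_eq_0_iff) auto
    \<comment> \<open>The zero function is written as \<open>f - f\<close>, whose membership in the
      subspace is an instance of \<open>HX_diff\<close>.\<close>
    moreover have "coeff_map dx \<psi> (\<lambda>x. f x - f x) q = 0" for q
      by (simp add: coeff_map_def split: prod.split)
    ultimately have "AE q in haar_G dx dh. coeff_map dx \<psi> f q = coeff_map dx \<psi> (\<lambda>x. f x - f x) q" by simp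
    from inj[OF f(1) HX_diff[OF f(1) f(1)] this] have "AE x in dx. f x = 0" by simp
    then have "L2norm_sq dx f = 0" using L2_measurable[OF fL] by (subst L2norm_sq_eq_0_iff) auto
    then have "emeasure lam D = 0" using f(2) by simp
    moreover have "(\<integral>\<^sup>+\<xi>. indicator B \<xi> * (if W P \<xi> = 0 then 1 else 0) \<partial>lam) = (\<integral>\<^sup>+\<xi>. indicator D \<xi> \<partial>lam)"
      by (intro nn_integral_cong) (auto simp: D_def split: split_indicator)
    ultimately show "(\<integral>\<^sup>+\<xi>. indicator B \<xi> * (if W P \<xi> = 0 then 1 else 0) \<partial>lam) \<le> (\<integral>\<^sup>+\<xi>. indicator B \<xi> * 0 \<partial>lam)"
      by simp
  qed auto
  ultimately have "AE \<xi> in lam. \<xi> \<in> X \<longrightarrow> 0 < W P \<xi> \<and> W P \<xi> < \<infinity>"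
  proof eventually_elim
    case (elim \<xi>)
    show ?case
    proof
      assume x: "\<xi> \<in> X"
      have "W P \<xi> \<noteq> 0" using elim(2) x by (auto split: if_splits)
      moreover have "W P \<xi> < \<infinity>" using elim(1) x by (auto intro: le_less_trans)
      ultimately show "0 < W P \<xi> \<and> W P \<xi> < \<infinity>" by (simp add: zero_less_iff_neq_zero)
    qed
  qed
  with PL show thesis by (rule that)
qed

subsection \<open>Normalizing the Calderon function\<close>

text \<open>An invariant set, so that division by \<open>W P\<close> is legitimate along whole
  orbits. The normalized function then has Calderon function 1 at every point of the set and 0 at
  all other characters; evaluation at orbit representatives relies on this holding
  everywhere.\<close>

definition good :: "(('a \<Rightarrow> complex) \<Rightarrow> complex) \<Rightarrow> ('a \<Rightarrow> complex) set" where
  "good P = {\<xi> \<in> Ch. \<xi> \<in> X \<and> 0 < W P \<xi> \<and> W P \<xi> < \<infinity>}"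

definition normalized :: "(('a \<Rightarrow> complex) \<Rightarrow> complex) \<Rightarrow> ('a \<Rightarrow> complex) \<Rightarrow> complex" where
  "normalized P \<xi> = indicator (good P) \<xi> * P \<xi> / complex_of_real (sqrt (enn2real (W P \<xi>)))"

lemma good_sets [measurable]:
  assumes [measurable]: "P \<in> borel_measurable lam" shows "good P \<in> sets lam"
proof -
  note [measurable] = X_borel
  have "{\<xi> \<in> space lam. \<xi> \<in> X \<and> 0 < W P \<xi> \<and> W P \<xi> < \<infinity>} \<in> sets lam" by measurable
  then show ?thesis by (simp add: good_def)
qed

lemma good_invariant:
  "P \<in> borel_measurable lam \<Longrightarrow> \<xi> \<in> Ch \<Longrightarrow> h \<in> HH \<Longrightarrow> \<xi> \<circ> h \<in> good P \<longleftrightarrow> \<xi> \<in> good P"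
  by (simp add: good_def W_invariant X_inv_iff comp_Ch)

lemma normalized_measurable [measurable]:
  assumes [measurable]: "P \<in> borel_measurable lam" shows "normalized P \<in> borel_measurable lam"
  unfolding normalized_def by measurable

lemma cmod_normalized:
  assumes "\<xi> \<in> good P"
  shows "(cmod (normalized P \<xi>))\<^sup>2 = (cmod (P \<xi>))\<^sup>2 / enn2real (W P \<xi>)"
  using assms by (simp add: normalized_def norm_divide power_divide)

lemma W_normalized:
  assumes P [measurable]: "P \<in> borel_measurable lam" and \<xi>: "\<xi> \<in> Ch"
  shows "W (normalized P) \<xi> = indicator (good P) \<xi>"
proof (cases "\<xi> \<in> good P")
  case True
  define w where "w = enn2real (W P \<xi>)"
  have w: "W P \<xi> = ennreal w" "0 < w"
    using True unfolding w_def good_def by (auto simp: enn2real_positive_iff)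
  have m: "(\<lambda>h. ennreal ((cmod (P (\<xi> \<circ> h)))\<^sup>2)) \<in> borel_measurable dh"
    using measurable_compose[OF orbit_map_measurable[OF \<xi>], of "\<lambda>\<xi>. ennreal ((cmod (P \<xi>))\<^sup>2)" borel] by simp
  have "W (normalized P) \<xi> = (\<integral>\<^sup>+h. ennreal (1 / w) * ennreal ((cmod (P (\<xi> \<circ> h)))\<^sup>2) \<partial>dh)"
    unfolding W_def V_def
  proof (rule nn_integral_cong)
    fix h assume "h \<in> space dh"
    then have h: "h \<in> HH" by simp
    have "(cmod (normalized P (\<xi> \<circ> h)))\<^sup>2 = (1 / w) * (cmod (P (\<xi> \<circ> h)))\<^sup>2"
      using cmod_normalized[of "\<xi> \<circ> h" P] True by (simp add: good_invariant[OF P \<xi> h] W_invariant[OF P \<xi> h] w_def)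
    then show "ennreal ((cmod (normalized P (\<xi> \<circ> h)))\<^sup>2) = ennreal (1 / w) * ennreal ((cmod (P (\<xi> \<circ> h)))\<^sup>2)"
      using w(2) by (simp only: ennreal_mult[symmetric] zero_le_power2 divide_nonneg_pos zero_le_one)
  qed
  also have "\<dots> = ennreal (1 / w) * W P \<xi>" unfolding W_def V_def by (rule nn_integral_cmult[OF m])
  also have "\<dots> = 1" using w by (simp add: ennreal_mult[symmetric])
  finally show ?thesis using True by simp
next
  case False
  have "W (normalized P) \<xi> = (\<integral>\<^sup>+h. 0 \<partial>dh)"
    unfolding W_def V_def
    by (intro nn_integral_cong) (simp add: normalized_def good_invariant[OF P \<xi>] False)
  then show ?thesis using False by simp
qed

lemma AE_good:
  assumes "AE \<xi> in lam. \<xi> \<in> X \<longrightarrow> 0 < W P \<xi> \<and> W P \<xi> < \<infinity>"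
  shows "AE \<xi> in lam. \<xi> \<in> X \<longrightarrow> \<xi> \<in> good P"
  using assms by eventually_elim (auto simp: good_def dest: subsetD[OF X_subset])

subsection \<open>The non-unimodular case\<close>

text \<open>The ratio is a homomorphism of \<open>H\<close> into the positive reals. If it differs
  from 1 at \<open>k\<close>, it is below 1 at \<open>k\<close> or at \<open>inv k\<close>, and
  powers of that element bring it below any bound.\<close>

lemma small_ratio:
  assumes k: "k \<in> HH" "modular_H dh k / delta dx k \<noteq> 1" and e: "0 < e"
  obtains g where "g \<in> HH" "modular_H dh g / delta dx g < e"
proof -
  define t where "t h = modular_H dh h / delta dx h" for h
  have t_pos: "0 < t h" if "h \<in> HH" for h
    unfolding t_def using modular_H_pos[OF that] delta_pos[OF that] by simp
  have t_comp: "t (g \<circ> h) = t g * t h" if "g \<in> HH" "h \<in> HH" for g h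
    unfolding t_def using that by (simp add: modular_H_comp delta_comp)
  obtain h where h: "h \<in> HH" "t h < 1"
  proof (cases "t k < 1")
    case True
    with k that show ?thesis by blast
  next
    case False
    moreover have "t k \<noteq> 1" using k(2) unfolding t_def .
    ultimately have "1 < t k" by simp
    moreover have "t (inv k) = 1 / t k" unfolding t_def using k(1) by (simp add: modular_H_inverse delta_inverse)
    ultimately have "t (inv k) < 1" by simp
    with inv_HH[OF k(1)] that show ?thesis by blast
  qed
  have pow: "\<exists>g\<in>HH. t g = t h ^ n" for n
  proof (induction n)
    case 0
    have "t id = 1" unfolding t_def modular_H_id delta_id by simp
    then show ?case by (intro bexI[OF _ id_HH]) (simp only: power_0)
  next
    case (Suc n)
    then obtain g where g: "g \<in> HH" "t g = t h ^ n" by blast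
    have "t (h \<circ> g) = t h ^ Suc n" unfolding t_comp[OF h(1) g(1)] g(2) power_Suc ..
    then show ?case using comp_HH[OF h(1) g(1)] by (rule bexI)
  qed
  obtain n where "t h ^ n < e" using real_arch_pow_inv[OF e h(2)] by blast
  moreover obtain g where "g \<in> HH" "t g = t h ^ n" using pow by blast
  ultimately show thesis using that[of g] unfolding t_def by simp
qed

text \<open>Where \<open>1 / W P\<close> is of size \<open>n\<close>, the normalized function is moved by a group element whose
  modulus is so small that the contributions of all \<open>n\<close> to the norm are summable.\<close>
lemma admissible_nonunimodular:
  assumes PL: "P \<in> L2 lam" and W: "AE \<xi> in lam. \<xi> \<in> X \<longrightarrow> 0 < W P \<xi> \<and> W P \<xi> < \<infinity>"
    and k: "k \<in> HH" "modular_H dh k / delta dx k \<noteq> 1"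
  shows "\<exists>\<psi>. admissible dx dh (HX dx lam X) \<psi>"
proof -
  note P [measurable] = L2_measurable[OF PL]
  \<comment> \<open>\<open>c n\<close> bounds the squared norm of the piece at level
    \<open>n\<close> before it is moved; the summand 1 keeps it positive for the division below,
    since \<open>n\<close> or the norm of \<open>P\<close> may be 0.\<close>
  define c where "c n = real n * (n2 lam P)\<^sup>2 + 1" for n
  have c: "0 < c n" for n unfolding c_def by (intro add_nonneg_pos mult_nonneg_nonneg) auto
  have "\<exists>g. g \<in> HH \<and> modular_H dh g / delta dx g < (1/2)^n / c n" for n
    by (rule small_ratio[OF k, of "(1/2)^n / c n"]) (use c in auto)
  then obtain g where g: "\<And>n. g n \<in> HH" "\<And>n. modular_H dh (g n) / delta dx (g n) < (1/2)^n / c n"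
    by metis
  define D where "D n = modular_H dh (g n)" for n
  have D: "0 < D n" for n unfolding D_def by (rule modular_H_pos[OF g(1)])
  \<comment> \<open>On \<open>good P\<close> the level satisfies
    \<open>1 / enn2real (W P \<xi>) \<le> N \<xi>\<close>. Where \<open>W P\<close> is 0 or
    infinite, \<open>enn2real\<close> and division by zero give level 0, harmlessly, as the
    normalized function vanishes there.\<close>
  define N where "N \<xi> = nat \<lceil>1 / enn2real (W P \<xi>)\<rceil>" for \<xi>
  have N_meas [measurable]: "N \<in> lam \<rightarrow>\<^sub>M count_space UNIV" unfolding N_def by measurable
  have N_inv: "N (\<xi> \<circ> h) = N \<xi>" if "\<xi> \<in> Ch" "h \<in> HH" for \<xi> h
    unfolding N_def by (simp add: W_invariant[OF P that])
  let ?Q = "normalized P"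
  \<comment> \<open>Composition with \<open>g n\<close> multiplies the Calderon function by
    \<open>1 / D n\<close>, which the factor \<open>sqrt (D (N \<xi>))\<close> undoes. Since
    \<open>N\<close> is constant on orbits, a single group element acts along each orbit.\<close>
  define R where "R \<xi> = complex_of_real (sqrt (D (N \<xi>))) * ?Q (\<xi> \<circ> g (N \<xi>))" for \<xi>
  have R_meas [measurable]: "R \<in> borel_measurable lam"
  proof -
    have "(\<lambda>\<xi>. complex_of_real (sqrt (D n)) * ?Q (\<xi> \<circ> g n)) \<in> borel_measurable lam" for n
      using dual_act_const[OF g(1)[of n]] by measurable
    from measurable_compose_countable[OF this N_meas] show ?thesis unfolding R_def .
  qed
  have R_sq: "ennreal ((cmod (R \<xi>))\<^sup>2) = ennreal (D (N \<xi>)) * ennreal ((cmod (?Q (\<xi> \<circ> g (N \<xi>))))\<^sup>2)" for \<xi>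
    using D[of "N \<xi>"] by (simp add: R_def norm_mult power_mult_distrib ennreal_mult)
  have WR: "W R \<xi> = 1" if \<xi>: "\<xi> \<in> good P" for \<xi>
  proof -
    have xc: "\<xi> \<in> Ch" using \<xi> by (simp add: good_def)
    let ?n = "N \<xi>"
    let ?u = "\<lambda>h. ennreal ((cmod (?Q (\<xi> \<circ> h)))\<^sup>2)"
    have u: "?u \<in> borel_measurable NH"
      using measurable_compose[OF orbit_map_measurable[OF xc], of "\<lambda>\<xi>. ennreal ((cmod (?Q \<xi>))\<^sup>2)" borel] by simp
    have gi: "inv (g ?n) \<in> HH" by (rule inv_HH[OF g(1)])
    have "(\<lambda>h. h \<circ> g ?n) \<in> NH \<rightarrow>\<^sub>M NH" using g(1)[of ?n] by (intro H.mul_meas) auto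
    from measurable_compose[OF this u]
    have ug: "(\<lambda>h. ?u (h \<circ> g ?n)) \<in> borel_measurable dh" by simp
    have "W R \<xi> = (\<integral>\<^sup>+h. ennreal (D ?n) * ?u (h \<circ> g ?n) \<partial>dh)"
      unfolding W_def V_def
      by (intro nn_integral_cong) (simp add: R_sq N_inv[OF xc] comp_assoc)
    also have "\<dots> = ennreal (D ?n) * (\<integral>\<^sup>+h. ?u (h \<circ> g ?n) \<partial>dh)" by (rule nn_integral_cmult[OF ug])
    also have "(\<integral>\<^sup>+h. ?u (h \<circ> g ?n) \<partial>dh) = ennreal (modular_H dh (inv (g ?n))) * (\<integral>\<^sup>+h. ?u h \<partial>dh)"
      using nn_integral_right[OF gi u] by (simp add: HH_inv_simps[OF g(1)])
    also have "(\<integral>\<^sup>+h. ?u h \<partial>dh) = 1" using W_normalized[OF P xc] \<xi> by (simp add: W_def V_def)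
    also have "ennreal (D ?n) * (ennreal (modular_H dh (inv (g ?n))) * 1) = 1"
      using D[of ?n] by (simp add: modular_H_inverse[OF g(1)] D_def[symmetric] ennreal_mult[symmetric])
    finally show ?thesis .
  qed
  have "L2norm_sq lam R \<le> (\<Sum>n. ennreal ((1/2)^n))"
  proof -
    \<comment> \<open>The part of \<open>R\<close> at level \<open>n\<close> has squared norm
      \<open>D n / delta dx (g n)\<close> times the integral of \<open>T n\<close>. That integral is
      at most \<open>c n\<close>, and \<open>g n\<close> was chosen to bring the product below
      \<open>(1/2)^n\<close>.\<close>
    define T where "T n \<xi> = (if N \<xi> = n then ennreal ((cmod (?Q \<xi>))\<^sup>2) else 0)" for n \<xi>
    have T_meas [measurable]: "T n \<in> borel_measurable lam" for n unfolding T_def by measurable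
    have Tg [measurable]: "(\<lambda>\<xi>. T n (\<xi> \<circ> g n)) \<in> borel_measurable lam" for n
      by (rule measurable_compose[OF dual_act_const[OF g(1)] T_meas])
    have "L2norm_sq lam R = (\<integral>\<^sup>+\<xi>. (\<Sum>n. ennreal (D n) * T n (\<xi> \<circ> g n)) \<partial>lam)"
      unfolding L2norm_sq_def
    proof (rule nn_integral_cong)
      fix \<xi> assume "\<xi> \<in> space lam"
      then have \<xi>: "\<xi> \<in> Ch" by simp
      have "(\<lambda>n. ennreal (D n) * T n (\<xi> \<circ> g n)) = (\<lambda>n. if n = N \<xi> then ennreal (D n) * ennreal ((cmod (?Q (\<xi> \<circ> g n)))\<^sup>2) else 0)"
        by (rule ext) (simp add: T_def N_inv[OF \<xi> g(1)])
      then show "ennreal ((cmod (R \<xi>))\<^sup>2) = (\<Sum>n. ennreal (D n) * T n (\<xi> \<circ> g n))"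
        unfolding R_sq using sums_unique[OF sums_single[of "N \<xi>" "\<lambda>n. ennreal (D n) * ennreal ((cmod (?Q (\<xi> \<circ> g n)))\<^sup>2)"]] by simp
    qed
    also have "\<dots> = (\<Sum>n. \<integral>\<^sup>+\<xi>. ennreal (D n) * T n (\<xi> \<circ> g n) \<partial>lam)"
      by (rule nn_integral_suminf) measurable
    also have "\<dots> \<le> (\<Sum>n. ennreal ((1/2)^n))"
    proof (rule suminf_le)
      fix n
      have Tle: "T n \<xi> \<le> ennreal (real n) * ennreal ((cmod (P \<xi>))\<^sup>2)" for \<xi>
      proof (cases "N \<xi> = n \<and> \<xi> \<in> good P")
        case True
        have w: "0 < enn2real (W P \<xi>)" using True by (auto simp: good_def enn2real_positive_iff)
        have "1 / enn2real (W P \<xi>) \<le> real (N \<xi>)" unfolding N_def by linarith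
        then have "(cmod (P \<xi>))\<^sup>2 * (1 / enn2real (W P \<xi>)) \<le> (cmod (P \<xi>))\<^sup>2 * real n"
          using True by (intro mult_left_mono) auto
        then have "(cmod (?Q \<xi>))\<^sup>2 \<le> real n * (cmod (P \<xi>))\<^sup>2"
          using True by (simp add: cmod_normalized mult.commute)
        then show ?thesis using True unfolding T_def by (simp add: ennreal_mult[symmetric])
      next
        case False
        then show ?thesis by (auto simp: T_def normalized_def)
      qed
      have "(\<integral>\<^sup>+\<xi>. T n \<xi> \<partial>lam) \<le> (\<integral>\<^sup>+\<xi>. ennreal (real n) * ennreal ((cmod (P \<xi>))\<^sup>2) \<partial>lam)"
        by (intro nn_integral_mono Tle)
      also have "\<dots> = ennreal (real n) * L2norm_sq lam P"
        unfolding L2norm_sq_def by (rule nn_integral_cmult) measurable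
      also have "\<dots> \<le> ennreal (c n)"
        unfolding L2norm_sq_eq[OF PL] by (subst ennreal_mult[symmetric]) (auto simp: c_def intro!: ennreal_leI)
      finally have Tn: "(\<integral>\<^sup>+\<xi>. T n \<xi> \<partial>lam) \<le> ennreal (c n)" .
      have d: "0 < delta dx (g n)" by (rule delta_pos[OF g(1)])
      have "(\<integral>\<^sup>+\<xi>. ennreal (D n) * T n (\<xi> \<circ> g n) \<partial>lam) = ennreal (D n) * (\<integral>\<^sup>+\<xi>. T n (\<xi> \<circ> g n) \<partial>lam)"
        by (rule nn_integral_cmult) measurable
      also have "\<dots> = ennreal (D n) * (ennreal (1 / delta dx (g n)) * (\<integral>\<^sup>+\<xi>. T n \<xi> \<partial>lam))"
        unfolding nn_integral_dual_act[OF g(1) T_meas] ..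
      also have "\<dots> \<le> ennreal (D n) * (ennreal (1 / delta dx (g n)) * ennreal (c n))"
        by (intro mult_left_mono Tn) auto
      also have "\<dots> = ennreal (D n / delta dx (g n) * c n)"
        using D[of n] d c[of n] by (simp add: ennreal_mult[symmetric])
      also have "\<dots> \<le> ennreal ((1/2)^n)"
      proof (rule ennreal_leI)
        have "D n / delta dx (g n) * c n \<le> (1/2)^n / c n * c n"
          using g(2)[of n] c[of n] by (intro mult_right_mono) (auto simp: D_def)
        then show "D n / delta dx (g n) * c n \<le> (1/2)^n" using c[of n] by simp
      qed
      finally show "(\<integral>\<^sup>+\<xi>. ennreal (D n) * T n (\<xi> \<circ> g n) \<partial>lam) \<le> ennreal ((1/2)^n)" .
    qed auto
    finally show ?thesis .
  qed
  also have "(\<Sum>n. ennreal ((1/2)^n)) = ennreal (\<Sum>n. (1/2)^n)"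
    by (intro suminf_ennreal2 summable_geometric) auto
  also have "\<dots> < \<infinity>" by simp
  finally have RL: "R \<in> L2 lam" by (subst L2_iff) auto
  show ?thesis
  proof (rule W_imp_admissible[OF RL])
    show "AE \<xi> in lam. \<xi> \<notin> X \<longrightarrow> R \<xi> = 0"
    proof (rule AE_I2, rule impI)
      fix \<xi> assume "\<xi> \<in> space lam" "\<xi> \<notin> X"
      then have "\<xi> \<in> Ch" "\<xi> \<notin> good P" by (auto simp: good_def)
      then show "R \<xi> = 0" by (simp add: R_def normalized_def good_invariant[OF P _ g(1)])
    qed
    show "AE \<xi> in lam. \<xi> \<in> X \<longrightarrow> W R \<xi> = 1"
      using AE_good[OF W] by eventually_elim (simp add: WR)
  qed
qed

subsection \<open>The unimodular case\<close>

lemma self_orbit: "\<xi> \<in> orbit HH \<xi>"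
proof -
  have "\<xi> = \<xi> \<circ> id" by simp
  then show ?thesis unfolding orbit_def using id_HH by blast
qed

lemma orbit_eq: "\<eta> \<in> orbit HH \<xi> \<Longrightarrow> orbit HH \<eta> = orbit HH \<xi>"
proof -
  assume "\<eta> \<in> orbit HH \<xi>"
  then obtain g where g: "\<eta> = \<xi> \<circ> g" "g \<in> HH" unfolding orbit_def by blast
  show ?thesis
  proof (intro set_eqI iffI)
    fix \<zeta> assume "\<zeta> \<in> orbit HH \<eta>"
    then obtain h where h: "\<zeta> = \<eta> \<circ> h" "h \<in> HH" unfolding orbit_def by blast
    have "\<zeta> = \<xi> \<circ> (g \<circ> h)" using g h by (simp add: comp_assoc)
    then show "\<zeta> \<in> orbit HH \<xi>" unfolding orbit_def using comp_HH[OF g(2) h(2)] by blast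
  next
    fix \<zeta> assume "\<zeta> \<in> orbit HH \<xi>"
    then obtain h where h: "\<zeta> = \<xi> \<circ> h" "h \<in> HH" unfolding orbit_def by blast
    have "\<eta> \<circ> (inv g \<circ> h) = \<xi> \<circ> (g \<circ> inv g) \<circ> h" using g by (simp add: comp_assoc)
    then have "\<zeta> = \<eta> \<circ> (inv g \<circ> h)" using h HH_inv_simps(4)[OF g(2)] by simp
    then show "\<zeta> \<in> orbit HH \<eta>" unfolding orbit_def using comp_HH[OF inv_HH[OF g(2)] h(2)] by blast
  qed
qed

lemma orbit_subset_X: "\<xi> \<in> X \<Longrightarrow> orbit HH \<xi> \<subseteq> X"
  unfolding orbit_def using X_inv by blast

text \<open>The very choice made inside \<open>orbit_measure\<close>, so that unfolding that
  definition exposes \<open>rep\<close>. Invariance of \<open>V\<close> makes the chosen point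
  immaterial.\<close>

definition rep :: "('a \<Rightarrow> complex) set \<Rightarrow> ('a \<Rightarrow> complex)" where
  "rep Orb = (SOME \<xi>. \<xi> \<in> Orb \<and> Orb = orbit HH \<xi>)"

lemma rep_orbit:
  shows "rep (orbit HH \<xi>) \<in> orbit HH \<xi>" "orbit HH (rep (orbit HH \<xi>)) = orbit HH \<xi>"
proof -
  have "rep (orbit HH \<xi>) \<in> orbit HH \<xi> \<and> orbit HH \<xi> = orbit HH (rep (orbit HH \<xi>))"
    unfolding rep_def by (rule someI[of _ \<xi>]) (simp add: self_orbit)
  then show "rep (orbit HH \<xi>) \<in> orbit HH \<xi>" "orbit HH (rep (orbit HH \<xi>)) = orbit HH \<xi>" by auto
qed

lemma rep_X: "Orb \<in> orbits HH X \<Longrightarrow> rep Orb \<in> X"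
  unfolding orbits_def using rep_orbit(1) orbit_subset_X by blast

lemma orbit_measure_eq:
  assumes Orb: "Orb \<in> orbits HH X" and B: "B \<in> sets lam"
  shows "orbit_measure HH dh Orb B = V (indicator B) (rep Orb)"
proof -
  have \<xi>: "rep Orb \<in> Ch" using rep_X[OF Orb] X_subset by blast
  let ?S = "{h \<in> HH. rep Orb \<circ> h \<in> B}"
  have "(\<lambda>h. rep Orb \<circ> h) -` B \<inter> space NH \<in> sets NH"
    by (rule measurable_sets[OF orbit_map_measurable[OF \<xi>] B])
  also have "(\<lambda>h. rep Orb \<circ> h) -` B \<inter> space NH = ?S" by auto
  finally have S: "?S \<in> sets dh" by simp
  have "orbit_measure HH dh Orb B = emeasure dh ?S"
    unfolding orbit_measure_def Let_def rep_def ..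
  also have "\<dots> = (\<integral>\<^sup>+h. indicator ?S h \<partial>dh)" using S by simp
  also have "\<dots> = V (indicator B) (rep Orb)"
    unfolding V_def by (intro nn_integral_cong) (auto split: split_indicator)
  finally show ?thesis .
qed

lemma V_rep_orbit:
  assumes u: "u \<in> borel_measurable lam" and \<xi>: "\<xi> \<in> Ch"
  shows "V u (rep (orbit HH \<xi>)) = V u \<xi>"
proof -
  obtain g where "rep (orbit HH \<xi>) = \<xi> \<circ> g" "g \<in> HH"
    using rep_orbit(1)[of \<xi>] unfolding orbit_def by blast
  then show ?thesis using V_invariant[OF u \<xi>] by simp
qed

lemma Union_orbit_compl:
  assumes S: "S \<subseteq> orbits HH X" shows "\<Union>(orbits HH X - S) = X - \<Union>S"
proof (intro set_eqI iffI)
  fix \<xi> assume "\<xi> \<in> \<Union>(orbits HH X - S)"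
  then obtain \<eta> where e: "\<eta> \<in> X" "\<xi> \<in> orbit HH \<eta>" "orbit HH \<eta> \<notin> S" unfolding orbits_def by blast
  have "\<xi> \<notin> \<Union>S"
  proof
    assume "\<xi> \<in> \<Union>S"
    then obtain Z where Z: "Z \<in> S" "\<xi> \<in> Z" by blast
    then obtain \<zeta> where z: "Z = orbit HH \<zeta>" using S unfolding orbits_def by blast
    have "orbit HH \<xi> = Z" "orbit HH \<xi> = orbit HH \<eta>" using orbit_eq[of \<xi> \<zeta>] orbit_eq[of \<xi> \<eta>] e(2) Z(2) z by auto
    then show False using e(3) Z(1) by simp
  qed
  then show "\<xi> \<in> X - \<Union>S" using e orbit_subset_X by blast
next
  fix \<xi> assume \<xi>: "\<xi> \<in> X - \<Union>S"
  then have "orbit HH \<xi> \<in> orbits HH X" "orbit HH \<xi> \<notin> S" using self_orbit[of \<xi>] unfolding orbits_def by blast+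
  then show "\<xi> \<in> \<Union>(orbits HH X - S)" using self_orbit[of \<xi>] by blast
qed

lemma Union_orbits: "\<Union>(orbits HH X) = X"
  unfolding orbits_def using self_orbit orbit_subset_X by blast

text \<open>Makes \<open>sigma\<close> return \<open>orbit_sets\<close> itself, so that a measure
  built on \<open>orbit_space\<close> has exactly the sets that
  \<open>is_orbit_disintegration\<close> demands. Closure under complements rests on the
  disjointness of distinct orbits.\<close>

lemma orbit_sigma: "sigma_algebra (orbits HH X) (orbit_sets HH lam X)"
  unfolding sigma_algebra_iff2
proof (intro conjI ballI allI impI)
  show "orbit_sets HH lam X \<subseteq> Pow (orbits HH X)" by (auto simp: orbit_sets_def)
  show "{} \<in> orbit_sets HH lam X" by (simp add: orbit_sets_def)
  show "orbits HH X - S \<in> orbit_sets HH lam X" if S: "S \<in> orbit_sets HH lam X" for S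
  proof -
    have "\<Union>(orbits HH X - S) = X - \<Union>S" using S by (intro Union_orbit_compl) (simp add: orbit_sets_def)
    moreover have "X - \<Union>S \<in> sets lam" using S X_borel by (intro sets.Diff) (auto simp: orbit_sets_def)
    ultimately show ?thesis unfolding orbit_sets_def by auto
  qed
  fix A :: "nat \<Rightarrow> _" assume A: "range A \<subseteq> orbit_sets HH lam X"
  then have Ai: "A i \<subseteq> orbits HH X" "\<Union>(A i) \<in> sets lam" for i by (auto simp: orbit_sets_def)
  have "\<Union>(\<Union>i. A i) = (\<Union>i. \<Union>(A i))" by blast
  moreover have "(\<Union>i. \<Union>(A i)) \<in> sets lam" using Ai(2) by (intro sets.countable_UN) auto
  moreover have "(\<Union>i. A i) \<subseteq> orbits HH X" using Ai(1) by (rule UN_least)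
  ultimately show "(\<Union>i. A i) \<in> orbit_sets HH lam X" unfolding orbit_sets_def by simp
qed

abbreviation orbit_space :: "('a \<Rightarrow> complex) set measure" where
  "orbit_space \<equiv> sigma (orbits HH X) (orbit_sets HH lam X)"

lemma orbit_space_simps: "space orbit_space = orbits HH X" "sets orbit_space = orbit_sets HH lam X"
proof -
  have s: "orbit_sets HH lam X \<subseteq> Pow (orbits HH X)" by (auto simp: orbit_sets_def)
  show "space orbit_space = orbits HH X" using s by (rule space_measure_of)
  show "sets orbit_space = orbit_sets HH lam X"
    using sigma_algebra.sets_measure_of_eq[OF orbit_sigma] .
qed

text \<open>\<open>V u\<close> is constant on orbits, so the union of the orbits selected by a
  preimage is the measurable set of all points of \<open>X\<close> where \<open>V u\<close> takes a
  value in \<open>A\<close>.\<close>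

lemma V_rep_measurable:
  assumes s: "sets lb = orbit_sets HH lam X" "space lb = orbits HH X" and u [measurable]: "u \<in> borel_measurable lam"
  shows "(\<lambda>Orb. V u (rep Orb)) \<in> borel_measurable lb"
proof (rule measurableI)
  fix A :: "ennreal set" assume A [measurable]: "A \<in> sets borel"
  let ?S = "(\<lambda>Orb. V u (rep Orb)) -` A \<inter> space lb"
  have mem: "\<xi> \<in> \<Union>?S \<longleftrightarrow> V u \<xi> \<in> A" if \<xi>: "\<xi> \<in> X" for \<xi>
  proof
    assume "\<xi> \<in> \<Union>?S"
    then obtain Orb where Orb: "\<xi> \<in> Orb" "Orb \<in> orbits HH X" "V u (rep Orb) \<in> A" using s(2) by auto
    then obtain \<eta> where "Orb = orbit HH \<eta>" unfolding orbits_def by blast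
    then have "Orb = orbit HH \<xi>" using orbit_eq[of \<xi> \<eta>] Orb(1) by simp
    then show "V u \<xi> \<in> A" using Orb(3) V_rep_orbit[OF u, of \<xi>] \<xi> X_subset by auto
  next
    assume "V u \<xi> \<in> A"
    then have "orbit HH \<xi> \<in> ?S" using V_rep_orbit[OF u, of \<xi>] \<xi> X_subset unfolding s(2) orbits_def by auto
    then show "\<xi> \<in> \<Union>?S" using self_orbit[of \<xi>] by blast
  qed
  have "\<Union>?S \<subseteq> X" unfolding s(2) using Union_orbits by blast
  then have "\<Union>?S = {\<xi> \<in> space lam. \<xi> \<in> X \<and> V u \<xi> \<in> A}" using mem X_subset by auto
  also have "\<dots> \<in> sets lam" using X_borel by measurable
  finally show "?S \<in> sets lb" unfolding s orbit_sets_def by blast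
qed simp

text \<open>The preimage of a family of orbits is its union, measurable by definition of
  \<open>orbit_sets\<close>. The general \<open>M\<close> allows application to \<open>lam\<close>
  with a density.\<close>

lemma orbit_measurable:
  assumes "sets M = sets lam" shows "orbit HH \<in> restrict_space M X \<rightarrow>\<^sub>M orbit_space"
proof (rule measurableI)
  have sM: "space M = Ch" using sets_eq_imp_space_eq[OF assms] by simp
  have sp: "space (restrict_space M X) = X" using X_subset by (auto simp: space_restrict_space sM)
  show "orbit HH \<xi> \<in> space orbit_space" if "\<xi> \<in> space (restrict_space M X)" for \<xi>
  proof -
    have "orbit HH \<xi> \<in> orbits HH X" using that unfolding sp orbits_def by blast
    then show ?thesis unfolding orbit_space_simps(1) .
  qed
  fix S assume "S \<in> sets orbit_space"
  then have "S \<in> orbit_sets HH lam X" unfolding orbit_space_simps(2) .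
  then have S: "S \<subseteq> orbits HH X" "\<Union>S \<in> sets lam" unfolding orbit_sets_def by auto
  have SX: "\<Union>S \<subseteq> X" using S(1) Union_orbits by blast
  have "orbit HH -` S \<inter> X = \<Union>S"
  proof (intro set_eqI iffI)
    fix \<xi> assume "\<xi> \<in> orbit HH -` S \<inter> X"
    then show "\<xi> \<in> \<Union>S" using self_orbit[of \<xi>] by auto
  next
    fix \<xi> assume x: "\<xi> \<in> \<Union>S"
    then obtain Z where Z: "Z \<in> S" "\<xi> \<in> Z" by blast
    then obtain \<zeta> where "Z = orbit HH \<zeta>" using S unfolding orbits_def by blast
    then have "orbit HH \<xi> = Z" using orbit_eq[of \<xi> \<zeta>] Z(2) by simp
    then show "\<xi> \<in> orbit HH -` S \<inter> X" using Z(1) x SX by auto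
  qed
  then show "orbit HH -` S \<inter> space (restrict_space M X) \<in> sets (restrict_space M X)"
    unfolding sp using S(2) SX X_borel X_subset assms by (simp add: sets_restrict_space_iff sM Int_absorb2)
qed

text \<open>Pushing forward the density \<open>|P|\<^sup>2\<close> to the orbit space gives the disintegrating measure; the total
  mass is the squared norm of \<open>P\<close>.\<close>
lemma disintegration_of_admissible:
  assumes PL: "P \<in> L2 lam" and W1: "AE \<xi> in lam. \<xi> \<in> X \<longrightarrow> W P \<xi> = 1"
    and unimod: "\<And>h. h \<in> HH \<Longrightarrow> modular_H dh h = delta dx h"
  shows "\<exists>lb. is_orbit_disintegration HH dh lam X lb \<and> emeasure lb (space lb) < \<infinity>"
proof -
  note P [measurable] = L2_measurable[OF PL]
  note [measurable] = X_borel
  define p where "p \<xi> = ennreal ((cmod (P \<xi>))\<^sup>2)" for \<xi>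
  have p_meas [measurable]: "p \<in> borel_measurable lam" unfolding p_def by measurable
  have Wp: "W P = V p" unfolding W_def p_def ..
  let ?M = "density lam p"
  have sM: "sets ?M = sets lam" by simp
  \<comment> \<open>Along almost every orbit in \<open>X\<close> the function \<open>p\<close> has
    total weight \<open>V p = 1\<close>, so the push-forward counts each orbit with unit weight. No
    measurable selection of representatives is involved.\<close>
  define lb where "lb = distr (restrict_space ?M X) orbit_space (orbit HH)"
  note om = orbit_measurable[OF sM]
  have lb_simps: "space lb = orbits HH X" "sets lb = orbit_sets HH lam X"
    unfolding lb_def by (simp_all only: space_distr sets_distr orbit_space_simps)
  have X_M: "X \<inter> space ?M \<in> sets ?M" using X_borel X_subset by (simp add: Int_absorb2)
  have int_lb: "(\<integral>\<^sup>+Orb. V u (rep Orb) \<partial>lb) = (\<integral>\<^sup>+\<xi>. p \<xi> * (V u \<xi> * indicator X \<xi>) \<partial>lam)"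
    if u [measurable]: "u \<in> borel_measurable lam" for u
  proof -
    have "(\<integral>\<^sup>+Orb. V u (rep Orb) \<partial>lb) = (\<integral>\<^sup>+\<xi>. V u (rep (orbit HH \<xi>)) \<partial>restrict_space ?M X)"
      unfolding lb_def
      by (rule nn_integral_distr[OF om]) (simp add: V_rep_measurable[OF orbit_space_simps(2,1) u])
    also have "\<dots> = (\<integral>\<^sup>+\<xi>. V u (rep (orbit HH \<xi>)) * indicator X \<xi> \<partial>?M)"
      by (rule nn_integral_restrict_space[OF X_M])
    also have "\<dots> = (\<integral>\<^sup>+\<xi>. V u \<xi> * indicator X \<xi> \<partial>?M)"
      by (intro nn_integral_cong) (simp add: V_rep_orbit[OF u])
    also have "\<dots> = (\<integral>\<^sup>+\<xi>. p \<xi> * (V u \<xi> * indicator X \<xi>) \<partial>lam)"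
      by (rule nn_integral_density) measurable
    finally show ?thesis .
  qed
  have fin: "emeasure lb (space lb) < \<infinity>"
  proof -
    have sp: "orbit HH -` orbits HH X \<inter> space (restrict_space ?M X) = X"
      unfolding space_restrict_space using X_subset unfolding orbits_def by auto
    have "orbits HH X \<in> sets orbit_space" using sets.top[of orbit_space] unfolding orbit_space_simps(1) .
    then have "emeasure lb (space lb) = emeasure (restrict_space ?M X) X"
      unfolding lb_simps unfolding lb_def by (subst emeasure_distr[OF om]) (simp_all only: sp)
    also have "\<dots> = emeasure ?M X" by (rule emeasure_restrict_space[OF X_M]) simp
    also have "\<dots> = (\<integral>\<^sup>+\<xi>. p \<xi> * indicator X \<xi> \<partial>lam)" by (rule emeasure_density) measurable
    also have "\<dots> \<le> L2norm_sq lam P"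
      unfolding L2norm_sq_def p_def by (rule nn_integral_mono) (auto split: split_indicator)
    also have "\<dots> < \<infinity>" by (simp add: L2norm_sq_eq[OF PL])
    finally show ?thesis .
  qed
  have "finite_measure lb" using fin by (intro finite_measureI) (simp add: less_top)
  then have sf: "sigma_finite_measure lb" by (rule finite_measure.axioms(1))
  have main: "emeasure lam B = (\<integral>\<^sup>+Orb. V (indicator B) (rep Orb) \<partial>lb)" if B [measurable]: "B \<in> sets lam" and BX: "B \<subseteq> X" for B
  proof -
    have off: "V (indicator B) \<xi> * indicator X \<xi> = V (indicator B) \<xi>" if \<xi>: "\<xi> \<in> Ch" for \<xi>
    proof (cases "\<xi> \<in> X")
      case False
      have "V (indicator B) \<xi> = (\<integral>\<^sup>+h. 0 \<partial>dh)"
        unfolding V_def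
      proof (rule nn_integral_cong)
        fix h assume "h \<in> space dh"
        then have "\<xi> \<circ> h \<notin> X" using X_inv_iff[OF \<xi>, of h] False by simp
        then show "indicator B (\<xi> \<circ> h) = (0::ennreal)" using BX by (auto split: split_indicator)
      qed
      then show ?thesis by simp
    qed simp
    have "(\<integral>\<^sup>+Orb. V (indicator B) (rep Orb) \<partial>lb) = (\<integral>\<^sup>+\<xi>. p \<xi> * V (indicator B) \<xi> \<partial>lam)"
      unfolding int_lb[OF borel_measurable_indicator[OF B]] by (intro nn_integral_cong) (simp add: off)
    also have "\<dots> = (\<integral>\<^sup>+h. (\<integral>\<^sup>+\<xi>. p \<xi> * indicator B (\<xi> \<circ> h) \<partial>lam) \<partial>dh)"
      by (rule nn_integral_mult_V) measurable
    \<comment> \<open>Substituting for \<open>\<xi> \<circ> h\<close> produces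
      \<open>1 / delta dx h\<close>. By unimodularity this is the modulus of \<open>inv h\<close>,
      exactly the density that inversion on \<open>H\<close> requires below.\<close>
    also have "\<dots> = (\<integral>\<^sup>+h. (\<integral>\<^sup>+\<eta>. indicator B \<eta> * (p (\<eta> \<circ> inv h) * ennreal (modular_H dh (inv h))) \<partial>lam) \<partial>dh)"
    proof (rule nn_integral_cong)
      fix h assume "h \<in> space dh"
      then have h: "h \<in> HH" by simp
      note [measurable] = dual_act_const[OF inv_HH[OF h]]
      have "(\<integral>\<^sup>+\<xi>. p \<xi> * indicator B (\<xi> \<circ> h) \<partial>lam) = (\<integral>\<^sup>+\<xi>. (\<lambda>\<eta>. p (\<eta> \<circ> inv h) * indicator B \<eta>) (\<xi> \<circ> h) \<partial>lam)"
        by (simp add: comp_assoc HH_inv_simps[OF h])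
      also have "\<dots> = ennreal (1 / delta dx h) * (\<integral>\<^sup>+\<eta>. p (\<eta> \<circ> inv h) * indicator B \<eta> \<partial>lam)"
        by (rule nn_integral_dual_act[OF h]) measurable
      also have "\<dots> = (\<integral>\<^sup>+\<eta>. ennreal (1 / delta dx h) * (p (\<eta> \<circ> inv h) * indicator B \<eta>) \<partial>lam)"
        by (rule nn_integral_cmult[symmetric]) measurable
      also have "\<dots> = (\<integral>\<^sup>+\<eta>. indicator B \<eta> * (p (\<eta> \<circ> inv h) * ennreal (modular_H dh (inv h))) \<partial>lam)"
        by (simp add: modular_H_inverse[OF h] unimod[OF h] mult_ac)
      finally show "(\<integral>\<^sup>+\<xi>. p \<xi> * indicator B (\<xi> \<circ> h) \<partial>lam)
        = (\<integral>\<^sup>+\<eta>. indicator B \<eta> * (p (\<eta> \<circ> inv h) * ennreal (modular_H dh (inv h))) \<partial>lam)" .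
    qed
    also have "\<dots> = (\<integral>\<^sup>+\<eta>. (\<integral>\<^sup>+h. indicator B \<eta> * (p (\<eta> \<circ> inv h) * ennreal (modular_H dh (inv h))) \<partial>dh) \<partial>lam)"
    proof -
      interpret LH: pair_sigma_finite lam dh ..
      have s: "(\<lambda>q. inv (snd q)) \<in> lam \<Otimes>\<^sub>M dh \<rightarrow>\<^sub>M NH"
        by (rule measurable_compose[OF _ H.iv_measurable]) measurable
      have a: "(\<lambda>q. fst q \<circ> inv (snd q)) \<in> lam \<Otimes>\<^sub>M dh \<rightarrow>\<^sub>M lam" by (rule dual_act_measurable[OF _ s]) measurable
      have [measurable]: "(\<lambda>q. p (fst q \<circ> inv (snd q))) \<in> borel_measurable (lam \<Otimes>\<^sub>M dh)"
        by (rule measurable_compose[OF a p_meas])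
      \<comment> \<open>Joint measurability of the modular function is borrowed from
        \<open>delta\<close>, with which it coincides here.\<close>
      have "(\<lambda>q. delta dx (inv (snd q))) \<in> borel_measurable (lam \<Otimes>\<^sub>M dh)"
        by (rule measurable_compose[OF s delta_measurable])
      moreover have "delta dx (inv (snd q)) = modular_H dh (inv (snd q))" if "q \<in> space (lam \<Otimes>\<^sub>M dh)" for q
        using that unimod[OF inv_HH, of "snd q"] by (auto simp: space_pair_measure)
      ultimately have [measurable]: "(\<lambda>q. modular_H dh (inv (snd q))) \<in> borel_measurable (lam \<Otimes>\<^sub>M dh)"
        by (rule iffD1[OF measurable_cong, rotated])
      show ?thesis
      proof (rule LH.Fubini')
        show "(\<lambda>(\<eta>, h). indicator B \<eta> * (p (\<eta> \<circ> inv h) * ennreal (modular_H dh (inv h)))) \<in> borel_measurable (lam \<Otimes>\<^sub>M dh)"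
          unfolding split_beta' by measurable
      qed
    qed
    also have "\<dots> = (\<integral>\<^sup>+\<eta>. indicator B \<eta> * V p \<eta> \<partial>lam)"
    proof (rule nn_integral_cong)
      fix \<eta> assume "\<eta> \<in> space lam"
      then have \<eta>: "\<eta> \<in> Ch" by simp
      have m: "(\<lambda>h. p (\<eta> \<circ> inv h)) \<in> borel_measurable NH"
        by (rule measurable_compose[OF measurable_compose[OF H.iv_measurable orbit_map_measurable[OF \<eta>]] p_meas])
      have "(\<integral>\<^sup>+h. p (\<eta> \<circ> inv (inv h)) \<partial>dh) = (\<integral>\<^sup>+h. p (\<eta> \<circ> inv h) * ennreal (modular_H dh (inv h)) \<partial>dh)"
        by (rule nn_integral_inverse_H[OF m])
      moreover have "(\<integral>\<^sup>+h. p (\<eta> \<circ> inv (inv h)) \<partial>dh) = V p \<eta>"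
        unfolding V_def by (intro nn_integral_cong) (simp add: HH_inv_simps)
      ultimately have e: "(\<integral>\<^sup>+h. p (\<eta> \<circ> inv h) * ennreal (modular_H dh (inv h)) \<partial>dh) = V p \<eta>" by simp
      show "(\<integral>\<^sup>+h. indicator B \<eta> * (p (\<eta> \<circ> inv h) * ennreal (modular_H dh (inv h))) \<partial>dh) = indicator B \<eta> * V p \<eta>"
        by (cases "\<eta> \<in> B") (simp_all add: e)
    qed
    also have "\<dots> = (\<integral>\<^sup>+\<eta>. indicator B \<eta> \<partial>lam)"
    proof (rule nn_integral_cong_AE)
      show "AE \<eta> in lam. indicator B \<eta> * V p \<eta> = indicator B \<eta>"
        using W1 unfolding Wp
      proof eventually_elim
        case (elim \<eta>)
        then show ?case using BX by (cases "\<eta> \<in> B") auto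
      qed
    qed
    finally show ?thesis by simp
  qed
  have om_eq: "orbit_measure HH dh Orb B = V (indicator B) (rep Orb)" if "Orb \<in> space lb" "B \<in> sets lam" for Orb B
    using that unfolding lb_simps by (rule orbit_measure_eq)
  have "is_orbit_disintegration HH dh lam X lb"
    unfolding is_orbit_disintegration_def
  proof (intro conjI allI impI lb_simps sf)
    fix B assume B: "B \<in> sets lam \<and> B \<subseteq> X"
    then have B1: "B \<in> sets lam" and B2: "B \<subseteq> X" by auto
    have "(\<lambda>Orb. V (indicator B) (rep Orb)) \<in> borel_measurable lb"
      by (rule V_rep_measurable[OF lb_simps(2,1)]) (use B1 in simp)
    then show "(\<lambda>Orb. orbit_measure HH dh Orb B) \<in> borel_measurable lb"
      by (rule iffD1[OF measurable_cong, rotated]) (simp add: om_eq[OF _ B1])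
    show "emeasure lam B = (\<integral>\<^sup>+Orb. orbit_measure HH dh Orb B \<partial>lb)"
      unfolding main[OF B1 B2] by (intro nn_integral_cong) (simp add: om_eq[OF _ B1])
  qed
  with fin show ?thesis by blast
qed

text \<open>The defining formula passes from sets to functions by linearity and monotone limits. The
  factor \<open>indicator X\<close> stays because the formula speaks of subsets of \<open>X\<close>
  only.\<close>

lemma disintegration_nn_integral:
  assumes dis: "is_orbit_disintegration HH dh lam X lb" and u: "u \<in> borel_measurable lam"
  shows "(\<integral>\<^sup>+\<xi>. u \<xi> * indicator X \<xi> \<partial>lam) = (\<integral>\<^sup>+Orb. V (\<lambda>\<xi>. u \<xi> * indicator X \<xi>) (rep Orb) \<partial>lb)"
proof -
  have lb: "space lb = orbits HH X" "sets lb = orbit_sets HH lam X"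
    and eq: "\<And>B. B \<in> sets lam \<Longrightarrow> B \<subseteq> X \<Longrightarrow> emeasure lam B = (\<integral>\<^sup>+Orb. orbit_measure HH dh Orb B \<partial>lb)"
    using dis unfolding is_orbit_disintegration_def by blast+
  note [measurable] = X_borel
  have rCh: "rep Orb \<in> Ch" if "Orb \<in> space lb" for Orb
    using rep_X[of Orb] that X_subset unfolding lb by blast
  have hm: "(\<lambda>h. u (rep Orb \<circ> h) * indicator X (rep Orb \<circ> h)) \<in> borel_measurable dh"
    if "u \<in> borel_measurable lam" "Orb \<in> space lb" for u :: "_ \<Rightarrow> ennreal" and Orb
  proof -
    have "(\<lambda>\<xi>. u \<xi> * indicator X \<xi>) \<in> borel_measurable lam" using that(1) by measurable
    from measurable_compose[OF orbit_map_measurable[OF rCh[OF that(2)]] this] show ?thesis by simp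
  qed
  show ?thesis
    using u
  proof (induction u rule: borel_measurable_induct)
    case (cong f g)
    have "(\<integral>\<^sup>+\<xi>. f \<xi> * indicator X \<xi> \<partial>lam) = (\<integral>\<^sup>+\<xi>. g \<xi> * indicator X \<xi> \<partial>lam)"
      using cong(3) by (intro nn_integral_cong) auto
    moreover have "(\<integral>\<^sup>+Orb. V (\<lambda>\<xi>. f \<xi> * indicator X \<xi>) (rep Orb) \<partial>lb) = (\<integral>\<^sup>+Orb. V (\<lambda>\<xi>. g \<xi> * indicator X \<xi>) (rep Orb) \<partial>lb)"
      unfolding V_def using cong(3) rCh comp_Ch by (intro nn_integral_cong) auto
    ultimately show ?case using cong(4) by simp
  next
    case (set A)
    have AX: "A \<inter> X \<in> sets lam" using set X_borel by auto
    have i: "indicator A \<xi> * indicator X \<xi> = (indicator (A \<inter> X) \<xi> :: ennreal)" for \<xi> by (auto split: split_indicator)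
    have "(\<integral>\<^sup>+\<xi>. indicator A \<xi> * indicator X \<xi> \<partial>lam) = emeasure lam (A \<inter> X)" unfolding i using AX by simp
    also have "\<dots> = (\<integral>\<^sup>+Orb. orbit_measure HH dh Orb (A \<inter> X) \<partial>lb)" by (rule eq[OF AX]) simp
    also have "\<dots> = (\<integral>\<^sup>+Orb. V (indicator (A \<inter> X)) (rep Orb) \<partial>lb)"
      by (intro nn_integral_cong orbit_measure_eq[OF _ AX]) (simp add: lb)
    finally show ?case unfolding i .
  next
    case (mult f c)
    have f [measurable]: "f \<in> borel_measurable lam" by (rule mult)
    have "(\<integral>\<^sup>+\<xi>. c * f \<xi> * indicator X \<xi> \<partial>lam) = c * (\<integral>\<^sup>+\<xi>. f \<xi> * indicator X \<xi> \<partial>lam)"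
      unfolding mult.assoc by (rule nn_integral_cmult) measurable
    also have "\<dots> = c * (\<integral>\<^sup>+Orb. V (\<lambda>\<xi>. f \<xi> * indicator X \<xi>) (rep Orb) \<partial>lb)" using mult.IH by simp
    also have "\<dots> = (\<integral>\<^sup>+Orb. c * V (\<lambda>\<xi>. f \<xi> * indicator X \<xi>) (rep Orb) \<partial>lb)"
      by (rule nn_integral_cmult[symmetric], rule V_rep_measurable[OF lb(2,1)]) measurable
    also have "\<dots> = (\<integral>\<^sup>+Orb. V (\<lambda>\<xi>. c * f \<xi> * indicator X \<xi>) (rep Orb) \<partial>lb)"
      unfolding V_def mult.assoc by (intro nn_integral_cong nn_integral_cmult[symmetric] hm f)
    finally show ?case .
  next
    case (add f g)
    have [measurable]: "f \<in> borel_measurable lam" "g \<in> borel_measurable lam" by (rule add)+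
    have "(\<integral>\<^sup>+\<xi>. (g \<xi> + f \<xi>) * indicator X \<xi> \<partial>lam) = (\<integral>\<^sup>+\<xi>. g \<xi> * indicator X \<xi> \<partial>lam) + (\<integral>\<^sup>+\<xi>. f \<xi> * indicator X \<xi> \<partial>lam)"
      unfolding distrib_right by (rule nn_integral_add) measurable
    also have "\<dots> = (\<integral>\<^sup>+Orb. V (\<lambda>\<xi>. g \<xi> * indicator X \<xi>) (rep Orb) + V (\<lambda>\<xi>. f \<xi> * indicator X \<xi>) (rep Orb) \<partial>lb)"
      unfolding add.IH by (rule nn_integral_add[symmetric]; rule V_rep_measurable[OF lb(2,1)]) measurable
    also have "\<dots> = (\<integral>\<^sup>+Orb. V (\<lambda>\<xi>. (g \<xi> + f \<xi>) * indicator X \<xi>) (rep Orb) \<partial>lb)"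
      unfolding V_def distrib_right by (intro nn_integral_cong nn_integral_add[symmetric] hm add)
    finally show ?case .
  next
    case (seq U)
    have Um [measurable]: "U i \<in> borel_measurable lam" for i by (rule seq)
    have inc: "incseq (\<lambda>i. U i \<xi>)" for \<xi> using seq(3) by (simp add: incseq_def le_fun_def)
    have incX: "incseq (\<lambda>i. U i \<xi> * indicator X \<xi>)" for \<xi>
      using inc[of \<xi>] by (auto simp: incseq_def intro: mult_right_mono)
    have sup: "(SUP i. U i) \<xi> * indicator X \<xi> = (SUP i. U i \<xi> * indicator X \<xi>)" for \<xi>
      by (simp add: SUP_mult_right_ennreal image_image)
    have VS: "V (\<lambda>\<xi>. (SUP i. U i) \<xi> * indicator X \<xi>) (rep Orb) = (SUP i. V (\<lambda>\<xi>. U i \<xi> * indicator X \<xi>) (rep Orb))"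
      if Orb: "Orb \<in> space lb" for Orb
      unfolding V_def sup
      by (rule nn_integral_monotone_convergence_SUP)
        (use incX hm[OF Um Orb] in \<open>auto simp: incseq_def le_fun_def\<close>)
    have Vinc: "V (\<lambda>\<xi>. U i \<xi> * indicator X \<xi>) \<xi> \<le> V (\<lambda>\<xi>. U j \<xi> * indicator X \<xi>) \<xi>" if "i \<le> j" for i j \<xi>
      unfolding V_def using incX that by (intro nn_integral_mono) (auto simp: incseq_def)
    have "(\<integral>\<^sup>+\<xi>. (SUP i. U i) \<xi> * indicator X \<xi> \<partial>lam) = (SUP i. \<integral>\<^sup>+\<xi>. U i \<xi> * indicator X \<xi> \<partial>lam)"
      unfolding sup by (rule nn_integral_monotone_convergence_SUP) (use incX in \<open>auto simp: incseq_def le_fun_def\<close>)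
    also have "\<dots> = (SUP i. \<integral>\<^sup>+Orb. V (\<lambda>\<xi>. U i \<xi> * indicator X \<xi>) (rep Orb) \<partial>lb)" using seq.IH by simp
    also have "\<dots> = (\<integral>\<^sup>+Orb. (SUP i. V (\<lambda>\<xi>. U i \<xi> * indicator X \<xi>) (rep Orb)) \<partial>lb)"
    proof (rule nn_integral_monotone_convergence_SUP[symmetric])
      show "incseq (\<lambda>i Orb. V (\<lambda>\<xi>. U i \<xi> * indicator X \<xi>) (rep Orb))"
        using Vinc by (auto simp: incseq_def le_fun_def)
      show "(\<lambda>Orb. V (\<lambda>\<xi>. U i \<xi> * indicator X \<xi>) (rep Orb)) \<in> borel_measurable lb" for i
        by (rule V_rep_measurable[OF lb(2,1)]) measurable
    qed
    also have "\<dots> = (\<integral>\<^sup>+Orb. V (\<lambda>\<xi>. (SUP i. U i) \<xi> * indicator X \<xi>) (rep Orb) \<partial>lb)"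
      by (intro nn_integral_cong) (simp only: VS)
    finally show ?case .
  qed
qed

text \<open>The squared norm of the normalized function is the \<open>lb\<close>-integral of its
  Calderon function at the representatives. The latter never exceeds 1, so the total mass bounds the
  norm. It matters that \<open>W_normalized\<close> holds at every point, as the representatives
  might all lie in a null set.\<close>

lemma admissible_of_disintegration:
  assumes PL: "P \<in> L2 lam" and W: "AE \<xi> in lam. \<xi> \<in> X \<longrightarrow> 0 < W P \<xi> \<and> W P \<xi> < \<infinity>"
    and dis: "is_orbit_disintegration HH dh lam X lb" and fin: "emeasure lb (space lb) < \<infinity>"
  shows "\<exists>\<psi>. admissible dx dh (HX dx lam X) \<psi>"
proof -
  note P [measurable] = L2_measurable[OF PL]
  let ?Q = "normalized P"
  let ?q = "\<lambda>\<xi>. ennreal ((cmod (?Q \<xi>))\<^sup>2)"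
  have off: "?Q \<xi> = 0" if "\<xi> \<notin> X" for \<xi> using that by (simp add: normalized_def good_def)
  have "L2norm_sq lam ?Q = (\<integral>\<^sup>+\<xi>. ?q \<xi> * indicator X \<xi> \<partial>lam)"
    unfolding L2norm_sq_def by (intro nn_integral_cong) (auto simp: off split: split_indicator)
  also have "\<dots> = (\<integral>\<^sup>+Orb. V (\<lambda>\<xi>. ?q \<xi> * indicator X \<xi>) (rep Orb) \<partial>lb)"
    by (rule disintegration_nn_integral[OF dis]) measurable
  also have "\<dots> \<le> (\<integral>\<^sup>+Orb. 1 \<partial>lb)"
  proof (rule nn_integral_mono)
    fix Orb assume "Orb \<in> space lb"
    then have "rep Orb \<in> X" using dis rep_X unfolding is_orbit_disintegration_def by blast
    then have r: "rep Orb \<in> Ch" using X_subset by blast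
    have "V (\<lambda>\<xi>. ?q \<xi> * indicator X \<xi>) (rep Orb) \<le> W ?Q (rep Orb)"
      unfolding W_def V_def by (rule nn_integral_mono) (auto split: split_indicator)
    also have "\<dots> \<le> 1" unfolding W_normalized[OF P r] by (auto split: split_indicator)
    finally show "V (\<lambda>\<xi>. ?q \<xi> * indicator X \<xi>) (rep Orb) \<le> 1" .
  qed
  also have "\<dots> = emeasure lb (space lb)" by simp
  finally have "L2norm_sq lam ?Q < \<infinity>" using fin by (rule le_less_trans)
  then have QL: "?Q \<in> L2 lam" by (subst L2_iff) auto
  show ?thesis
  proof (rule W_imp_admissible[OF QL])
    show "AE \<xi> in lam. \<xi> \<notin> X \<longrightarrow> ?Q \<xi> = 0" by (simp add: off)
    show "AE \<xi> in lam. \<xi> \<in> X \<longrightarrow> W ?Q \<xi> = 1"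
      using AE_good[OF W]
    proof (rule AE_mp, intro AE_I2 impI)
      fix \<xi> assume "\<xi> \<in> space lam" "\<xi> \<in> X \<longrightarrow> \<xi> \<in> good P" "\<xi> \<in> X"
      then show "W ?Q \<xi> = 1" using W_normalized[OF P, of \<xi>] by simp
    qed
  qed
qed

section \<open>The equivalence\<close>

lemma unimodular_iff: "unimodular_G HH dx dh \<longleftrightarrow> (\<forall>h\<in>HH. modular_H dh h / delta dx h = 1)"
  by (simp add: unimodular_G_def modular_G_def)

theorem admissible_iff:
  "(\<exists>\<psi>. admissible dx dh (HX dx lam X) \<psi>) \<longleftrightarrow>
     ((\<exists>\<psi>. weakly_admissible dx dh (HX dx lam X) \<psi>) \<and>
      (\<not> unimodular_G HH dx dh \<or>
       (unimodular_G HH dx dh \<and>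
        (\<exists>lb. is_orbit_disintegration HH dh lam X lb \<and> emeasure lb (space lb) < \<infinity>))))"
proof (intro iffI conjI; (elim conjE)?)
  assume "\<exists>\<psi>. admissible dx dh (HX dx lam X) \<psi>"
  then show "\<exists>\<psi>. weakly_admissible dx dh (HX dx lam X) \<psi>"
    using admissible_imp_weakly_admissible by blast
next
  assume "\<exists>\<psi>. admissible dx dh (HX dx lam X) \<psi>"
  then obtain \<psi> where a: "admissible dx dh (HX dx lam X) \<psi>" ..
  obtain P where P: "P \<in> L2 lam" "AE \<xi> in lam. \<xi> \<in> X \<longrightarrow> W P \<xi> = 1"
    by (rule admissible_imp_W[OF a])
  \<comment> \<open>The condition asserts that a disintegrating measure exists, so this direction
    has to construct the measure as well as bound its mass.\<close>
  have "\<exists>lb. is_orbit_disintegration HH dh lam X lb \<and> emeasure lb (space lb) < \<infinity>"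
    if u: "unimodular_G HH dx dh"
  proof (rule disintegration_of_admissible[OF P])
    fix h assume h: "h \<in> HH"
    then have "modular_H dh h / delta dx h = 1" using u unfolding unimodular_iff by blast
    then show "modular_H dh h = delta dx h" using delta_pos[OF h] by simp
  qed
  then show "\<not> unimodular_G HH dx dh \<or> (unimodular_G HH dx dh \<and>
      (\<exists>lb. is_orbit_disintegration HH dh lam X lb \<and> emeasure lb (space lb) < \<infinity>))" by blast
next
  assume "\<exists>\<psi>. weakly_admissible dx dh (HX dx lam X) \<psi>"
    and c: "\<not> unimodular_G HH dx dh \<or> (unimodular_G HH dx dh \<and>
      (\<exists>lb. is_orbit_disintegration HH dh lam X lb \<and> emeasure lb (space lb) < \<infinity>))"
  then obtain \<psi> where w: "weakly_admissible dx dh (HX dx lam X) \<psi>" by blast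
  obtain P where P: "P \<in> L2 lam" "AE \<xi> in lam. \<xi> \<in> X \<longrightarrow> 0 < W P \<xi> \<and> W P \<xi> < \<infinity>"
    by (rule weakly_admissible_imp_W[OF w])
  from c show "\<exists>\<psi>. admissible dx dh (HX dx lam X) \<psi>"
  proof
    assume "\<not> unimodular_G HH dx dh"
    then obtain k where "k \<in> HH" "modular_H dh k / delta dx k \<noteq> 1" unfolding unimodular_iff by blast
    then show ?thesis by (rule admissible_nonunimodular[OF P])
  next
    assume "unimodular_G HH dx dh \<and> (\<exists>lb. is_orbit_disintegration HH dh lam X lb \<and> emeasure lb (space lb) < \<infinity>)"
    then obtain lb where "is_orbit_disintegration HH dh lam X lb" "emeasure lb (space lb) < \<infinity>" by blast
    then show ?thesis by (rule admissible_of_disintegration[OF P])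
  qed
qed

end

theorem mainTheorem14:
  fixes dx :: "'a::{topological_ab_group_add, t2_space, second_countable_topology} measure"
    and lam :: "('a \<Rightarrow> complex) measure"
    and HH :: "('a \<Rightarrow> 'a) set"
    and TH :: "('a \<Rightarrow> 'a) topology"
    and dh :: "('a \<Rightarrow> 'a) measure"
    and X :: "('a \<Rightarrow> complex) set"
  assumes A_lc: "locally_compact_space (euclidean :: 'a topology)"
    and haarA: "is_haar_A dx"
    and haar_dual: "is_plancherel_dual_haar dx lam"
    and Hgrp: "is_auto_group HH TH"
    and haarH: "is_left_haar_H HH TH dh"
    and X_borel: "X \<in> sets lam"
    and X_inv: "\<forall>\<xi>\<in>X. \<forall>h\<in>HH. \<xi> \<circ> h \<in> X"
  shows "(\<exists>\<psi>. admissible dx dh (HX dx lam X) \<psi>) \<longleftrightarrow>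
         ((\<exists>\<psi>. weakly_admissible dx dh (HX dx lam X) \<psi>) \<and>
          (\<not> unimodular_G HH dx dh \<or>
           (unimodular_G HH dx dh \<and>
            (\<exists>lb. is_orbit_disintegration HH dh lam X lb \<and> emeasure lb (space lb) < \<infinity>))))"
proof -
  interpret semidirect dx lam HH TH dh X
    by unfold_locales (rule A_lc haarA haar_dual Hgrp haarH X_borel X_inv)+
  show ?thesis by (rule admissible_iff)
qed

end
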